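(* Let $R$ be a local fqp-ring which is not a chain ring and $N$ its nilradical. Consider the following conditions: (1) $R$ is a linearly compact ring; (2) each ideal of $R$ is quasi-projective; (3) $N$ is of finite rank over $R/N$. Then (1) holds if and only if both (2) and (3) hold.
   Context: All rings are commutative with unity. A local ring is a ring with exactly one maximal ideal (no Noetherian assumption). A chain ring (valuation ring) is a ring whose ideals are totally ordered by inclusion. An $R$-module $V$ is quasi-projective if the natural homomorphism $\mathrm{Hom}_R(V,V)\rightarrow\mathrm{Hom}_R(V,V/X)$ is surjective for every submodule $X$ of $V$. $R$ is an fqp-ring if every finitely generated ideal of $R$ is quasi-projective. It is known that a local ring $R$ with nilradical $N$ is an fqp-ring if and only if either $R$ is a chain ring or $R/N$ is a valuation domain and $N$ is a divisible torsionfree $R/N$-module. Thus, for $R$ as in the statement, $N$ is a vector space over the quotient field $Q'$ of $R/N$; the rank of $N$ over $R/N$ is the dimension of this vector space. An $R$-module $M$ is linearly compact if every finitely solvable set of congruences $x\equiv x_\alpha\ (\mathrm{mod}\ M_\alpha)$ ($\alpha\in\Lambda$, $x_\alpha\in M$, $M_\alpha$ a submodule of $M$ for each $\alpha\in\Lambda$) has a simultaneous solution in $M$. A ring is linearly compact if it is linearly compact as a module over itself. *)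

theory Defs
  imports "HOL-Algebra.QuotRing" "Jordan_Normal_Form.Missing_VectorSpace"
begin

text \<open>
  The record \<^typ>\<open>('a, 'b) module\<close> extends the ring record, so its fields \<open>mult\<close> and \<open>one\<close>
  carry no information about a module; they are left undefined below. The notions
  \<open>submodule\<close>, \<open>module_hom\<close> and \<open>vectorspace.fin_dim\<close> are those of the AFP entry VectorSpace.
\<close>

definition local_ring :: "('a, 'm) ring_scheme \<Rightarrow> bool" where
  "local_ring R \<longleftrightarrow> cring R \<and> (\<exists>!M. maximalideal M R)"

definition chain_ring :: "('a, 'm) ring_scheme \<Rightarrow> bool" where
  "chain_ring R \<longleftrightarrow> cring R \<and> (\<forall>I J. ideal I R \<and> ideal J R \<longrightarrow> I \<subseteq> J \<or> J \<subseteq> I)"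

definition nilradical :: "('a, 'm) ring_scheme \<Rightarrow> 'a set" where
  "nilradical R = {x \<in> carrier R. \<exists>n::nat. x [^]\<^bsub>R\<^esub> n = \<zero>\<^bsub>R\<^esub>}"

definition ideal_module :: "('a, 'm) ring_scheme \<Rightarrow> 'a set \<Rightarrow> ('a, 'a) module" where
  "ideal_module R I =
     \<lparr>carrier = I, monoid.mult = undefined, monoid.one = undefined,
      ring.zero = \<zero>\<^bsub>R\<^esub>, ring.add = ring.add R, smult = monoid.mult R\<rparr>"


subsection \<open>Quasi-projective modules\<close>

definition quotient_module ::
  "('a, 'b, 'n) module_scheme \<Rightarrow> 'b set \<Rightarrow> ('a, 'b set) module" where
  "quotient_module V U =
     \<lparr>carrier = a_rcosets\<^bsub>V\<^esub> U, monoid.mult = undefined, monoid.one = undefined,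
      ring.zero = U, ring.add = set_add V,
      smult = (\<lambda>r C. \<Union>v\<in>C. U +>\<^bsub>V\<^esub> (r \<odot>\<^bsub>V\<^esub> v))\<rparr>"

definition quasi_projective ::
  "('a, 'm) ring_scheme \<Rightarrow> ('a, 'b, 'n) module_scheme \<Rightarrow> bool" where
  "quasi_projective R V \<longleftrightarrow>
     module R V \<and>
     (\<forall>U. submodule R U V \<longrightarrow>
        (\<forall>f \<in> module_hom R V (quotient_module V U).
           \<exists>g \<in> module_hom R V V. \<forall>v \<in> carrier V. U +>\<^bsub>V\<^esub> g v = f v))"

definition fqp_ring :: "('a, 'm) ring_scheme \<Rightarrow> bool" where
  "fqp_ring R \<longleftrightarrow>
     cring R \<and>
     (\<forall>S. finite S \<and> S \<subseteq> carrier R \<longrightarrow> quasi_projective R (ideal_module R (genideal R S)))"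


subsection \<open>Linear compactness\<close>

text \<open>
  A pair \<open>(a, U)\<close> stands for the congruence \<open>x \<equiv> a (mod U)\<close>. Solvability of a family of
  congruences depends only on the set of pairs occurring in it, so no index set is needed.
\<close>

definition solves_congruences ::
  "('a, 'b, 'n) module_scheme \<Rightarrow> ('b \<times> 'b set) set \<Rightarrow> 'b \<Rightarrow> bool" where
  "solves_congruences M F x \<longleftrightarrow> x \<in> carrier M \<and> (\<forall>(a, U) \<in> F. x \<ominus>\<^bsub>M\<^esub> a \<in> U)"

definition linearly_compact ::
  "('a, 'm) ring_scheme \<Rightarrow> ('a, 'b, 'n) module_scheme \<Rightarrow> bool" where
  "linearly_compact R M \<longleftrightarrow>
     module R M \<and>
     (\<forall>F. (\<forall>(a, U) \<in> F. a \<in> carrier M \<and> submodule R U M) \<and>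
          (\<forall>G. G \<subseteq> F \<and> finite G \<longrightarrow> (\<exists>x. solves_congruences M G x))
          \<longrightarrow> (\<exists>x. solves_congruences M F x))"

definition linearly_compact_ring :: "('a, 'm) ring_scheme \<Rightarrow> bool" where
  "linearly_compact_ring R \<longleftrightarrow> cring R \<and> linearly_compact R (ideal_module R (carrier R))"


subsection \<open>The rank of a divisible torsionfree module\<close>

definition fraction_rel :: "('a, 'm) ring_scheme \<Rightarrow> (('a \<times> 'a) \<times> ('a \<times> 'a)) set" where
  "fraction_rel D =
     {((a, s), (b, t)) | a s b t.
        a \<in> carrier D \<and> b \<in> carrier D \<and>
        s \<in> carrier D - {\<zero>\<^bsub>D\<^esub>} \<and> t \<in> carrier D - {\<zero>\<^bsub>D\<^esub>} \<and>
        a \<otimes>\<^bsub>D\<^esub> t = b \<otimes>\<^bsub>D\<^esub> s}"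

definition fraction :: "('a, 'm) ring_scheme \<Rightarrow> 'a \<Rightarrow> 'a \<Rightarrow> ('a \<times> 'a) set" where
  "fraction D a s = fraction_rel D `` {(a, s)}"

definition quotient_field :: "('a, 'm) ring_scheme \<Rightarrow> ('a \<times> 'a) set ring" where
  "quotient_field D =
     \<lparr>carrier = (carrier D \<times> (carrier D - {\<zero>\<^bsub>D\<^esub>})) // fraction_rel D,
      monoid.mult = (\<lambda>p q. \<Union>(a, s)\<in>p. \<Union>(b, t)\<in>q. fraction D (a \<otimes>\<^bsub>D\<^esub> b) (s \<otimes>\<^bsub>D\<^esub> t)),
      monoid.one = fraction D \<one>\<^bsub>D\<^esub> \<one>\<^bsub>D\<^esub>,
      ring.zero = fraction D \<zero>\<^bsub>D\<^esub> \<one>\<^bsub>D\<^esub>,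
      ring.add = (\<lambda>p q. \<Union>(a, s)\<in>p. \<Union>(b, t)\<in>q.
               fraction D ((a \<otimes>\<^bsub>D\<^esub> t) \<oplus>\<^bsub>D\<^esub> (b \<otimes>\<^bsub>D\<^esub> s)) (s \<otimes>\<^bsub>D\<^esub> t))\<rparr>"

text \<open>
  If \<open>M\<close> is a divisible torsionfree module over the domain \<open>D\<close>, then \<open>s \<odot> n = a \<odot> m\<close> has
  exactly one solution \<open>n\<close> for \<open>s \<noteq> 0\<close>, namely \<open>(a/s) \<odot> m\<close>; this is the only vector space
  structure over the quotient field that extends the given module structure.
\<close>

definition quotient_field_space ::
  "('a, 'm) ring_scheme \<Rightarrow> ('a, 'b, 'n) module_scheme \<Rightarrow> (('a \<times> 'a) set, 'b) module" where
  "quotient_field_space D M =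
     \<lparr>carrier = carrier M, monoid.mult = undefined, monoid.one = undefined,
      ring.zero = \<zero>\<^bsub>M\<^esub>, ring.add = ring.add M,
      smult = (\<lambda>q m. THE n. n \<in> carrier M \<and> (\<forall>(a, s) \<in> q. s \<odot>\<^bsub>M\<^esub> n = a \<odot>\<^bsub>M\<^esub> m))\<rparr>"

text \<open>Meaningful only for a divisible torsionfree module \<open>M\<close> over a domain \<open>D\<close>.\<close>

definition finite_rank :: "('a, 'm) ring_scheme \<Rightarrow> ('a, 'b, 'n) module_scheme \<Rightarrow> bool" where
  "finite_rank D M \<longleftrightarrow> vectorspace.fin_dim (quotient_field D) (quotient_field_space D M)"

text \<open>
  An \<open>R\<close>-module annihilated by the ideal \<open>I\<close>, regarded as an \<open>R/I\<close>-module: \<open>r \<odot> m\<close> is then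
  the same for all \<open>r\<close> in a coset \<open>C\<close> of \<open>I\<close>.
\<close>

definition module_over_quotient ::
  "('a, 'b, 'n) module_scheme \<Rightarrow> ('a set, 'b) module" where
  "module_over_quotient M =
     \<lparr>carrier = carrier M, monoid.mult = undefined, monoid.one = undefined,
      ring.zero = \<zero>\<^bsub>M\<^esub>, ring.add = ring.add M,
      smult = (\<lambda>C m. the_elem ((\<lambda>r. r \<odot>\<^bsub>M\<^esub> m) ` C))\<rparr>"

end

theory Submission
  imports Defs "HOL.Hull"
begin

text \<open>
  Submodules instead of quotients: a homomorphism \<open>I \<rightarrow> I/U\<close> amounts to a submodule \<open>G\<close> of \<open>I \<times> I\<close>
  with domain \<open>I\<close>, and a lift of it to an endomorphism whose graph is contained in \<open>G\<close>. So an ideal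
  is quasi-projective iff every such \<open>G\<close> contains a linear map with domain \<open>I\<close> (\<open>liftable\<close>).

  Structure of \<open>R\<close>. If neither of \<open>a\<close>, \<open>b\<close> is a multiple of the other, quasi-projectivity of
  \<open>Ra + Rb\<close> gives \<open>Ra \<inter> Rb = 0\<close> and \<open>ann a = ann b\<close> (\<open>incomparable_disjoint\<close>,
  \<open>incomparable_annihilator\<close>). It follows that \<open>N\<close> is prime with \<open>N\<^sup>2 = 0\<close>, that elements outside
  \<open>N\<close> are comparable with everything, and that they act on \<open>N\<close> bijectively. Thus \<open>N\<close> is a vector
  space over the quotient field \<open>Q\<close> of \<open>R/N\<close>. Its subspaces are the ideals \<open>U \<subseteq> N\<close> with
  \<open>s v \<in> U \<Longrightarrow> v \<in> U\<close> for \<open>s \<notin> N\<close>, here called pure, and the span of a set is its pure hull; the rank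
  condition becomes the existence of a finite set with pure hull \<open>N\<close> (\<open>finite_rank_iff\<close>).

  Linear compactness implies finite rank, since the congruences \<open>x = e\<close> modulo the span of
  \<open>S - {e}\<close>, for \<open>e\<close> in an infinite basis \<open>S\<close>, have finite partial solutions but no common one
  (\<open>coset_compact_imp_finite_rank\<close>). It implies that all ideals are quasi-projective, because a
  lift can be extended across a step of rank one by choosing a single value, subject to a finitely
  solvable family of congruences (\<open>extend_section\<close>). For an ideal inside \<open>N\<close> finitely many steps
  suffice by finite rank; an ideal not contained in \<open>N\<close> is itself a step of rank one.

  Conversely, let all ideals be quasi-projective and the rank be finite. A finite flag of subspaces
  of \<open>N\<close>, followed by \<open>N \<subseteq> R\<close>, has factors isomorphic to \<open>Q\<close> and to \<open>R/N \<subseteq> Q\<close>, and linear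
  compactness passes to extensions (\<open>coset_compact_extension\<close>). It remains to see that
  \<open>Q \<cong> Qb \<subseteq> N\<close> is linearly compact. As \<open>R\<close> is not a chain ring, there is a second line \<open>Qa\<close> in \<open>N\<close>.
  A chain of congruences on \<open>Qb\<close> can be read as a homomorphism from a submodule \<open>B\<close> of \<open>Qa\<close> to
  \<open>Qb/Rb\<close>, and a solution is obtained from a lift of it, which exists because the ideal \<open>B + Qb\<close> is
  quasi-projective (\<open>principal_congruences_solvable\<close>).
\<close>

section \<open>Ideals as modules\<close>

lemma ideal_module_simps [simp]:
  "carrier (ideal_module R I) = I"
  "\<zero>\<^bsub>ideal_module R I\<^esub> = \<zero>\<^bsub>R\<^esub>"
  "x \<oplus>\<^bsub>ideal_module R I\<^esub> y = x \<oplus>\<^bsub>R\<^esub> y"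
  "r \<odot>\<^bsub>ideal_module R I\<^esub> x = r \<otimes>\<^bsub>R\<^esub> x"
  by (simp_all add: ideal_module_def)

lemma a_r_coset_ideal_module [simp]: "U +>\<^bsub>ideal_module R I\<^esub> v = U +>\<^bsub>R\<^esub> v"
  by (simp add: a_r_coset_def' )

lemma set_add_ideal_module [simp]: "X <+>\<^bsub>ideal_module R I\<^esub> Y = X <+>\<^bsub>R\<^esub> Y"
  by (simp add: set_add_def')

lemma a_rcosets_ideal_module [simp]: "a_rcosets\<^bsub>ideal_module R I\<^esub> U = {U +>\<^bsub>R\<^esub> v | v. v \<in> I}"
  by (auto simp: A_RCOSETS_def' a_r_coset_def')

context cring
begin

lemma module_ideal_module:
  assumes "ideal I R"
  shows "module R (ideal_module R I)"
proof -
  interpret I: ideal I R by fact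
  have "abelian_group (ideal_module R I)"
  proof (rule abelian_groupI)
    fix x assume "x \<in> carrier (ideal_module R I)"
    then show "\<exists>y\<in>carrier (ideal_module R I). y \<oplus>\<^bsub>ideal_module R I\<^esub> x = \<zero>\<^bsub>ideal_module R I\<^esub>"
      by (auto intro!: bexI[of _ "\<ominus> x"] simp: I.Icarr l_neg)
  qed (auto simp: I.Icarr a_ac)
  then show ?thesis
    by (intro moduleI is_cring) (auto simp: I.Icarr I.I_l_closed l_distr r_distr m_assoc)
qed

lemma a_minus_ideal_module:
  assumes "ideal I R" "x \<in> I" "y \<in> I"
  shows "x \<ominus>\<^bsub>ideal_module R I\<^esub> y = x \<ominus> y"
proof -
  interpret I: ideal I R by fact
  interpret M: module R "ideal_module R I" by (rule module_ideal_module) fact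
  have "\<ominus>\<^bsub>ideal_module R I\<^esub> y = \<ominus> y"
    using assms(3) M.M.r_neg[of y] by (intro minus_equality[symmetric]) (auto simp: I.Icarr a_comm M.M.a_inv_closed[of y, simplified])
  then show ?thesis by (simp add: a_minus_def)
qed

lemma ideal_ofI:
  assumes "U \<subseteq> carrier R" "\<zero> \<in> U" "\<And>x y. x \<in> U \<Longrightarrow> y \<in> U \<Longrightarrow> x \<oplus> y \<in> U"
    and "\<And>r x. r \<in> carrier R \<Longrightarrow> x \<in> U \<Longrightarrow> r \<otimes> x \<in> U"
  shows "ideal U R"
proof -
  have neg: "\<ominus> x \<in> U" if "x \<in> U" for x
    using assms(4)[of "\<ominus> \<one>" x] that assms(1) by (auto simp: l_minus)
  have mc: "x \<otimes> r \<in> U" if "r \<in> carrier R" "x \<in> U" for r x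
    using assms(1,4) that m_comm[of x r] by auto
  show ?thesis
    using assms neg
    by (intro idealI ring_axioms subgroup.intro)
      (use mc in \<open>auto simp: subset_iff a_inv_def[symmetric]\<close>)
qed

lemma submodule_ideal_module_iff:
  assumes "ideal I R"
  shows "submodule R U (ideal_module R I) \<longleftrightarrow> ideal U R \<and> U \<subseteq> I"
proof
  assume "submodule R U (ideal_module R I)"
  then interpret U: submodule R U "ideal_module R I" .
  interpret I: ideal I R by fact
  have UI: "U \<subseteq> I" using U.subset by simp
  moreover have "ideal U R"
  proof (rule ideal_ofI)
    show "U \<subseteq> carrier R" using UI I.Icarr by blast
    show "\<zero> \<in> U" using U.zero_closed by simp
    show "x \<oplus> y \<in> U" if "x \<in> U" "y \<in> U" for x y using U.m_closed[OF that] by simp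
    show "r \<otimes> x \<in> U" if "r \<in> carrier R" "x \<in> U" for r x using U.smult_closed[OF that] by simp
  qed
  ultimately show "ideal U R \<and> U \<subseteq> I" by simp
next
  assume U: "ideal U R \<and> U \<subseteq> I"
  then interpret U: ideal U R by simp
  show "submodule R U (ideal_module R I)"
    by (rule submodule.intro) (use U module_ideal_module[OF assms] U.I_l_closed in auto)
qed

lemma mem_ideal_coset_iff:
  assumes "ideal U R" "x \<in> carrier R" "y \<in> carrier R"
  shows "y \<in> U +> x \<longleftrightarrow> y \<ominus> x \<in> U"
proof -
  interpret U: ideal U R by fact
  show ?thesis using assms by (simp add: U.a_rcos_module_imp U.a_rcos_module_rev iffI U.a_rcos_module_minus ring_axioms)
qed

lemma ideal_coset_eqI:
  assumes "ideal U R" "x \<in> carrier R" "y \<in> U +> x"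
  shows "U +> y = U +> x"
proof -
  interpret U: ideal U R by fact
  show ?thesis using U.a_repr_independence'[OF assms(3,2)] by simp
qed

section \<open>Linear relations\<close>

text \<open>
  A homomorphism into a quotient of \<open>I\<close> is the same thing as a submodule of \<open>I \<times> I\<close> with domain
  \<open>I\<close>, namely the set of all pairs \<open>(v, y)\<close> with \<open>y\<close> in the image coset of \<open>v\<close>. Working with
  such relations makes the quotient disappear from all lifting arguments.
\<close>

definition linear_relation :: "('a \<times> 'a) set \<Rightarrow> bool" where
  "linear_relation G \<longleftrightarrow> G \<subseteq> carrier R \<times> carrier R \<and> (\<zero>, \<zero>) \<in> G \<and>
     (\<forall>x y x' y'. (x, y) \<in> G \<longrightarrow> (x', y') \<in> G \<longrightarrow> (x \<oplus> x', y \<oplus> y') \<in> G) \<and>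
     (\<forall>r x y. r \<in> carrier R \<longrightarrow> (x, y) \<in> G \<longrightarrow> (r \<otimes> x, r \<otimes> y) \<in> G)"

definition linear_map :: "('a \<times> 'a) set \<Rightarrow> bool" where
  "linear_map g \<longleftrightarrow> linear_relation g \<and> (\<forall>y. (\<zero>, y) \<in> g \<longrightarrow> y = \<zero>)"

lemma linear_relationI:
  assumes "\<And>x y. (x, y) \<in> G \<Longrightarrow> x \<in> carrier R \<and> y \<in> carrier R" "(\<zero>, \<zero>) \<in> G"
    and "\<And>x y x' y'. (x, y) \<in> G \<Longrightarrow> (x', y') \<in> G \<Longrightarrow> (x \<oplus> x', y \<oplus> y') \<in> G"
    and "\<And>r x y. r \<in> carrier R \<Longrightarrow> (x, y) \<in> G \<Longrightarrow> (r \<otimes> x, r \<otimes> y) \<in> G"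
  shows "linear_relation G"
  using assms unfolding linear_relation_def by auto

lemma linear_relationD:
  assumes "linear_relation G"
  shows "(x, y) \<in> G \<Longrightarrow> x \<in> carrier R" "(x, y) \<in> G \<Longrightarrow> y \<in> carrier R" "(\<zero>, \<zero>) \<in> G"
    "(x, y) \<in> G \<Longrightarrow> (x', y') \<in> G \<Longrightarrow> (x \<oplus> x', y \<oplus> y') \<in> G"
    "r \<in> carrier R \<Longrightarrow> (x, y) \<in> G \<Longrightarrow> (r \<otimes> x, r \<otimes> y) \<in> G"
  using assms unfolding linear_relation_def by auto

lemma minus_self [simp]: "x \<in> carrier R \<Longrightarrow> x \<ominus> x = \<zero>"
  by (simp add: a_minus_def r_neg)

lemma linear_relation_minus:
  assumes G: "linear_relation G" and "(x, y) \<in> G" "(x', y') \<in> G"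
  shows "(x \<ominus> x', y \<ominus> y') \<in> G"
proof -
  have "(\<ominus> \<one> \<otimes> x', \<ominus> \<one> \<otimes> y') \<in> G"
    using assms by (intro linear_relationD(5)[OF G]) auto
  then have "(\<ominus> x', \<ominus> y') \<in> G"
    using linear_relationD(1,2)[OF G assms(3)] by (simp add: l_minus)
  then show ?thesis
    unfolding a_minus_def by (rule linear_relationD(4)[OF G assms(2)])
qed

lemma linear_relation_Domain: "linear_relation G \<Longrightarrow> ideal (Domain G) R"
  by (rule ideal_ofI) (force dest: linear_relationD)+

lemma linear_relation_fibre: "linear_relation G \<Longrightarrow> ideal {y. (\<zero>, y) \<in> G} R"
proof (rule ideal_ofI)
  fix x y assume "linear_relation G" and "x \<in> {y. (\<zero>, y) \<in> G}" "y \<in> {y. (\<zero>, y) \<in> G}"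
  then show "x \<oplus> y \<in> {y. (\<zero>, y) \<in> G}"
    using linear_relationD(4)[of G \<zero> x \<zero> y] by simp
next
  fix r x assume "linear_relation G" and "r \<in> carrier R" "x \<in> {y. (\<zero>, y) \<in> G}"
  then show "r \<otimes> x \<in> {y. (\<zero>, y) \<in> G}"
    using linear_relationD(5)[of G r \<zero> x] by simp
qed (auto dest: linear_relationD)

lemma linear_relation_Int: "linear_relation G \<Longrightarrow> linear_relation H \<Longrightarrow> linear_relation (G \<inter> H)"
  by (rule linear_relationI) (auto dest: linear_relationD)

lemma linear_relation_Times:
  assumes "ideal A R" "ideal B R"
  shows "linear_relation (A \<times> B)"
proof -
  interpret A: ideal A R + B: ideal B R by fact+
  show ?thesis by (rule linear_relationI) (auto simp: A.Icarr B.Icarr A.I_l_closed B.I_l_closed)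
qed

lemma linear_map_unique:
  assumes "linear_map g" "(x, y) \<in> g" "(x, z) \<in> g"
  shows "y = z"
proof -
  have g: "linear_relation g" using assms(1) by (simp add: linear_map_def)
  have "(x \<ominus> x, y \<ominus> z) \<in> g" by (rule linear_relation_minus[OF g]) fact+
  then have "y \<ominus> z = \<zero>"
    using assms linear_relationD(1)[OF g assms(2)] by (simp add: linear_map_def)
  then show ?thesis using linear_relationD(2)[OF g] assms by simp
qed

definition liftable :: "'a set \<Rightarrow> bool" where
  "liftable I \<longleftrightarrow> (\<forall>G. linear_relation G \<and> Domain G = I \<and> Range G \<subseteq> I \<longrightarrow>
      (\<exists>g. g \<subseteq> G \<and> linear_map g \<and> Domain g = I))"

lemma liftableE:
  assumes "liftable I" "linear_relation G" "Domain G = I" "Range G \<subseteq> I"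
  obtains g where "g \<subseteq> G" "linear_map g" "Domain g = I"
  using assms(1)[unfolded liftable_def, rule_format, of G] assms(2-4) by metis

text \<open>
  Let \<open>U\<close> be the fibre of \<open>G\<close> over \<open>0\<close>. Then \<open>v \<mapsto> G `` {v}\<close> is a homomorphism to \<open>I/U\<close>, and the graph
  of a lift is contained in \<open>G\<close>.
\<close>

lemma quasi_projective_imp_liftable:
  assumes I: "ideal I R" and qp: "quasi_projective R (ideal_module R I)"
  shows "liftable I"
  unfolding liftable_def
proof (intro allI impI)
  interpret I: ideal I R by fact
  fix G assume "linear_relation G \<and> Domain G = I \<and> Range G \<subseteq> I"
  then have G: "linear_relation G" and dom: "Domain G = I" and ran: "Range G \<subseteq> I" by auto
  define U where "U = {y. (\<zero>, y) \<in> G}"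
  have U: "ideal U R" unfolding U_def by (rule linear_relation_fibre[OF G])
  have UI: "U \<subseteq> I" using ran by (auto simp: U_def)
  have fib: "G `` {v} = U +> y" if vy: "(v, y) \<in> G" for v y
  proof -
    have v: "v \<in> carrier R" and y: "y \<in> carrier R" using linear_relationD[OF G] vy by blast+
    have "z \<in> U +> y \<longleftrightarrow> (v, z) \<in> G" if z: "z \<in> carrier R" for z
    proof -
      have "(\<zero>, z \<ominus> y) \<in> G \<longleftrightarrow> (v, z) \<in> G"
      proof
        assume "(\<zero>, z \<ominus> y) \<in> G"
        from linear_relationD(4)[OF G this vy] show "(v, z) \<in> G"
          using v y z by (simp add: a_minus_def a_assoc l_neg)
      next
        assume "(v, z) \<in> G"
        from linear_relation_minus[OF G this vy] show "(\<zero>, z \<ominus> y) \<in> G" using v by simp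
      qed
      then show ?thesis using mem_ideal_coset_iff[OF U y z] by (simp add: U_def)
    qed
    moreover have "U +> y \<subseteq> carrier R"
      using y ideal.Icarr[OF U] by (auto simp: a_r_coset_def')
    moreover have "G `` {v} \<subseteq> carrier R" using linear_relationD[OF G] by blast
    ultimately show ?thesis by blast
  qed
  have fib': "\<exists>y\<in>I. (v, y) \<in> G \<and> G `` {v} = U +> y" if "v \<in> I" for v
    using that dom ran fib by blast
  have coset_add: "(U +> y) <+> (U +> z) = U +> (y \<oplus> z)" if "y \<in> I" "z \<in> I" for y z
    using that ideal.a_rcos_sum[OF U] by (simp add: I.Icarr)
  have coset_smult: "(\<Union>w\<in>U +> y. U +> (r \<otimes> w)) = U +> (r \<otimes> y)" if "r \<in> carrier R" "y \<in> I" for r y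
  proof -
    have "U +> (r \<otimes> w) = U +> (r \<otimes> y)" if w: "w \<in> U +> y" for w
    proof (rule ideal_coset_eqI[OF U])
      obtain u where "u \<in> U" "w = u \<oplus> y" using w by (auto simp: a_r_coset_def')
      then show "r \<otimes> w \<in> U +> (r \<otimes> y)"
        using \<open>r \<in> carrier R\<close> \<open>y \<in> I\<close> ideal.I_l_closed[OF U, of u r]
        by (auto simp: a_r_coset_def' r_distr I.Icarr ideal.Icarr[OF U])
    qed (use \<open>r \<in> carrier R\<close> \<open>y \<in> I\<close> in \<open>auto simp: I.Icarr\<close>)
    moreover have "U +> y \<noteq> {}"
      using additive_subgroup.zero_closed[OF ideal.axioms(1)[OF U]] by (auto simp: a_r_coset_def')
    ultimately show ?thesis by auto
  qed
  have hom: "(\<lambda>v. G `` {v}) \<in> module_hom R (ideal_module R I) (quotient_module (ideal_module R I) U)"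
    unfolding module_hom_def
  proof (intro CollectI conjI allI impI funcsetI)
    fix v assume "v \<in> carrier (ideal_module R I)"
    then show "G `` {v} \<in> carrier (quotient_module (ideal_module R I) U)"
      using fib'[of v] by (auto simp: quotient_module_def)
  next
    fix v w assume "v \<in> carrier (ideal_module R I) \<and> w \<in> carrier (ideal_module R I)"
    then have "v \<in> I" "w \<in> I" by auto
    then obtain y z where y: "y \<in> I" "(v, y) \<in> G" "G `` {v} = U +> y"
      and z: "z \<in> I" "(w, z) \<in> G" "G `` {w} = U +> z" using fib' by metis
    have "G `` {v \<oplus> w} = U +> (y \<oplus> z)" by (rule fib) (rule linear_relationD(4)[OF G y(2) z(2)])
    then show "G `` {v \<oplus>\<^bsub>ideal_module R I\<^esub> w} =
        G `` {v} \<oplus>\<^bsub>quotient_module (ideal_module R I) U\<^esub> G `` {w}"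
      using y z coset_add by (simp add: quotient_module_def)
  next
    fix r v assume "r \<in> carrier R \<and> v \<in> carrier (ideal_module R I)"
    then have rv: "r \<in> carrier R" "v \<in> I" by auto
    then obtain y where y: "y \<in> I" "(v, y) \<in> G" "G `` {v} = U +> y" using fib' by metis
    have "G `` {r \<otimes> v} = U +> (r \<otimes> y)" by (rule fib) (rule linear_relationD(5)[OF G rv(1) y(2)])
    then show "G `` {r \<odot>\<^bsub>ideal_module R I\<^esub> v} = r \<odot>\<^bsub>quotient_module (ideal_module R I) U\<^esub> (G `` {v})"
      using y rv coset_smult by (simp add: quotient_module_def)
  qed
  have sub: "submodule R U (ideal_module R I)"
    using submodule_ideal_module_iff[OF I] U UI by simp
  have "\<exists>f\<in>module_hom R (ideal_module R I) (ideal_module R I).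
      \<forall>v\<in>carrier (ideal_module R I). U +>\<^bsub>ideal_module R I\<^esub> f v = G `` {v}"
    by (rule qp[unfolded quasi_projective_def, THEN conjunct2, rule_format, OF sub hom])
  then obtain f where f: "f \<in> module_hom R (ideal_module R I) (ideal_module R I)"
    and lift: "\<And>v. v \<in> I \<Longrightarrow> U +> f v = G `` {v}"
    by auto
  have fI: "f v \<in> I" if "v \<in> I" for v using module_hom_closed[OF f] that by auto
  have fadd: "f (v \<oplus> w) = f v \<oplus> f w" if "v \<in> I" "w \<in> I" for v w
    using module_hom_add[OF f] that by simp
  have fsm: "f (r \<otimes> v) = r \<otimes> f v" if "r \<in> carrier R" "v \<in> I" for r v
    using module_hom_smult[OF f] that by simp
  have f0: "f \<zero> = \<zero>" using fsm[of \<zero> \<zero>] fI[of \<zero>] by (simp add: I.Icarr)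
  define g where "g = {(v, f v) | v. v \<in> I}"
  have "f v \<in> U +> f v" if "v \<in> I" for v
    using fI[OF that] additive_subgroup.zero_closed[OF ideal.axioms(1)[OF U]]
    by (force simp: a_r_coset_def' I.Icarr)
  then have "g \<subseteq> G" using lift by (force simp: g_def)
  moreover have "linear_map g" unfolding linear_map_def
  proof
    show "linear_relation g"
      by (rule linear_relationI) (auto simp: g_def I.Icarr fI fadd fsm f0 I.I_l_closed)
  qed (auto simp: g_def f0)
  moreover have "Domain g = I" by (auto simp: g_def)
  ultimately show "\<exists>g\<subseteq>G. linear_map g \<and> Domain g = I" by blast
qed

lemma liftable_imp_quasi_projective:
  assumes I: "ideal I R" and lift: "liftable I"
  shows "quasi_projective R (ideal_module R I)"
  unfolding quasi_projective_def
proof (intro conjI allI impI ballI)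
  interpret I: ideal I R by fact
  show "module R (ideal_module R I)" by (rule module_ideal_module[OF I])
  fix U f assume "submodule R U (ideal_module R I)"
    and f: "f \<in> module_hom R (ideal_module R I) (quotient_module (ideal_module R I) U)"
  then have U: "ideal U R" and UI: "U \<subseteq> I" using submodule_ideal_module_iff[OF I] by auto
  have fI: "\<exists>y\<in>I. f v = U +> y" if "v \<in> I" for v
    using module_hom_closed[OF f] that by (auto simp: quotient_module_def Pi_iff)
  have fadd: "f (v \<oplus> w) = f v <+> f w" if "v \<in> I" "w \<in> I" for v w
    using module_hom_add[OF f] that by (simp add: quotient_module_def)
  have fsm: "f (r \<otimes> v) = (\<Union>w\<in>f v. U +> (r \<otimes> w))" if "r \<in> carrier R" "v \<in> I" for r v
    using module_hom_smult[OF f] that by (simp add: quotient_module_def)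
  have self: "y \<in> U +> y" if "y \<in> I" for y
    using that additive_subgroup.zero_closed[OF ideal.axioms(1)[OF U]]
    by (force simp: a_r_coset_def' I.Icarr)
  have sub: "f v \<subseteq> I" if v: "v \<in> I" for v
  proof -
    obtain y where "y \<in> I" "f v = U +> y" using fI[OF v] by blast
    then show ?thesis using UI I.a_closed by (auto simp: a_r_coset_def')
  qed
  define G where "G = {(v, y). v \<in> I \<and> y \<in> f v}"
  have Gsm: "(r \<otimes> v, r \<otimes> y) \<in> G" if "(v, y) \<in> G" "r \<in> carrier R" for r v y
  proof -
    have vy: "v \<in> I" "y \<in> f v" "y \<in> I" using that sub by (auto simp: G_def)
    then have "r \<otimes> y \<in> U +> (r \<otimes> y)" using that by (intro self) (simp add: I.I_l_closed)
    then show ?thesis using vy that fsm[of r v] by (auto simp: G_def I.I_l_closed)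
  qed
  have dom: "Domain G = I"   proof
    show "I \<subseteq> Domain G"
    proof
      fix v assume v: "v \<in> I"
      then obtain y where "y \<in> I" "f v = U +> y" using fI by blast
      then show "v \<in> Domain G" using v self[of y] by (auto simp: G_def)
    qed
  qed (auto simp: G_def)
  have G: "linear_relation G"
  proof (rule linear_relationI)
    obtain y where "(\<zero>, y) \<in> G" using dom I.zero_closed by blast
    then show "(\<zero>, \<zero>) \<in> G" using Gsm[of \<zero> y \<zero>] sub[OF I.zero_closed] I.Icarr[of y] by (auto simp: G_def)
  next
    fix v y w z assume "(v, y) \<in> G" "(w, z) \<in> G"
    then show "(v \<oplus> w, y \<oplus> z) \<in> G" using fadd[of v w] by (auto simp: G_def set_add_def')
  next
    fix v y assume "(v, y) \<in> G"
    then show "v \<in> carrier R \<and> y \<in> carrier R" using sub[of v] I.Icarr by (auto simp: G_def)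
  qed (rule Gsm)
  have "Range G \<subseteq> I" using sub by (auto simp: G_def)
  then obtain g where gG: "g \<subseteq> G" and g: "linear_map g" and domg: "Domain g = I"
    using liftableE[OF lift G dom] by metis
  have glin: "linear_relation g" using g by (simp add: linear_map_def)
  define h where "h v = (SOME y. (v, y) \<in> g)" for v
  have h: "(v, h v) \<in> g" if "v \<in> I" for v
    unfolding h_def using that domg by (metis DomainE someI)
  have hI: "h v \<in> I" if "v \<in> I" for v using h[OF that] gG sub by (auto simp: G_def)
  have "h \<in> module_hom R (ideal_module R I) (ideal_module R I)"
    unfolding module_hom_def
  proof (intro CollectI conjI allI impI funcsetI)
    fix v w assume "v \<in> carrier (ideal_module R I) \<and> w \<in> carrier (ideal_module R I)"
    then show "h (v \<oplus>\<^bsub>ideal_module R I\<^esub> w) = h v \<oplus>\<^bsub>ideal_module R I\<^esub> h w"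
      using linear_map_unique[OF g h[of "v \<oplus> w"] linear_relationD(4)[OF glin h[of v] h[of w]]] by simp
  next
    fix r v assume "r \<in> carrier R \<and> v \<in> carrier (ideal_module R I)"
    then show "h (r \<odot>\<^bsub>ideal_module R I\<^esub> v) = r \<odot>\<^bsub>ideal_module R I\<^esub> h v"
      using linear_map_unique[OF g h[of "r \<otimes> v"] linear_relationD(5)[OF glin _ h[of v], of r]]
      by (simp add: I.I_l_closed)
  qed (use hI in auto)
  moreover have "U +>\<^bsub>ideal_module R I\<^esub> h v = f v" if "v \<in> carrier (ideal_module R I)" for v
  proof -
    have v: "v \<in> I" using that by simp
    then obtain y where "y \<in> I" "f v = U +> y" using fI by blast
    moreover have "h v \<in> f v" using h[OF v] gG by (auto simp: G_def)
    ultimately show ?thesis using ideal_coset_eqI[OF U, of y "h v"] by (simp add: I.Icarr)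
  qed
  ultimately show "\<exists>g\<in>module_hom R (ideal_module R I) (ideal_module R I).
      \<forall>v\<in>carrier (ideal_module R I). U +>\<^bsub>ideal_module R I\<^esub> g v = f v" by blast
qed

end

section \<open>Local rings\<close>

context cring
begin

lemma nonunit_in_maximalideal:
  assumes x: "x \<in> carrier R" "x \<notin> Units R"
  shows "\<exists>M. maximalideal M R \<and> x \<in> M"
proof -
  let ?A = "{J. ideal J R \<and> x \<in> J \<and> \<one> \<notin> J}"
  have pidl: "PIdl x \<in> ?A"
  proof -
    have "\<one> \<notin> PIdl x"
    proof
      assume "\<one> \<in> PIdl x"
      then obtain r where "r \<in> carrier R" "\<one> = r \<otimes> x" by (auto simp: cgenideal_def)
      then have "x \<in> Units R" using x(1) by (auto simp: Units_def m_comm intro!: bexI[of _ r])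
      then show False using x(2) by simp
    qed
    then show ?thesis using x(1) by (simp add: cgenideal_ideal cgenideal_self)
  qed
  have "\<exists>M\<in>?A. \<forall>X\<in>?A. M \<subseteq> X \<longrightarrow> X = M"
  proof (rule subset_Zorn_nonempty)
    show "?A \<noteq> {}" using pidl by (metis empty_iff)
  next
    fix C assume C: "C \<noteq> {}" and ch: "subset.chain ?A C"
    have sub: "ideal J R" "x \<in> J" "\<one> \<notin> J" if "J \<in> C" for J
      using ch that by (auto simp: subset_chain_def)
    have "ideal (\<Union>C) R"
    proof (rule ideal_ofI)
      show "\<Union>C \<subseteq> carrier R" by (meson Union_least sub(1) subsetI ideal.Icarr)
      obtain J where "J \<in> C" using C by blast
      then show "\<zero> \<in> \<Union>C" using additive_subgroup.zero_closed[OF ideal.axioms(1)[OF sub(1)]] by blast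
      show "r \<otimes> y \<in> \<Union>C" if r: "r \<in> carrier R" and y: "y \<in> \<Union>C" for r y
      proof -
        obtain J where "J \<in> C" "y \<in> J" using y by blast
        then show ?thesis using ideal.I_l_closed[OF sub(1) _ r] by blast
      qed
      fix y z assume "y \<in> \<Union>C" "z \<in> \<Union>C"
      then obtain J K where JK: "J \<in> C" "K \<in> C" "y \<in> J" "z \<in> K" by blast
      then have "J \<subseteq> K \<or> K \<subseteq> J" using ch by (auto simp: subset_chain_def)
      then obtain L where "L \<in> C" "y \<in> L" "z \<in> L" using JK by blast
      then show "y \<oplus> z \<in> \<Union>C" using additive_subgroup.a_closed[OF ideal.axioms(1)[OF sub(1)]] by blast
    qed
    then show "\<Union>C \<in> ?A" using C sub by auto
  qed
  then obtain M where "M \<in> ?A" and max0: "\<forall>X\<in>?A. M \<subseteq> X \<longrightarrow> X = M" by (elim bexE)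
  then have M: "ideal M R" "x \<in> M" "\<one> \<notin> M" by auto
  have max: "J = M" if "ideal J R" "\<one> \<notin> J" "M \<subseteq> J" for J
    using bspec[OF max0, of J] that M(2) by auto
  have "maximalideal M R"
  proof (rule maximalidealI[OF M(1)])
    show "carrier R \<noteq> M" using M(3) by auto
    show "J = M \<or> J = carrier R" if "ideal J R" "M \<subseteq> J" "J \<subseteq> carrier R" for J
      using max[of J] ideal.one_imp_carrier[of J R] that by blast
  qed
  then show ?thesis using M(2) by blast
qed

lemma local_ring_nonunits_ideal:
  assumes "local_ring R"
  shows "\<exists>P. ideal P R \<and> (\<forall>x\<in>carrier R. x \<in> P \<longleftrightarrow> x \<notin> Units R)"
proof -
  obtain P where P: "maximalideal P R" and uniq: "\<And>M. maximalideal M R \<Longrightarrow> M = P"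
    using assms unfolding local_ring_def by blast
  interpret P: maximalideal P R by fact
  show ?thesis
  proof (intro exI conjI ballI)
    show "ideal P R" by (rule P.is_ideal)
    fix x assume x: "x \<in> carrier R"
    show "x \<in> P \<longleftrightarrow> x \<notin> Units R"
    proof
      assume "x \<in> P"
      show "x \<notin> Units R"
      proof
        assume "x \<in> Units R"
        then have "inv x \<otimes> x \<in> P" using \<open>x \<in> P\<close> by (intro P.I_l_closed) auto
        then have "P = carrier R" using \<open>x \<in> Units R\<close> by (intro P.one_imp_carrier) simp
        then show False using P.I_notcarr by simp
      qed
    next
      assume "x \<notin> Units R"
      then show "x \<in> P" using nonunit_in_maximalideal[OF x] uniq by blast
    qed
  qed
qed

lemma Units_l_cancel_inv: "u \<in> Units R \<Longrightarrow> x \<in> carrier R \<Longrightarrow> inv u \<otimes> (u \<otimes> x) = x"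
  using m_assoc[of "inv u" u x] Units_closed by simp

definition incomparable :: "'a \<Rightarrow> 'a \<Rightarrow> bool" where
  "incomparable a b \<longleftrightarrow> a \<in> carrier R \<and> b \<in> carrier R \<and>
     (\<forall>r\<in>carrier R. a \<noteq> r \<otimes> b \<and> b \<noteq> r \<otimes> a)"

lemma incomparable_sym: "incomparable a b \<Longrightarrow> incomparable b a"
  by (auto simp: incomparable_def)

lemma incomparableD:
  assumes "incomparable a b"
  shows "a \<in> carrier R" "b \<in> carrier R" "r \<in> carrier R \<Longrightarrow> a \<noteq> r \<otimes> b" "r \<in> carrier R \<Longrightarrow> b \<noteq> r \<otimes> a"
    "a \<noteq> \<zero>" "b \<noteq> \<zero>"
  using assms unfolding incomparable_def by (auto dest: bspec[OF _ zero_closed])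

lemma incomparable_cases:
  assumes "a \<in> carrier R" "b \<in> carrier R"
  obtains "incomparable a b" | r where "r \<in> carrier R" "a = r \<otimes> b" | r where "r \<in> carrier R" "b = r \<otimes> a"
  using assms unfolding incomparable_def by blast

lemma Idl_pair:
  assumes "a \<in> carrier R" "b \<in> carrier R"
  shows "Idl {a, b} = {x \<otimes> a \<oplus> y \<otimes> b | x y. x \<in> carrier R \<and> y \<in> carrier R}" (is "_ = ?I")
proof
  have "ideal ?I R"
  proof (rule ideal_ofI)
    show "\<zero> \<in> ?I" using assms by (auto intro!: exI[of _ \<zero>])
    fix u v assume "u \<in> ?I" "v \<in> ?I"
    then obtain x y x' y' where "x \<in> carrier R" "y \<in> carrier R" "x' \<in> carrier R" "y' \<in> carrier R"
      "u = x \<otimes> a \<oplus> y \<otimes> b" "v = x' \<otimes> a \<oplus> y' \<otimes> b" by blast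
    moreover from this assms have "u \<oplus> v = (x \<oplus> x') \<otimes> a \<oplus> (y \<oplus> y') \<otimes> b" by algebra
    ultimately show "u \<oplus> v \<in> ?I" by blast
  next
    fix r u assume r: "r \<in> carrier R" and "u \<in> ?I"
    then obtain x y where "x \<in> carrier R" "y \<in> carrier R" "u = x \<otimes> a \<oplus> y \<otimes> b" by blast
    moreover from this assms r have "r \<otimes> u = (r \<otimes> x) \<otimes> a \<oplus> (r \<otimes> y) \<otimes> b" by algebra
    ultimately show "r \<otimes> u \<in> ?I" using r by blast
  qed (use assms in auto)
  moreover have "a \<in> ?I"
  proof -
    have "a = \<one> \<otimes> a \<oplus> \<zero> \<otimes> b" using assms by simp
    then show ?thesis by blast
  qed
  moreover have "b \<in> ?I"
  proof -
    have "b = \<zero> \<otimes> a \<oplus> \<one> \<otimes> b" using assms by simp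
    then show ?thesis by blast
  qed
  ultimately show "Idl {a, b} \<subseteq> ?I" by (intro genideal_minimal) auto
  interpret J: ideal "Idl {a, b}" R using assms by (intro genideal_ideal) auto
  have "a \<in> Idl {a, b}" "b \<in> Idl {a, b}" using genideal_self[of "{a, b}"] assms by auto
  then show "?I \<subseteq> Idl {a, b}" by (auto intro!: J.a_closed J.I_l_closed)
qed

text \<open>
  The map \<open>xa + yb \<mapsto> xc + U\<close> is well defined; a lift of it sends \<open>a\<close> into \<open>c + U\<close> and \<open>b\<close> into \<open>U\<close>.
\<close>

lemma lift_two_generated:
  assumes ab: "a \<in> carrier R" "b \<in> carrier R" and lift: "liftable (Idl {a, b})"
    and U: "ideal U R" "U \<subseteq> Idl {a, b}" and c: "c \<in> Idl {a, b}"
    and wd: "\<forall>x\<in>carrier R. \<forall>y\<in>carrier R. x \<otimes> a \<oplus> y \<otimes> b = \<zero> \<longrightarrow> x \<otimes> c \<in> U"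
  shows "\<exists>a'\<in>carrier R. \<exists>b'\<in>U. a' \<ominus> c \<in> U \<and>
    (\<forall>x\<in>carrier R. \<forall>y\<in>carrier R. x \<otimes> a \<oplus> y \<otimes> b = \<zero> \<longrightarrow> x \<otimes> a' \<oplus> y \<otimes> b' = \<zero>)"
proof -
  interpret U: ideal U R by (rule U(1))
  interpret I: ideal "Idl {a, b}" R using ab by (intro genideal_ideal) auto
  have cc: "c \<in> carrier R" by (rule I.Icarr[OF c])
  define G where "G = {(x \<otimes> a \<oplus> y \<otimes> b, x \<otimes> c \<oplus> u) | x y u. x \<in> carrier R \<and> y \<in> carrier R \<and> u \<in> U}"
  have GI: "(v, z) \<in> G" if "v = x \<otimes> a \<oplus> y \<otimes> b" "z = x \<otimes> c \<oplus> u" "x \<in> carrier R" "y \<in> carrier R" "u \<in> U"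
    for v z x y u unfolding G_def using that by blast
  have GE: "\<exists>x\<in>carrier R. \<exists>y\<in>carrier R. \<exists>u\<in>U. v = x \<otimes> a \<oplus> y \<otimes> b \<and> z = x \<otimes> c \<oplus> u" if "(v, z) \<in> G" for v z
    using that unfolding G_def by blast
  have G: "linear_relation G"
  proof (rule linear_relationI)
    show "v \<in> carrier R \<and> z \<in> carrier R" if "(v, z) \<in> G" for v z
      using GE[OF that] ab cc U.Icarr by auto
    show "(\<zero>, \<zero>) \<in> G" by (rule GI[OF _ _ zero_closed zero_closed U.zero_closed]) (use ab cc in auto)
  next
    fix v z v' z' assume vz: "(v, z) \<in> G" and vz': "(v', z') \<in> G"
    obtain x y u where 1: "x \<in> carrier R" "y \<in> carrier R" "u \<in> U" "v = x \<otimes> a \<oplus> y \<otimes> b" "z = x \<otimes> c \<oplus> u"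
      using GE[OF vz] by blast
    obtain x' y' u' where 2: "x' \<in> carrier R" "y' \<in> carrier R" "u' \<in> U" "v' = x' \<otimes> a \<oplus> y' \<otimes> b" "z' = x' \<otimes> c \<oplus> u'"
      using GE[OF vz'] by blast
    show "(v \<oplus> v', z \<oplus> z') \<in> G"
    proof (rule GI)
      show "v \<oplus> v' = (x \<oplus> x') \<otimes> a \<oplus> (y \<oplus> y') \<otimes> b" unfolding 1(4) 2(4) using 1(1,2) 2(1,2) ab by algebra
      show "z \<oplus> z' = (x \<oplus> x') \<otimes> c \<oplus> (u \<oplus> u')"
        unfolding 1(5) 2(5) using 1(1) 2(1) U.Icarr[OF 1(3)] U.Icarr[OF 2(3)] cc by algebra
    qed (use 1 2 in auto)
  next
    fix r v z assume r: "r \<in> carrier R" and vz: "(v, z) \<in> G"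
    obtain x y u where 1: "x \<in> carrier R" "y \<in> carrier R" "u \<in> U" "v = x \<otimes> a \<oplus> y \<otimes> b" "z = x \<otimes> c \<oplus> u"
      using GE[OF vz] by blast
    show "(r \<otimes> v, r \<otimes> z) \<in> G"
    proof (rule GI)
      show "r \<otimes> v = (r \<otimes> x) \<otimes> a \<oplus> (r \<otimes> y) \<otimes> b" unfolding 1(4) using 1(1,2) r ab by algebra
      show "r \<otimes> z = (r \<otimes> x) \<otimes> c \<oplus> r \<otimes> u" unfolding 1(5) using 1(1) U.Icarr[OF 1(3)] r cc by algebra
    qed (use 1 r U.I_l_closed in auto)
  qed
  have dom: "Domain G = Idl {a, b}"
    unfolding Idl_pair[OF ab]
  proof (intro subset_antisym subsetI)
    fix v assume "v \<in> {x \<otimes> a \<oplus> y \<otimes> b | x y. x \<in> carrier R \<and> y \<in> carrier R}"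
    then show "v \<in> Domain G" using GI[OF _ refl _ _ U.zero_closed] by blast
  next
    fix v assume "v \<in> Domain G"
    then show "v \<in> {x \<otimes> a \<oplus> y \<otimes> b | x y. x \<in> carrier R \<and> y \<in> carrier R}" unfolding G_def by blast
  qed
  have "z \<in> Idl {a, b}" if z: "(v, z) \<in> G" for v z
  proof -
    obtain x y u where "x \<in> carrier R" "u \<in> U" "z = x \<otimes> c \<oplus> u" using GE[OF z] by blast
    then show ?thesis using U(2) c by (auto intro!: I.a_closed I.I_l_closed)
  qed
  then have "Range G \<subseteq> Idl {a, b}" by blast
  then obtain g where gG: "g \<subseteq> G" and g: "linear_map g" and domg: "Domain g = Idl {a, b}"
    using liftableE[OF lift G dom] by metis
  have glin: "linear_relation g" using g by (simp add: linear_map_def)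
  have fib: "z \<ominus> x0 \<otimes> c \<in> U"
    if z: "(x0 \<otimes> a \<oplus> y0 \<otimes> b, z) \<in> g" and xy0: "x0 \<in> carrier R" "y0 \<in> carrier R" for x0 y0 z
  proof -
    obtain x y u where 1: "x \<in> carrier R" "y \<in> carrier R" "u \<in> U"
      "x0 \<otimes> a \<oplus> y0 \<otimes> b = x \<otimes> a \<oplus> y \<otimes> b" "z = x \<otimes> c \<oplus> u"
      using GE z gG by blast
    have "(x \<ominus> x0) \<otimes> a \<oplus> (y \<ominus> y0) \<otimes> b = (x \<otimes> a \<oplus> y \<otimes> b) \<ominus> (x0 \<otimes> a \<oplus> y0 \<otimes> b)"
      using 1(1,2) xy0 ab by algebra
    also have "\<dots> = \<zero>" unfolding 1(4) using 1(1,2) ab by simp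
    finally have "(x \<ominus> x0) \<otimes> c \<in> U" using wd[rule_format, of "x \<ominus> x0" "y \<ominus> y0"] 1(1,2) xy0 by simp
    then have "(x \<ominus> x0) \<otimes> c \<oplus> u \<in> U" using 1(3) by (rule U.a_closed)
    moreover have "z \<ominus> x0 \<otimes> c = (x \<ominus> x0) \<otimes> c \<oplus> u"
      unfolding 1(5) using 1(1) xy0(1) U.Icarr[OF 1(3)] cc by algebra
    ultimately show ?thesis by simp
  qed
  have memI: "x \<otimes> a \<oplus> y \<otimes> b \<in> Domain g" if "x \<in> carrier R" "y \<in> carrier R" for x y
    unfolding domg Idl_pair[OF ab] using that by blast
  obtain a' where a': "(\<one> \<otimes> a \<oplus> \<zero> \<otimes> b, a') \<in> g" using memI[of \<one> \<zero>] by blast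
  obtain b' where b': "(\<zero> \<otimes> a \<oplus> \<one> \<otimes> b, b') \<in> g" using memI[of \<zero> \<one>] by blast
  note c' = linear_relationD(2)[OF glin a'] linear_relationD(2)[OF glin b']
  show ?thesis
  proof (rule bexI[of _ a'], rule bexI[of _ b'], intro conjI ballI impI)
    show "a' \<in> carrier R" by (rule c')
    show "a' \<ominus> c \<in> U" using fib[OF a'] cc by simp
    show "b' \<in> U" using fib[OF b'] cc c' by (simp add: a_minus_def)
    fix x y assume xy: "x \<in> carrier R" "y \<in> carrier R" and "x \<otimes> a \<oplus> y \<otimes> b = \<zero>"
    moreover have "(x \<otimes> (\<one> \<otimes> a \<oplus> \<zero> \<otimes> b) \<oplus> y \<otimes> (\<zero> \<otimes> a \<oplus> \<one> \<otimes> b), x \<otimes> a' \<oplus> y \<otimes> b') \<in> g"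
      by (intro linear_relationD(4)[OF glin] linear_relationD(5)[OF glin] a' b' xy)
    ultimately have "(\<zero>, x \<otimes> a' \<oplus> y \<otimes> b') \<in> g" using ab by simp
    then show "x \<otimes> a' \<oplus> y \<otimes> b' = \<zero>" using g by (simp add: linear_map_def)
  qed
qed

text \<open>
  For incomparable \<open>a\<close>, \<open>b\<close> put \<open>U = Ra \<inter> Rb\<close>. A lift of the projection of \<open>(Ra + Rb)/U\<close> onto
  \<open>Ra/U\<close> multiplies \<open>a\<close> by a unit \<open>1 + p\<close> and \<open>b\<close> by a nonunit \<open>q\<close>; on \<open>U\<close> both multiplications
  agree, so the unit \<open>1 + p - q\<close> annihilates \<open>U\<close>.
\<close>

lemma incomparable_disjoint:
  assumes loc: "local_ring R" and ab: "incomparable a b" and lift: "liftable (Idl {a, b})"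
    and x: "x \<in> carrier R" and y: "y \<in> carrier R" and eq: "x \<otimes> a = y \<otimes> b"
  shows "x \<otimes> a = \<zero>"
proof -
  note carr = incomparableD(1,2)[OF ab]
  obtain P where P: "ideal P R" and units: "\<And>x. x \<in> carrier R \<Longrightarrow> x \<in> P \<longleftrightarrow> x \<notin> Units R"
    using local_ring_nonunits_ideal[OF loc] by blast
  interpret P: ideal P R by fact
  let ?U = "PIdl a \<inter> PIdl b"
  have I: "ideal (Idl {a, b}) R" and aI: "a \<in> Idl {a, b}"
    using carr genideal_ideal[of "{a, b}"] genideal_self[of "{a, b}"] by auto
  have U: "ideal ?U R" using carr by (intro i_intersect cgenideal_ideal)
  have UI: "?U \<subseteq> Idl {a, b}" using cgenideal_minimal[OF I aI] by blast
  have wd: "x \<otimes> a \<in> ?U" if xy: "x \<in> carrier R" "y \<in> carrier R" "x \<otimes> a \<oplus> y \<otimes> b = \<zero>" for x y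
  proof -
    have "\<ominus> (y \<otimes> b) = x \<otimes> a" using xy carr by (intro minus_equality) auto
    then have "x \<otimes> a = (\<ominus> y) \<otimes> b" using xy carr by (simp add: l_minus)
    then show ?thesis unfolding cgenideal_def using xy(1,2) a_inv_closed[OF xy(2)] by blast
  qed
  obtain a' b' where a': "a' \<in> carrier R" "a' \<ominus> a \<in> ?U" and b': "b' \<in> ?U"
    and lin: "\<And>x y. x \<in> carrier R \<Longrightarrow> y \<in> carrier R \<Longrightarrow> x \<otimes> a \<oplus> y \<otimes> b = \<zero> \<Longrightarrow> x \<otimes> a' \<oplus> y \<otimes> b' = \<zero>"
    using lift_two_generated[OF carr lift U UI aI] wd by blast
  obtain p p' where p: "p \<in> carrier R" "a' \<ominus> a = p \<otimes> a" and p': "p' \<in> carrier R" "a' \<ominus> a = p' \<otimes> b"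
    using a'(2) unfolding cgenideal_def by blast
  obtain q' q where q': "q' \<in> carrier R" "b' = q' \<otimes> a" and q: "q \<in> carrier R" "b' = q \<otimes> b"
    using b' unfolding cgenideal_def by blast
  have "p \<in> P"
  proof (rule ccontr)
    assume "p \<notin> P"
    then have u: "p \<in> Units R" using units p by blast
    have "a = inv p \<otimes> (p \<otimes> a)" using u carr by (simp add: Units_l_cancel_inv)
    also have "\<dots> = inv p \<otimes> (p' \<otimes> b)" unfolding p(2)[symmetric] p'(2) ..
    also have "\<dots> = (inv p \<otimes> p') \<otimes> b" using u carr p' by (simp add: m_assoc)
    finally show False using incomparableD(3)[OF ab, of "inv p \<otimes> p'"] u p' by simp
  qed
  moreover have "q \<in> P"
  proof (rule ccontr)
    assume "q \<notin> P"
    then have u: "q \<in> Units R" using units q by blast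
    have "b = inv q \<otimes> (q \<otimes> b)" using u carr by (simp add: Units_l_cancel_inv)
    also have "\<dots> = inv q \<otimes> (q' \<otimes> a)" unfolding q(2)[symmetric] q'(2) ..
    also have "\<dots> = (inv q \<otimes> q') \<otimes> a" using u carr q' by (simp add: m_assoc)
    finally show False using incomparableD(4)[OF ab, of "inv q \<otimes> q'"] u q' by simp
  qed
  ultimately have "q \<ominus> p \<in> P" by (simp add: a_minus_def)
  have u: "\<one> \<oplus> p \<ominus> q \<in> Units R"
  proof (rule ccontr)
    assume "\<one> \<oplus> p \<ominus> q \<notin> Units R"
    then have "\<one> \<oplus> p \<ominus> q \<in> P" using units p(1) q(1) by simp
    then have "(\<one> \<oplus> p \<ominus> q) \<oplus> (q \<ominus> p) \<in> P" using \<open>q \<ominus> p \<in> P\<close> by simp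
    moreover have "(\<one> \<oplus> p \<ominus> q) \<oplus> (q \<ominus> p) = \<one>" using p(1) q(1) by algebra
    ultimately show False using units[of \<one>] by simp
  qed
  have "x \<otimes> a \<oplus> (\<ominus> y) \<otimes> b = \<zero>" using eq y carr by (simp add: l_minus r_neg)
  from lin[OF x a_inv_closed[OF y] this] have 0: "x \<otimes> a' \<oplus> (\<ominus> y) \<otimes> (q \<otimes> b) = \<zero>" unfolding q(2) .
  have "a' = a \<oplus> (a' \<ominus> a)" using a'(1) carr by algebra
  then have a'_eq: "a' = a \<oplus> p \<otimes> a" unfolding p(2) .
  have "(\<one> \<oplus> p \<ominus> q) \<otimes> (x \<otimes> a) = x \<otimes> (a \<oplus> p \<otimes> a) \<ominus> q \<otimes> (x \<otimes> a)" using p(1) q(1) x carr by algebra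
  also have "\<dots> = x \<otimes> a' \<oplus> (\<ominus> y) \<otimes> (q \<otimes> b)"
    unfolding a'_eq[symmetric] eq using a'(1) q(1) x y carr by algebra
  finally show ?thesis using Units_l_cancel_inv[OF u, of "x \<otimes> a"] u x carr 0 by simp
qed

text \<open>
  The map \<open>xa + yb \<mapsto> xb\<close> is well defined modulo \<open>ann(a) b\<close>; a lift sends \<open>a\<close> to a unit multiple
  of \<open>b\<close>, whence \<open>ann(a)\<close> annihilates \<open>b\<close>.
\<close>

lemma incomparable_annihilator:
  assumes loc: "local_ring R" and ab: "incomparable a b" and lift: "liftable (Idl {a, b})"
    and r: "r \<in> carrier R" and ra: "r \<otimes> a = \<zero>"
  shows "r \<otimes> b = \<zero>"
proof -
  note carr = incomparableD(1,2)[OF ab]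
  obtain P where P: "ideal P R" and units: "\<And>x. x \<in> carrier R \<Longrightarrow> x \<in> P \<longleftrightarrow> x \<notin> Units R"
    using local_ring_nonunits_ideal[OF loc] by blast
  interpret P: ideal P R by fact
  let ?U = "{t \<otimes> b | t. t \<in> carrier R \<and> t \<otimes> a = \<zero>}"
  have UI: "t \<otimes> b \<in> ?U" if "t \<in> carrier R" "t \<otimes> a = \<zero>" for t using that by blast
  have U: "ideal ?U R"
  proof (rule ideal_ofI)
    show "\<zero> \<in> ?U" using UI[of \<zero>] carr by simp
    fix u v assume "u \<in> ?U" "v \<in> ?U"
    then obtain t t' where t: "t \<in> carrier R" "t \<otimes> a = \<zero>" "u = t \<otimes> b"
      and t': "t' \<in> carrier R" "t' \<otimes> a = \<zero>" "v = t' \<otimes> b" by blast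
    show "u \<oplus> v \<in> ?U" using UI[of "t \<oplus> t'"] t t' carr by (simp add: l_distr)
  next
    fix q u assume q: "q \<in> carrier R" and "u \<in> ?U"
    then obtain t where t: "t \<in> carrier R" "t \<otimes> a = \<zero>" "u = t \<otimes> b" by blast
    show "q \<otimes> u \<in> ?U" using UI[of "q \<otimes> t"] t q carr by (simp add: m_assoc)
  qed (use carr in auto)
  interpret I: ideal "Idl {a, b}" R using carr by (intro genideal_ideal) auto
  have bI: "b \<in> Idl {a, b}" using genideal_self[of "{a, b}"] carr by auto
  have wd: "x \<otimes> b \<in> ?U" if xy: "x \<in> carrier R" "y \<in> carrier R" "x \<otimes> a \<oplus> y \<otimes> b = \<zero>" for x y
  proof (rule UI[OF xy(1)])
    have "\<ominus> (y \<otimes> b) = x \<otimes> a" using xy carr by (intro minus_equality) auto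
    then have "x \<otimes> a = (\<ominus> y) \<otimes> b" using xy carr by (simp add: l_minus)
    then show "x \<otimes> a = \<zero>" using incomparable_disjoint[OF loc ab lift xy(1), of "\<ominus> y"] xy(2) by simp
  qed
  have UI': "?U \<subseteq> Idl {a, b}" using bI I.I_l_closed by blast
  obtain a' b' where a': "a' \<in> carrier R" "a' \<ominus> b \<in> ?U" "b' \<in> ?U"
    and lin: "\<And>x y. x \<in> carrier R \<Longrightarrow> y \<in> carrier R \<Longrightarrow> x \<otimes> a \<oplus> y \<otimes> b = \<zero> \<Longrightarrow> x \<otimes> a' \<oplus> y \<otimes> b' = \<zero>"
    using lift_two_generated[OF carr lift U UI' bI] wd by blast
  obtain t where t: "t \<in> carrier R" "t \<otimes> a = \<zero>" "a' \<ominus> b = t \<otimes> b" using a'(2) by blast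
  have b'c: "b' \<in> carrier R" using a'(3) carr by auto
  \<comment> \<open>As \<open>t\<close> annihilates \<open>a \<noteq> 0\<close>, it is a nonunit.\<close>
  have "t \<in> P"
  proof (rule ccontr)
    assume "t \<notin> P"
    then have u: "t \<in> Units R" using units t by blast
    have "a = inv t \<otimes> (t \<otimes> a)" using u carr by (simp add: Units_l_cancel_inv)
    then show False using t(2) u incomparableD(5)[OF ab] by simp
  qed
  have u: "\<one> \<oplus> t \<in> Units R"
  proof (rule ccontr)
    assume "\<one> \<oplus> t \<notin> Units R"
    then have "\<one> \<oplus> t \<in> P" using units t(1) by simp
    then have "(\<one> \<oplus> t) \<ominus> t \<in> P" using \<open>t \<in> P\<close> by (simp add: a_minus_def)
    moreover have "(\<one> \<oplus> t) \<ominus> t = \<one>" using t(1) by algebra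
    ultimately show False using units[of \<one>] by simp
  qed
  have "a' = b \<oplus> (a' \<ominus> b)" using a'(1) carr by algebra
  then have "a' = b \<oplus> t \<otimes> b" unfolding t(3) .
  moreover have "(\<one> \<oplus> t) \<otimes> (r \<otimes> b) = r \<otimes> (b \<oplus> t \<otimes> b)" using r t(1) carr by algebra
  moreover have "r \<otimes> a' = \<zero>" using lin[OF r zero_closed] ra carr r a'(1) b'c by simp
  ultimately show ?thesis using Units_l_cancel_inv[OF u, of "r \<otimes> b"] u r carr by simp
qed

end

section \<open>The structure of local fqp-rings that are not chain rings\<close>

text \<open>
  The first two assumptions are what quasi-projectivity of the ideals with two generators says
  about a pair of incomparable elements.
\<close>

locale nonchain_fqp = cring R for R (structure) +
  assumes disjoint: "incomparable a b \<Longrightarrow> x \<in> carrier R \<Longrightarrow> y \<in> carrier R \<Longrightarrow>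
      x \<otimes> a = y \<otimes> b \<Longrightarrow> x \<otimes> a = \<zero>"
    and same_annihilator: "incomparable a b \<Longrightarrow> r \<in> carrier R \<Longrightarrow> r \<otimes> a = \<zero> \<Longrightarrow> r \<otimes> b = \<zero>"
    and ex_incomparable: "\<exists>a b. incomparable a b"

lemma (in cring) chain_ringI:
  assumes "\<nexists>a b. incomparable a b"
  shows "chain_ring R"
  unfolding chain_ring_def
proof (intro conjI allI impI is_cring)
  fix I J assume "ideal I R \<and> ideal J R"
  then interpret I: ideal I R + J: ideal J R by auto
  show "I \<subseteq> J \<or> J \<subseteq> I"
  proof (rule ccontr)
    assume "\<not> (I \<subseteq> J \<or> J \<subseteq> I)"
    then obtain a b where ab: "a \<in> I" "a \<notin> J" "b \<in> J" "b \<notin> I" by blast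
    have "incomparable a b"
      unfolding incomparable_def
    proof (intro conjI ballI notI)
      show "a \<in> carrier R" "b \<in> carrier R" using ab I.Icarr J.Icarr by auto
      fix r assume r: "r \<in> carrier R"
      show False if "a = r \<otimes> b" using J.I_l_closed[OF ab(3) r] that ab by simp
      show False if "b = r \<otimes> a" using I.I_l_closed[OF ab(1) r] that ab by simp
    qed
    then show False using assms by blast
  qed
qed

lemma nonchain_fqp_intro:
  fixes R (structure)
  assumes loc: "local_ring R" and fqp: "fqp_ring R" and nch: "\<not> chain_ring R"
  shows "nonchain_fqp R"
proof -
  interpret cring R using loc by (simp add: local_ring_def)
  have lift: "liftable (Idl {a, b})" if "incomparable a b" for a b
    using fqp incomparableD(1,2)[OF that] unfolding fqp_ring_def
    by (intro quasi_projective_imp_liftable genideal_ideal) auto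
  show ?thesis
  proof
    show "\<exists>a b. incomparable a b" using nch chain_ringI by blast
    show "x \<otimes> a = \<zero>" if "incomparable a b" "x \<in> carrier R" "y \<in> carrier R" "x \<otimes> a = y \<otimes> b" for a b x y
      using incomparable_disjoint[OF loc that(1) lift that(2-)] that by blast
    show "r \<otimes> b = \<zero>" if "incomparable a b" "r \<in> carrier R" "r \<otimes> a = \<zero>" for a b r
      using incomparable_annihilator[OF loc that(1) lift that(2-)] that by blast
  qed
qed

context nonchain_fqp
begin

abbreviation N where "N \<equiv> nilradical R"

lemma N_carr: "x \<in> N \<Longrightarrow> x \<in> carrier R"
  by (simp add: nilradical_def)

lemma nilradicalI: "x \<in> carrier R \<Longrightarrow> x [^] (n::nat) = \<zero> \<Longrightarrow> x \<in> N"
  by (auto simp: nilradical_def)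

lemma nilradicalI_square: "x \<in> carrier R \<Longrightarrow> x \<otimes> x \<in> N \<Longrightarrow> x \<in> N"
proof -
  assume x: "x \<in> carrier R" and "x \<otimes> x \<in> N"
  then obtain n :: nat where "(x \<otimes> x) [^] n = \<zero>" by (auto simp: nilradical_def)
  then have "x [^] (n + n) = \<zero>" using x by (simp add: nat_pow_distrib nat_pow_mult)
  then show "x \<in> N" by (rule nilradicalI[OF x])
qed

lemma N_zero: "\<zero> \<in> N"
  by (rule nilradicalI[of _ 1]) auto

lemma N_mult: "r \<in> carrier R \<Longrightarrow> x \<in> N \<Longrightarrow> r \<otimes> x \<in> N"
proof -
  assume r: "r \<in> carrier R" and x: "x \<in> N"
  then obtain n :: nat where "x [^] n = \<zero>" by (auto simp: nilradical_def)
  then have "(r \<otimes> x) [^] n = \<zero>" using r N_carr[OF x] by (simp add: nat_pow_distrib)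
  then show ?thesis by (rule nilradicalI[rotated]) (use r N_carr[OF x] in auto)
qed

lemma incomparable_mult: "incomparable a b \<Longrightarrow> a \<otimes> b = \<zero>"
proof -
  assume ab: "incomparable a b"
  have "b \<otimes> a = \<zero>"
    using disjoint[OF ab, of b a] incomparableD(1,2)[OF ab] m_comm[of a b] by simp
  then show ?thesis using incomparableD(1,2)[OF ab] by (simp add: m_comm)
qed

lemma incomparable_square: "incomparable a b \<Longrightarrow> a \<otimes> a = \<zero>"
proof -
  assume ab: "incomparable a b"
  then show ?thesis
    using same_annihilator[OF incomparable_sym[OF ab] incomparableD(1)[OF ab]] incomparable_mult[OF ab] by simp
qed

lemma incomparable_N:
  assumes "incomparable a b"
  shows "a \<in> N" "b \<in> N"
proof -
  show "a \<in> N"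
    using incomparable_square[OF assms] incomparableD(1)[OF assms] N_zero nilradicalI_square[of a] by simp
  show "b \<in> N"
    using incomparable_square[OF incomparable_sym[OF assms]] incomparableD(2)[OF assms] N_zero
      nilradicalI_square[of b] by simp
qed

lemma comparable_cases:
  assumes "a \<in> carrier R" "b \<in> carrier R" "a \<notin> N \<or> b \<notin> N"
  obtains r where "r \<in> carrier R" "a = r \<otimes> b" | r where "r \<in> carrier R" "b = r \<otimes> a"
  using assms(1,2)
proof (cases rule: incomparable_cases)
  case 1
  then show thesis using incomparable_N[OF 1] assms(3) by simp
next
  case (2 r)
  then show thesis by (rule that(1))
next
  case (3 r)
  then show thesis by (rule that(2))
qed

lemma N_add:
  assumes x: "x \<in> N" and y: "y \<in> N"
  shows "x \<oplus> y \<in> N"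
  using N_carr[OF x] N_carr[OF y]
proof (cases rule: incomparable_cases)
  case 1
  have "(x \<oplus> y) \<otimes> (x \<oplus> y) = x \<otimes> x \<oplus> (x \<otimes> y \<oplus> x \<otimes> y) \<oplus> y \<otimes> y"
    using N_carr[OF x] N_carr[OF y] by algebra
  also have "\<dots> = \<zero>"
    using incomparable_mult[OF 1] incomparable_square[OF 1] incomparable_square[OF incomparable_sym[OF 1]] by simp
  finally show ?thesis using N_carr[OF x] N_carr[OF y] N_zero nilradicalI_square[of "x \<oplus> y"] by simp
next
  case (2 r)
  then have "x \<oplus> y = (r \<oplus> \<one>) \<otimes> y" using N_carr[OF y] by (simp add: l_distr)
  then show ?thesis using N_mult[OF _ y] 2 by simp
next
  case (3 r)
  then have "x \<oplus> y = (r \<oplus> \<one>) \<otimes> x" using N_carr[OF x] by (simp add: l_distr a_comm)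
  then show ?thesis using N_mult[OF _ x] 3 by simp
qed

lemma ideal_N: "ideal N R"
  by (rule ideal_ofI) (auto simp: N_carr N_zero N_add N_mult)

lemma N_prime:
  assumes x: "x \<in> carrier R" and y: "y \<in> carrier R" and xy: "x \<otimes> y \<in> N"
  shows "x \<in> N \<or> y \<in> N"
  using x y
proof (cases rule: incomparable_cases)
  case 1
  then show ?thesis using incomparable_N by blast
next
  case (2 r)
  then have "x \<otimes> x = r \<otimes> (x \<otimes> y)" using x y by (simp add: m_assoc m_comm m_lcomm)
  then show ?thesis using nilradicalI_square[OF x] N_mult[OF 2(1) xy] by simp
next
  case (3 r)
  then have "y \<otimes> y = r \<otimes> (x \<otimes> y)" using x y by (simp add: m_assoc)
  then show ?thesis using nilradicalI_square[OF y] N_mult[OF 3(1) xy] by simp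
qed

lemma one_notin_N: "\<one> \<notin> N"
proof
  assume "\<one> \<in> N"
  then have "\<one> = \<zero>" by (auto simp: nilradical_def)
  then have "x = \<zero>" if "x \<in> carrier R" for x using that l_one[OF that] by simp
  then show False using ex_incomparable incomparableD(1,5) by blast
qed

lemma primeideal_N: "primeideal N R"
  using ideal_N is_cring N_prime one_notin_N by (intro primeidealI) auto

lemma divisible:
  assumes s: "s \<in> carrier R" "s \<notin> N" and x: "x \<in> N"
  obtains y where "y \<in> N" "x = s \<otimes> y"
proof -
  have "\<exists>r\<in>carrier R. x = r \<otimes> s"
    using s(1) N_carr[OF x] disjI1[OF s(2), of "x \<notin> N"]
  proof (cases rule: comparable_cases)
    case (1 r)
    then show ?thesis using N_mult[OF _ x] s(2) by auto
  next
    case (2 r)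
    then show ?thesis by blast
  qed
  then obtain r where r: "r \<in> carrier R" "x = s \<otimes> r" using s(1) m_comm by metis
  then have "r \<in> N" using N_prime[of s r] s x by blast
  then show thesis using that r by blast
qed

text \<open>
  Write \<open>a = s a'\<close> and \<open>b = s b'\<close>. Then \<open>a\<close> and \<open>b'\<close> are again incomparable, so \<open>s a = 0\<close> would
  give \<open>s b' = 0\<close>, that is \<open>b = 0\<close>.
\<close>

lemma incomparable_torsionfree:
  assumes ab: "incomparable a b" and s: "s \<in> carrier R" "s \<notin> N"
  shows "s \<otimes> a \<noteq> \<zero>"
proof
  assume sa: "s \<otimes> a = \<zero>"
  note ab_carr = incomparableD(1,2)[OF ab]
  obtain a' where a': "a' \<in> N" "a = s \<otimes> a'" using divisible[OF s incomparable_N(1)[OF ab]] .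
  obtain b' where b': "b' \<in> N" "b = s \<otimes> b'" using divisible[OF s incomparable_N(2)[OF ab]] .
  note carr = s(1) N_carr[OF a'(1)] N_carr[OF b'(1)]
  have inc: "incomparable a' b'"
    unfolding incomparable_def
  proof (intro conjI ballI notI)
    fix r assume r: "r \<in> carrier R"
    show False if "a' = r \<otimes> b'"
    proof -
      have "a = r \<otimes> b" using carr r by (simp add: a'(2) b'(2) that m_lcomm)
      then show False using incomparableD(3)[OF ab] r by blast
    qed
    show False if "b' = r \<otimes> a'"
    proof -
      have "b = r \<otimes> a" using carr r by (simp add: a'(2) b'(2) that m_lcomm)
      then show False using incomparableD(4)[OF ab] r by blast
    qed
  qed (rule carr)+
  have "incomparable a b'"
    unfolding incomparable_def
  proof (intro conjI ballI notI)
    fix r assume r: "r \<in> carrier R"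
    show False if "a = r \<otimes> b'"
      using disjoint[OF inc carr(1) r] that a'(2) incomparableD(5)[OF ab] by simp
    show False if "b' = r \<otimes> a"
    proof -
      have "b' = (r \<otimes> s) \<otimes> a'" using carr r that by (simp add: a'(2) m_assoc)
      then show False using incomparableD(4)[OF inc, of "r \<otimes> s"] r carr by simp
    qed
  qed (use carr ab_carr in auto)
  then have "s \<otimes> b' = \<zero>" using same_annihilator s(1) sa by blast
  then show False using b'(2) incomparableD(6)[OF ab] by simp
qed

text \<open>
  If \<open>a = rx\<close> and \<open>b = tx\<close> with \<open>a\<close>, \<open>b\<close> incomparable, then so are \<open>ax\<close> and \<open>bx\<close>.
  Iterating, no power of \<open>x\<close> vanishes.
\<close>

lemma incomparable_common_divisor:
  assumes ab: "incomparable a b" and x: "x \<in> carrier R"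
    and r: "r \<in> carrier R" "a = r \<otimes> x" and t: "t \<in> carrier R" "b = t \<otimes> x"
  shows "incomparable (x \<otimes> a) (x \<otimes> b)"
proof -
  note ab_carr = incomparableD(1,2)[OF ab]
  have nz: "x \<otimes> b \<noteq> \<zero>" if ab: "incomparable a b" and r: "r \<in> carrier R" "a = r \<otimes> x"
    and t: "t \<in> carrier R" "b = t \<otimes> x" for a b r t
  proof
    assume xb: "x \<otimes> b = \<zero>"
    have rt: "incomparable r t"
      unfolding incomparable_def
    proof (intro conjI ballI notI)
      fix q assume q: "q \<in> carrier R"
      show False if "r = q \<otimes> t"
        using incomparableD(3)[OF ab q] that q t r x by (simp add: m_assoc)
      show False if "t = q \<otimes> r"
        using incomparableD(4)[OF ab q] that q t r x by (simp add: m_assoc)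
    qed fact+
    have "incomparable b r"
      unfolding incomparable_def
    proof (intro conjI ballI notI)
      fix q assume q: "q \<in> carrier R"
      show False if "r = q \<otimes> b"
      proof -
        have "r = (q \<otimes> x) \<otimes> t" using that q t x by (simp add: m_ac)
        then show False using incomparableD(3)[OF rt, of "q \<otimes> x"] q x by simp
      qed
      show False if "b = q \<otimes> r"
      proof -
        have "q \<otimes> r = x \<otimes> t" using that t x by (simp add: m_comm)
        then have "q \<otimes> r = \<zero>" using disjoint[OF rt q x] by blast
        then show False using that incomparableD(6)[OF ab] by simp
      qed
    qed (use incomparableD(2)[OF ab] r in auto)
    then have "x \<otimes> r = \<zero>" using same_annihilator x xb by blast
    then show False using r x incomparableD(5)[OF ab] by (simp add: m_comm)
  qed
  have no: False if ab: "incomparable a b" and nz: "x \<otimes> a \<noteq> \<zero>" and q: "q \<in> carrier R" "x \<otimes> a = q \<otimes> (x \<otimes> b)" for a b q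
  proof -
    have "x \<otimes> a = (q \<otimes> x) \<otimes> b" using q x incomparableD(2)[OF ab] by (simp add: m_assoc)
    then show False using disjoint[OF ab x, of "q \<otimes> x"] q x nz by simp
  qed
  show ?thesis
    unfolding incomparable_def
  proof (intro conjI ballI notI)
    fix q assume q: "q \<in> carrier R"
    show False if "x \<otimes> a = q \<otimes> (x \<otimes> b)"
      using no[OF ab nz[OF incomparable_sym[OF ab] t r] q that] .
    show False if "x \<otimes> b = q \<otimes> (x \<otimes> a)"
      using no[OF incomparable_sym[OF ab] nz[OF ab r t] q that] .
  qed (use ab_carr x in auto)
qed

lemma common_divisor_notin_N:
  assumes "incomparable a b" "x \<in> carrier R" "r \<in> carrier R" "a = r \<otimes> x" "t \<in> carrier R" "b = t \<otimes> x"
  shows "x \<notin> N"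
proof
  have pow: "x [^] (n::nat) \<otimes> a \<noteq> \<zero>"
    if "incomparable a b" "r \<in> carrier R" "a = r \<otimes> x" "t \<in> carrier R" "b = t \<otimes> x" for n a b r t
    using that
  proof (induction n arbitrary: a b r t)
    case 0
    then show ?case using incomparableD(1,5)[of a b] by simp
  next
    case (Suc n)
    have "incomparable (x \<otimes> a) (x \<otimes> b)"
      using incomparable_common_divisor[of a b x r t] Suc.prems assms(2) by blast
    moreover have "x \<otimes> a = a \<otimes> x" "x \<otimes> b = b \<otimes> x" "a \<in> carrier R" "b \<in> carrier R"
      using Suc.prems assms(2) incomparableD(1,2)[of a b] by (auto intro: m_comm)
    ultimately have "x [^] n \<otimes> (x \<otimes> a) \<noteq> \<zero>" by (intro Suc.IH[of _ "x \<otimes> b" a b]) auto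
    then show ?case using assms(2) \<open>a \<in> carrier R\<close> by (simp add: m_assoc)
  qed
  assume "x \<in> N"
  then obtain n :: nat where "x [^] n = \<zero>" by (auto simp: nilradical_def)
  then show False using pow[of a b r t n] assms incomparableD(1)[of a b] by simp
qed

text \<open>
  Compare \<open>x\<close> with a pair of incomparable elements: a common multiple is zero, and a common
  divisor is not nilpotent.
\<close>

lemma ex_incomparable_with:
  assumes x: "x \<in> N" "x \<noteq> \<zero>"
  shows "\<exists>y. incomparable x y"
proof (rule ccontr)
  assume no: "\<nexists>y. incomparable x y"
  obtain a b where ab: "incomparable a b" using ex_incomparable by blast
  note carr = incomparableD(1,2)[OF ab] N_carr[OF x(1)]
  have cmp: "(\<exists>r\<in>carrier R. x = r \<otimes> c) \<or> (\<exists>r\<in>carrier R. c = r \<otimes> x)" if "c \<in> carrier R" for c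
    using no that carr(3) unfolding incomparable_def by blast
  have no_mixed: False if ab: "incomparable a b" and "r \<in> carrier R" "x = r \<otimes> a" "q \<in> carrier R" "b = q \<otimes> x" for a b r q
  proof -
    have "b = (q \<otimes> r) \<otimes> a" using that incomparableD(1)[OF ab] by (simp add: m_assoc)
    then show False using incomparableD(4)[OF ab, of "q \<otimes> r"] that by simp
  qed
  from cmp[OF carr(1)] show False
  proof (elim disjE bexE)
    fix r assume r: "r \<in> carrier R" "x = r \<otimes> a"
    from cmp[OF carr(2)] show False
    proof (elim disjE bexE)
      fix q assume "q \<in> carrier R" "x = q \<otimes> b"
      then show False using disjoint[OF ab r(1), of q] r(2) x(2) by simp
    qed (rule no_mixed[OF ab r])
  next
    fix r assume r: "r \<in> carrier R" "a = r \<otimes> x"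
    from cmp[OF carr(2)] show False
    proof (elim disjE bexE)
      fix q assume q: "q \<in> carrier R" "x = q \<otimes> b"
      show False by (rule no_mixed[OF incomparable_sym[OF ab] q r])
    next
      fix q assume q: "q \<in> carrier R" "b = q \<otimes> x"
      show False using common_divisor_notin_N[OF ab carr(3) r q] x(1) by simp
    qed
  qed
qed

text \<open>
  A nonzero element of \<open>N\<close> has an incomparable partner, so its square vanishes; products reduce to
  squares by comparing the factors.
\<close>

lemma N_mult_N:
  assumes x: "x \<in> N" and y: "y \<in> N"
  shows "x \<otimes> y = \<zero>"
proof -
  note carr = N_carr[OF x] N_carr[OF y]
  have sq: "z \<otimes> z = \<zero>" if "z \<in> N" for z
    using ex_incomparable_with[OF that] incomparable_square by (cases "z = \<zero>") auto
  from carr show ?thesis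
  proof (cases rule: incomparable_cases)
    case 1
    then show ?thesis by (rule incomparable_mult)
  next
    case (2 r)
    then show ?thesis using sq[OF y] carr by (simp add: m_assoc)
  next
    case (3 r)
    then show ?thesis using sq[OF x] carr by (simp add: m_lcomm)
  qed
qed

lemma torsionfree:
  assumes s: "s \<in> carrier R" "s \<notin> N" and x: "x \<in> carrier R" and sx: "s \<otimes> x = \<zero>"
  shows "x = \<zero>"
proof (rule ccontr)
  assume "x \<noteq> \<zero>"
  have "x \<in> N" using N_prime[OF s(1) x] s sx N_zero by simp
  then show False using ex_incomparable_with[of x] incomparable_torsionfree[OF _ s, of x] \<open>x \<noteq> \<zero>\<close> sx by blast
qed

lemma cancel:
  assumes s: "s \<in> carrier R" "s \<notin> N" and xy: "x \<in> carrier R" "y \<in> carrier R" and eq: "s \<otimes> x = s \<otimes> y"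
  shows "x = y"
proof -
  have "s \<otimes> (x \<ominus> y) = s \<otimes> x \<ominus> s \<otimes> y" using s xy by algebra
  then have "x \<ominus> y = \<zero>" using torsionfree[OF s, of "x \<ominus> y"] xy s eq by simp
  then show ?thesis using xy by simp
qed

lemma annihilator_N:
  assumes r: "r \<in> carrier R" and x: "x \<in> carrier R" "x \<noteq> \<zero>" and "r \<otimes> x = \<zero>"
  shows "r \<in> N"
  using torsionfree[OF r _ x(1)] assms by blast

lemma N_complement_mult: "s \<in> carrier R - N \<Longrightarrow> t \<in> carrier R - N \<Longrightarrow> s \<otimes> t \<in> carrier R - N"
  using N_prime by auto

end

section \<open>The field of fractions of a domain and vector spaces over it\<close>

context "domain"
begin

lemma equiv_fraction_rel: "equiv (carrier R \<times> (carrier R - {\<zero>})) (fraction_rel R)"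
proof (rule equivI)
  show "fraction_rel R \<subseteq> (carrier R \<times> (carrier R - {\<zero>})) \<times> (carrier R \<times> (carrier R - {\<zero>}))"
    by (auto simp: fraction_rel_def)
  show "refl_on (carrier R \<times> (carrier R - {\<zero>})) (fraction_rel R)"
    by (auto simp: refl_on_def fraction_rel_def)
  show "sym (fraction_rel R)"
    by (auto simp: sym_def fraction_rel_def)
  show "trans (fraction_rel R)"
  proof (rule transI)
    fix p q r assume "(p, q) \<in> fraction_rel R" "(q, r) \<in> fraction_rel R"
    then obtain a s b t c u where pqr: "p = (a, s)" "q = (b, t)" "r = (c, u)"
      and carr: "a \<in> carrier R" "b \<in> carrier R" "c \<in> carrier R" "s \<in> carrier R" "t \<in> carrier R" "u \<in> carrier R"
      and nz: "s \<noteq> \<zero>" "t \<noteq> \<zero>" "u \<noteq> \<zero>"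
      and eq: "a \<otimes> t = b \<otimes> s" "b \<otimes> u = c \<otimes> t"
      by (auto simp: fraction_rel_def)
    have "t \<otimes> (a \<otimes> u) = (a \<otimes> t) \<otimes> u" using carr by algebra
    also have "\<dots> = (b \<otimes> u) \<otimes> s" unfolding eq(1) using carr by algebra
    also have "\<dots> = t \<otimes> (c \<otimes> s)" unfolding eq(2) using carr by algebra
    finally have "a \<otimes> u = c \<otimes> s" using carr nz m_lcancel by simp
    then show "(p, r) \<in> fraction_rel R" using pqr carr nz by (auto simp: fraction_rel_def)
  qed
qed

lemma fraction_eq_iff:
  assumes "a \<in> carrier R" "s \<in> carrier R - {\<zero>}" "b \<in> carrier R" "t \<in> carrier R - {\<zero>}"
  shows "fraction R a s = fraction R b t \<longleftrightarrow> a \<otimes> t = b \<otimes> s"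
proof -
  have "fraction R a s = fraction R b t \<longleftrightarrow> ((a, s), (b, t)) \<in> fraction_rel R"
    unfolding fraction_def using assms by (intro eq_equiv_class_iff[OF equiv_fraction_rel]) auto
  then show ?thesis using assms by (auto simp: fraction_rel_def)
qed

lemma mem_fraction_iff:
  assumes "a \<in> carrier R" "s \<in> carrier R - {\<zero>}"
  shows "(b, t) \<in> fraction R a s \<longleftrightarrow> b \<in> carrier R \<and> t \<in> carrier R - {\<zero>} \<and> a \<otimes> t = b \<otimes> s"
  using assms by (auto simp: fraction_def fraction_rel_def)

lemma carrier_quotient_field:
  "carrier (quotient_field R) = {fraction R a s | a s. a \<in> carrier R \<and> s \<in> carrier R - {\<zero>}}"
  by (auto simp: quotient_field_def quotient_def fraction_def)

lemma quotient_fieldE: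
  assumes "p \<in> carrier (quotient_field R)"
  obtains a s where "a \<in> carrier R" "s \<in> carrier R - {\<zero>}" "p = fraction R a s"
  using assms by (auto simp: carrier_quotient_field)

lemma zero_quotient_field: "\<zero>\<^bsub>quotient_field R\<^esub> = fraction R \<zero> \<one>"
  by (simp add: quotient_field_def)

lemma one_quotient_field: "\<one>\<^bsub>quotient_field R\<^esub> = fraction R \<one> \<one>"
  by (simp add: quotient_field_def)

lemma nonzero_mult: "s \<in> carrier R - {\<zero>} \<Longrightarrow> t \<in> carrier R - {\<zero>} \<Longrightarrow> s \<otimes> t \<in> carrier R - {\<zero>}"
  using integral by auto

lemma UN_fraction_const:
  assumes "a \<in> carrier R" "s \<in> carrier R - {\<zero>}" "b \<in> carrier R" "t \<in> carrier R - {\<zero>}"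
    and "\<And>a' s' b' t'. a' \<in> carrier R \<Longrightarrow> s' \<in> carrier R - {\<zero>} \<Longrightarrow> b' \<in> carrier R \<Longrightarrow> t' \<in> carrier R - {\<zero>} \<Longrightarrow>
      a \<otimes> s' = a' \<otimes> s \<Longrightarrow> b \<otimes> t' = b' \<otimes> t \<Longrightarrow> h a' s' b' t' = (c :: 'x set)"
  shows "(\<Union>(a, s)\<in>fraction R a s. \<Union>(b, t)\<in>fraction R b t. h a s b t) = c"
proof -
  have mem: "(a, s) \<in> fraction R a s" "(b, t) \<in> fraction R b t" using assms by (simp_all add: mem_fraction_iff)
  have h: "h a' s' b' t' = c" if "(a', s') \<in> fraction R a s" "(b', t') \<in> fraction R b t" for a' s' b' t'
    using that assms by (simp add: mem_fraction_iff)
  show ?thesis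
  proof (rule UN_constant_eq[OF mem(1)], clarify)
    fix a' s' assume "(a', s') \<in> fraction R a s"
    then show "(\<Union>(b, t)\<in>fraction R b t. h a' s' b t) = c"
      using h by (intro UN_constant_eq[OF mem(2)]) auto
  qed
qed

lemma mult_fraction:
  assumes "a \<in> carrier R" "s \<in> carrier R - {\<zero>}" "b \<in> carrier R" "t \<in> carrier R - {\<zero>}"
  shows "fraction R a s \<otimes>\<^bsub>quotient_field R\<^esub> fraction R b t = fraction R (a \<otimes> b) (s \<otimes> t)"
proof -
  have "(\<Union>(a, s)\<in>fraction R a s. \<Union>(b, t)\<in>fraction R b t. fraction R (a \<otimes> b) (s \<otimes> t)) =
      fraction R (a \<otimes> b) (s \<otimes> t)"
  proof (rule UN_fraction_const[OF assms])
    fix a' s' b' t'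
    assume carr': "a' \<in> carrier R" "s' \<in> carrier R - {\<zero>}" "b' \<in> carrier R" "t' \<in> carrier R - {\<zero>}"
      and eq: "a \<otimes> s' = a' \<otimes> s" "b \<otimes> t' = b' \<otimes> t"
    have carr: "a \<in> carrier R" "s \<in> carrier R" "b \<in> carrier R" "t \<in> carrier R"
      "a' \<in> carrier R" "s' \<in> carrier R" "b' \<in> carrier R" "t' \<in> carrier R" using assms carr' by auto
    have "(a' \<otimes> b') \<otimes> (s \<otimes> t) = (a' \<otimes> s) \<otimes> (b' \<otimes> t)" using carr by algebra
    also have "\<dots> = (a \<otimes> b) \<otimes> (s' \<otimes> t')" unfolding eq[symmetric] using carr by algebra
    finally show "fraction R (a' \<otimes> b') (s' \<otimes> t') = fraction R (a \<otimes> b) (s \<otimes> t)"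
      using carr nonzero_mult assms carr' by (subst fraction_eq_iff) auto
  qed
  then show ?thesis by (simp add: quotient_field_def)
qed

lemma add_fraction:
  assumes "a \<in> carrier R" "s \<in> carrier R - {\<zero>}" "b \<in> carrier R" "t \<in> carrier R - {\<zero>}"
  shows "fraction R a s \<oplus>\<^bsub>quotient_field R\<^esub> fraction R b t = fraction R (a \<otimes> t \<oplus> b \<otimes> s) (s \<otimes> t)"
proof -
  have "(\<Union>(a, s)\<in>fraction R a s. \<Union>(b, t)\<in>fraction R b t. fraction R (a \<otimes> t \<oplus> b \<otimes> s) (s \<otimes> t)) =
      fraction R (a \<otimes> t \<oplus> b \<otimes> s) (s \<otimes> t)"
  proof (rule UN_fraction_const[OF assms])
    fix a' s' b' t'
    assume carr': "a' \<in> carrier R" "s' \<in> carrier R - {\<zero>}" "b' \<in> carrier R" "t' \<in> carrier R - {\<zero>}"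
      and eq: "a \<otimes> s' = a' \<otimes> s" "b \<otimes> t' = b' \<otimes> t"
    have carr: "a \<in> carrier R" "s \<in> carrier R" "b \<in> carrier R" "t \<in> carrier R"
      "a' \<in> carrier R" "s' \<in> carrier R" "b' \<in> carrier R" "t' \<in> carrier R" using assms carr' by auto
    have "(a' \<otimes> t' \<oplus> b' \<otimes> s') \<otimes> (s \<otimes> t) = (a' \<otimes> s) \<otimes> (t' \<otimes> t) \<oplus> (b' \<otimes> t) \<otimes> (s' \<otimes> s)"
      using carr by algebra
    also have "\<dots> = (a \<otimes> t \<oplus> b \<otimes> s) \<otimes> (s' \<otimes> t')" unfolding eq[symmetric] using carr by algebra
    finally show "fraction R (a' \<otimes> t' \<oplus> b' \<otimes> s') (s' \<otimes> t') = fraction R (a \<otimes> t \<oplus> b \<otimes> s) (s \<otimes> t)"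
      using carr nonzero_mult assms carr' by (subst fraction_eq_iff) auto
  qed
  then show ?thesis by (simp add: quotient_field_def)
qed

lemma field_quotient_field: "field (quotient_field R)"
proof -
  let ?K = "quotient_field R"
  have one: "\<one> \<in> carrier R - {\<zero>}" using one_not_zero by simp
  have closed: "fraction R a s \<in> carrier ?K" if "a \<in> carrier R" "s \<in> carrier R - {\<zero>}" for a s
    using that by (auto simp: carrier_quotient_field)
  note simps = mult_fraction add_fraction zero_quotient_field one_quotient_field
  have "abelian_group ?K"
  proof (rule abelian_groupI)
    fix p q assume "p \<in> carrier ?K" "q \<in> carrier ?K"
    then obtain a s b t where pq: "p = fraction R a s" "q = fraction R b t"
      and c: "a \<in> carrier R" "s \<in> carrier R - {\<zero>}" "b \<in> carrier R" "t \<in> carrier R - {\<zero>}"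
      by (metis quotient_fieldE)
    show "p \<oplus>\<^bsub>?K\<^esub> q \<in> carrier ?K" using pq c nonzero_mult[OF c(2,4)] by (simp add: simps closed)
    have c': "s \<in> carrier R" "t \<in> carrier R" using c by auto
    have "a \<otimes> t \<oplus> b \<otimes> s = b \<otimes> s \<oplus> a \<otimes> t" using c(1,3) c' by algebra
    then show "p \<oplus>\<^bsub>?K\<^esub> q = q \<oplus>\<^bsub>?K\<^esub> p" using pq c by (simp add: simps m_comm)
    fix r assume "r \<in> carrier ?K"
    then obtain d u where r: "r = fraction R d u" and d: "d \<in> carrier R" "u \<in> carrier R - {\<zero>}"
      by (metis quotient_fieldE)
    have u: "u \<in> carrier R" using d by simp
    have "(a \<otimes> t \<oplus> b \<otimes> s) \<otimes> u \<oplus> d \<otimes> (s \<otimes> t) = a \<otimes> (t \<otimes> u) \<oplus> (b \<otimes> u \<oplus> d \<otimes> t) \<otimes> s"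
      "(s \<otimes> t) \<otimes> u = s \<otimes> (t \<otimes> u)"
      using c(1,3) c' d(1) u by algebra+
    then show "(p \<oplus>\<^bsub>?K\<^esub> q) \<oplus>\<^bsub>?K\<^esub> r = p \<oplus>\<^bsub>?K\<^esub> (q \<oplus>\<^bsub>?K\<^esub> r)"
      using pq r c d nonzero_mult[OF c(2,4)] nonzero_mult[OF c(4) d(2)] by (simp add: simps)
  next
    show "\<zero>\<^bsub>?K\<^esub> \<in> carrier ?K" using one by (simp add: simps closed)
    fix p assume "p \<in> carrier ?K"
    then obtain a s where p: "p = fraction R a s" and c: "a \<in> carrier R" "s \<in> carrier R - {\<zero>}"
      by (metis quotient_fieldE)
    show "\<zero>\<^bsub>?K\<^esub> \<oplus>\<^bsub>?K\<^esub> p = p" using p c one by (simp add: simps)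
    have "fraction R (\<ominus> a) s \<oplus>\<^bsub>?K\<^esub> p = fraction R \<zero> (s \<otimes> s)"
      using p c by (simp add: simps l_minus l_neg)
    also have "\<dots> = \<zero>\<^bsub>?K\<^esub>"
      unfolding simps using c one nonzero_mult[OF c(2,2)] by (subst fraction_eq_iff) auto
    finally show "\<exists>q\<in>carrier ?K. q \<oplus>\<^bsub>?K\<^esub> p = \<zero>\<^bsub>?K\<^esub>" using closed[of "\<ominus> a" s] c by auto
  qed
  moreover have "comm_monoid ?K"
  proof (rule comm_monoidI)
    show "\<one>\<^bsub>?K\<^esub> \<in> carrier ?K" using one by (simp add: simps closed)
  next
    fix p q assume "p \<in> carrier ?K" "q \<in> carrier ?K"
    then obtain a s b t where pq: "p = fraction R a s" "q = fraction R b t"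
      and c: "a \<in> carrier R" "s \<in> carrier R - {\<zero>}" "b \<in> carrier R" "t \<in> carrier R - {\<zero>}"
      by (metis quotient_fieldE)
    show "p \<otimes>\<^bsub>?K\<^esub> q \<in> carrier ?K" using pq c nonzero_mult[OF c(2,4)] by (simp add: simps closed)
    show "p \<otimes>\<^bsub>?K\<^esub> q = q \<otimes>\<^bsub>?K\<^esub> p" using pq c by (simp add: simps m_comm)
    fix r assume "r \<in> carrier ?K"
    then obtain d u where r: "r = fraction R d u" and d: "d \<in> carrier R" "u \<in> carrier R - {\<zero>}"
      by (metis quotient_fieldE)
    show "(p \<otimes>\<^bsub>?K\<^esub> q) \<otimes>\<^bsub>?K\<^esub> r = p \<otimes>\<^bsub>?K\<^esub> (q \<otimes>\<^bsub>?K\<^esub> r)"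
      using pq r c d nonzero_mult[OF c(2,4)] nonzero_mult[OF c(4) d(2)] by (simp add: simps m_assoc)
  next
    fix p assume "p \<in> carrier ?K"
    then obtain a s where p: "p = fraction R a s" and c: "a \<in> carrier R" "s \<in> carrier R - {\<zero>}"
      by (metis quotient_fieldE)
    then show "\<one>\<^bsub>?K\<^esub> \<otimes>\<^bsub>?K\<^esub> p = p" using one by (simp add: simps)
  qed
  ultimately have "cring ?K"
  proof (rule cringI)
    fix p q r assume "p \<in> carrier ?K" "q \<in> carrier ?K" "r \<in> carrier ?K"
    then obtain a s b t d u where pqr: "p = fraction R a s" "q = fraction R b t" "r = fraction R d u"
      and c: "a \<in> carrier R" "s \<in> carrier R - {\<zero>}" "b \<in> carrier R" "t \<in> carrier R - {\<zero>}"
        "d \<in> carrier R" "u \<in> carrier R - {\<zero>}"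
      by (metis quotient_fieldE)
    note nz = nonzero_mult[OF c(2,4)] nonzero_mult[OF c(2,6)] nonzero_mult[OF c(4,6)]
    have c': "s \<in> carrier R" "t \<in> carrier R" "u \<in> carrier R" using c by auto
    have "((a \<otimes> t \<oplus> b \<otimes> s) \<otimes> d) \<otimes> ((s \<otimes> u) \<otimes> (t \<otimes> u)) =
        ((a \<otimes> d) \<otimes> (t \<otimes> u) \<oplus> (b \<otimes> d) \<otimes> (s \<otimes> u)) \<otimes> ((s \<otimes> t) \<otimes> u)"
      using c(1,3,5) c' by algebra
    then have "fraction R ((a \<otimes> t \<oplus> b \<otimes> s) \<otimes> d) ((s \<otimes> t) \<otimes> u) =
        fraction R ((a \<otimes> d) \<otimes> (t \<otimes> u) \<oplus> (b \<otimes> d) \<otimes> (s \<otimes> u)) ((s \<otimes> u) \<otimes> (t \<otimes> u))"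
      using c c' nonzero_mult[OF nz(1) c(6)] nonzero_mult[OF nz(2,3)] by (subst fraction_eq_iff) auto
    then show "(p \<oplus>\<^bsub>?K\<^esub> q) \<otimes>\<^bsub>?K\<^esub> r = (p \<otimes>\<^bsub>?K\<^esub> r) \<oplus>\<^bsub>?K\<^esub> (q \<otimes>\<^bsub>?K\<^esub> r)"
      using pqr c nz c' by (simp add: simps)
  qed
  then interpret K: cring ?K .
  show ?thesis
  proof (rule K.cring_fieldI2)
    show "\<zero>\<^bsub>?K\<^esub> \<noteq> \<one>\<^bsub>?K\<^esub>" unfolding simps using one by (subst fraction_eq_iff) auto
    fix p assume "p \<in> carrier ?K" "p \<noteq> \<zero>\<^bsub>?K\<^esub>"
    then obtain a s where p: "p = fraction R a s" and c: "a \<in> carrier R" "s \<in> carrier R - {\<zero>}"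
      by (metis quotient_fieldE)
    have "fraction R a s \<noteq> fraction R \<zero> \<one>" using \<open>p \<noteq> \<zero>\<^bsub>?K\<^esub>\<close> p by (simp add: simps)
    then have a: "a \<in> carrier R - {\<zero>}" using c one by (subst (asm) fraction_eq_iff) auto
    have "p \<otimes>\<^bsub>?K\<^esub> fraction R s a = \<one>\<^bsub>?K\<^esub>"
      unfolding p using c a one nonzero_mult[OF c(2) a]
      by (simp add: simps) (subst fraction_eq_iff; auto simp: m_comm)
    then show "\<exists>q\<in>carrier ?K. p \<otimes>\<^bsub>?K\<^esub> q = \<one>\<^bsub>?K\<^esub>" using closed[of s a] c a by auto
  qed
qed

end

locale torsionfree_divisible = D: "domain" D + M: module D M for D (structure) and M +
  assumes divisible: "s \<in> carrier D - {\<zero>} \<Longrightarrow> m \<in> carrier M \<Longrightarrow> \<exists>n\<in>carrier M. s \<odot>\<^bsub>M\<^esub> n = m"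
    and torsionfree: "s \<in> carrier D - {\<zero>} \<Longrightarrow> m \<in> carrier M \<Longrightarrow> s \<odot>\<^bsub>M\<^esub> m = \<zero>\<^bsub>M\<^esub> \<Longrightarrow> m = \<zero>\<^bsub>M\<^esub>"
begin

abbreviation "V \<equiv> quotient_field_space D M"
abbreviation "K \<equiv> quotient_field D"

lemma V_simps [simp]: "carrier V = carrier M" "\<zero>\<^bsub>V\<^esub> = \<zero>\<^bsub>M\<^esub>" "x \<oplus>\<^bsub>V\<^esub> y = x \<oplus>\<^bsub>M\<^esub> y"
  by (simp_all add: quotient_field_space_def)

lemma smult_cancel:
  assumes s: "s \<in> carrier D - {\<zero>}" and "m \<in> carrier M" "n \<in> carrier M" and eq: "s \<odot>\<^bsub>M\<^esub> m = s \<odot>\<^bsub>M\<^esub> n"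
  shows "m = n"
proof -
  have "s \<odot>\<^bsub>M\<^esub> (m \<ominus>\<^bsub>M\<^esub> n) = s \<odot>\<^bsub>M\<^esub> m \<ominus>\<^bsub>M\<^esub> s \<odot>\<^bsub>M\<^esub> n"
    using assms by (simp add: a_minus_def M.smult_r_distr M.smult_r_minus)
  also have "\<dots> = \<zero>\<^bsub>M\<^esub>" using assms by (simp add: a_minus_def M.M.r_neg)
  finally have "m \<ominus>\<^bsub>M\<^esub> n = \<zero>\<^bsub>M\<^esub>" 
    using torsionfree[OF s, of "m \<ominus>\<^bsub>M\<^esub> n"] assms(2,3) by simp
  then show ?thesis using assms(2,3) by simp
qed

lemma smult_fraction_ex1:
  assumes a: "a \<in> carrier D" and s: "s \<in> carrier D - {\<zero>}" and m: "m \<in> carrier M"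
  shows "fraction D a s \<odot>\<^bsub>V\<^esub> m \<in> carrier M \<and> s \<odot>\<^bsub>M\<^esub> (fraction D a s \<odot>\<^bsub>V\<^esub> m) = a \<odot>\<^bsub>M\<^esub> m"
proof -
  obtain n where n: "n \<in> carrier M" "s \<odot>\<^bsub>M\<^esub> n = a \<odot>\<^bsub>M\<^esub> m"
    using divisible[OF s, of "a \<odot>\<^bsub>M\<^esub> m"] a m by auto
  have "t \<odot>\<^bsub>M\<^esub> n = b \<odot>\<^bsub>M\<^esub> m" if "(b, t) \<in> fraction D a s" for b t
  proof -
    have bt: "b \<in> carrier D" "t \<in> carrier D - {\<zero>}" "a \<otimes> t = b \<otimes> s"
      using that D.mem_fraction_iff[OF a s] by auto
    have "s \<odot>\<^bsub>M\<^esub> (t \<odot>\<^bsub>M\<^esub> n) = t \<odot>\<^bsub>M\<^esub> (s \<odot>\<^bsub>M\<^esub> n)"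
      using s bt n(1) by (simp add: M.smult_assoc1[symmetric] D.m_comm)
    also have "\<dots> = (a \<otimes> t) \<odot>\<^bsub>M\<^esub> m"
      unfolding n(2) using a bt m by (simp add: M.smult_assoc1[symmetric] D.m_comm)
    also have "\<dots> = s \<odot>\<^bsub>M\<^esub> (b \<odot>\<^bsub>M\<^esub> m)"
      unfolding bt(3) using s bt m by (simp add: M.smult_assoc1[symmetric] D.m_comm)
    finally show ?thesis using smult_cancel[OF s] bt n m by auto
  qed
  moreover have "(a, s) \<in> fraction D a s" using D.mem_fraction_iff[OF a s] a s by simp
  ultimately have "fraction D a s \<odot>\<^bsub>V\<^esub> m = n"
    unfolding quotient_field_space_def module.select_convs
  proof (intro the_equality)
    fix n' assume "n' \<in> carrier M \<and> (\<forall>(a, s)\<in>fraction D a s. s \<odot>\<^bsub>M\<^esub> n' = a \<odot>\<^bsub>M\<^esub> m)"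
    then show "n' = n" using \<open>(a, s) \<in> fraction D a s\<close> n smult_cancel[OF s, of n' n] by auto
  qed (use n in auto)
  then show ?thesis using n by simp
qed

lemma smult_fraction_eq:
  assumes "a \<in> carrier D" "s \<in> carrier D - {\<zero>}" "m \<in> carrier M" "n \<in> carrier M" "s \<odot>\<^bsub>M\<^esub> n = a \<odot>\<^bsub>M\<^esub> m"
  shows "fraction D a s \<odot>\<^bsub>V\<^esub> m = n"
  using smult_fraction_ex1[OF assms(1-3)] assms smult_cancel[OF assms(2)] by metis

lemma vectorspace_V: "vectorspace K V"
proof -
  interpret K: field K by (rule D.field_quotient_field)
  have one: "\<one> \<in> carrier D - {\<zero>}" by simp
  have "abelian_group V"
  proof (rule abelian_groupI)
    fix x assume "x \<in> carrier V"
    then show "\<exists>y\<in>carrier V. y \<oplus>\<^bsub>V\<^esub> x = \<zero>\<^bsub>V\<^esub>" using M.M.l_neg[of x] by auto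
  qed (auto simp: M.M.a_ac)
  moreover have "module_axioms K V"
  proof
    fix p x assume "p \<in> carrier K" and "x \<in> carrier V"
    then have x: "x \<in> carrier M" by simp
    obtain a s where a: "a \<in> carrier D" "s \<in> carrier D - {\<zero>}" and p: "p = fraction D a s"
      using \<open>p \<in> carrier K\<close> by (rule D.quotient_fieldE)
    note px = smult_fraction_ex1[OF a x]
    have s: "s \<in> carrier D" using a by simp
    show "p \<odot>\<^bsub>V\<^esub> x \<in> carrier V" using px p by simp
    show "p \<odot>\<^bsub>V\<^esub> (x \<oplus>\<^bsub>V\<^esub> y) = p \<odot>\<^bsub>V\<^esub> x \<oplus>\<^bsub>V\<^esub> p \<odot>\<^bsub>V\<^esub> y" if "y \<in> carrier V" for y
    proof -
      have y: "y \<in> carrier M" using that by simp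
      show ?thesis
        unfolding p V_simps
        by (rule smult_fraction_eq) (use a s x y px smult_fraction_ex1[OF a y] in \<open>auto simp: M.smult_r_distr\<close>)
    qed
    fix q assume "q \<in> carrier K"
    then obtain b t where b: "b \<in> carrier D" "t \<in> carrier D - {\<zero>}" and q: "q = fraction D b t"
      by (rule D.quotient_fieldE)
    note qx = smult_fraction_ex1[OF b x]
    have t: "t \<in> carrier D" using b by simp
    note st = D.nonzero_mult[OF a(2) b(2)]
    show "(p \<oplus>\<^bsub>K\<^esub> q) \<odot>\<^bsub>V\<^esub> x = p \<odot>\<^bsub>V\<^esub> x \<oplus>\<^bsub>V\<^esub> q \<odot>\<^bsub>V\<^esub> x"
      unfolding p q D.add_fraction[OF a b] V_simps
    proof (rule smult_fraction_eq)
      let ?y = "fraction D a s \<odot>\<^bsub>V\<^esub> x" and ?z = "fraction D b t \<odot>\<^bsub>V\<^esub> x"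
      have "(s \<otimes> t) \<odot>\<^bsub>M\<^esub> (?y \<oplus>\<^bsub>M\<^esub> ?z) = (t \<otimes> s) \<odot>\<^bsub>M\<^esub> ?y \<oplus>\<^bsub>M\<^esub> (s \<otimes> t) \<odot>\<^bsub>M\<^esub> ?z"
        using s t px qx by (simp add: M.smult_r_distr D.m_comm)
      also have "\<dots> = t \<odot>\<^bsub>M\<^esub> (a \<odot>\<^bsub>M\<^esub> x) \<oplus>\<^bsub>M\<^esub> s \<odot>\<^bsub>M\<^esub> (b \<odot>\<^bsub>M\<^esub> x)"
        using s t px qx by (simp add: M.smult_assoc1)
      also have "\<dots> = (t \<otimes> a \<oplus> s \<otimes> b) \<odot>\<^bsub>M\<^esub> x"
        using s t a b x by (simp add: M.smult_assoc1 M.smult_l_distr)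
      finally show "(s \<otimes> t) \<odot>\<^bsub>M\<^esub> (?y \<oplus>\<^bsub>M\<^esub> ?z) = (a \<otimes> t \<oplus> b \<otimes> s) \<odot>\<^bsub>M\<^esub> x"
        using s t a b by (simp add: D.m_comm)
    qed (use a b s t st x px qx in auto)
    show "(p \<otimes>\<^bsub>K\<^esub> q) \<odot>\<^bsub>V\<^esub> x = p \<odot>\<^bsub>V\<^esub> (q \<odot>\<^bsub>V\<^esub> x)"
      unfolding p q D.mult_fraction[OF a b]
    proof (rule smult_fraction_eq)
      let ?z = "fraction D b t \<odot>\<^bsub>V\<^esub> x"
      have z: "?z \<in> carrier M" using qx by simp
      note y = smult_fraction_ex1[OF a z]
      let ?y = "fraction D a s \<odot>\<^bsub>V\<^esub> ?z"
      have "(s \<otimes> t) \<odot>\<^bsub>M\<^esub> ?y = (t \<otimes> s) \<odot>\<^bsub>M\<^esub> ?y"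
        using s t by (simp add: D.m_comm)
      also have "\<dots> = t \<odot>\<^bsub>M\<^esub> (s \<odot>\<^bsub>M\<^esub> ?y)"
        using s t y by (intro M.smult_assoc1) auto
      also have "\<dots> = a \<odot>\<^bsub>M\<^esub> (t \<odot>\<^bsub>M\<^esub> ?z)"
        using y t a z by (simp add: M.smult_assoc1[symmetric] D.m_comm)
      also have "\<dots> = (a \<otimes> b) \<odot>\<^bsub>M\<^esub> x" using qx a b x by (simp add: M.smult_assoc1)
      finally show "(s \<otimes> t) \<odot>\<^bsub>M\<^esub> ?y = (a \<otimes> b) \<odot>\<^bsub>M\<^esub> x" .
      show "?y \<in> carrier M" using y by simp
    qed (use a b st x in auto)
  next
    fix x assume "x \<in> carrier V"
    then show "\<one>\<^bsub>K\<^esub> \<odot>\<^bsub>V\<^esub> x = x"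
      unfolding D.one_quotient_field using one by (intro smult_fraction_eq) auto
  qed
  ultimately show ?thesis
    by (intro vectorspace.intro module.intro K.is_cring K.field_axioms)
qed

lemma submodule_V_iff:
  "submodule K U V \<longleftrightarrow> submodule D U M \<and>
     (\<forall>s\<in>carrier D - {\<zero>}. \<forall>v\<in>carrier M. s \<odot>\<^bsub>M\<^esub> v \<in> U \<longrightarrow> v \<in> U)"
proof
  assume "submodule K U V"
  then interpret U: submodule K U V .
  have Ucarr: "v \<in> carrier M" if "v \<in> U" for v using U.subset that by auto
  have one: "\<one> \<in> carrier D - {\<zero>}" by simp
  have frac: "fraction D a s \<odot>\<^bsub>V\<^esub> v \<in> U" if "a \<in> carrier D" "s \<in> carrier D - {\<zero>}" "v \<in> U" for a s v
    using that by (intro U.smult_closed) (auto simp: D.carrier_quotient_field)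
  have "submodule D U M"
  proof
    show "U \<subseteq> carrier M" "\<zero>\<^bsub>M\<^esub> \<in> U" using Ucarr U.zero_closed by auto
    show "v \<oplus>\<^bsub>M\<^esub> w \<in> U" if "v \<in> U" "w \<in> U" for v w using U.m_closed[OF that] by simp
    show "r \<odot>\<^bsub>M\<^esub> v \<in> U" if "r \<in> carrier D" "v \<in> U" for r v
      using frac[OF that(1) one that(2)] smult_fraction_eq[OF that(1) one, of v "r \<odot>\<^bsub>M\<^esub> v"] that Ucarr by simp
  qed
  moreover have "v \<in> U" if "s \<in> carrier D - {\<zero>}" "v \<in> carrier M" "s \<odot>\<^bsub>M\<^esub> v \<in> U" for s v
    using frac[OF _ that(1,3), of \<one>] smult_fraction_eq[of \<one> s "s \<odot>\<^bsub>M\<^esub> v" v] that by simp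
  ultimately show "submodule D U M \<and> (\<forall>s\<in>carrier D - {\<zero>}. \<forall>v\<in>carrier M. s \<odot>\<^bsub>M\<^esub> v \<in> U \<longrightarrow> v \<in> U)" by blast
next
  assume U: "submodule D U M \<and> (\<forall>s\<in>carrier D - {\<zero>}. \<forall>v\<in>carrier M. s \<odot>\<^bsub>M\<^esub> v \<in> U \<longrightarrow> v \<in> U)"
  then interpret U: submodule D U M by simp
  interpret V: vectorspace K V by (rule vectorspace_V)
  show "submodule K U V"
  proof
    fix p v assume "p \<in> carrier K" and v: "v \<in> U"
    then obtain a s where a: "a \<in> carrier D" "s \<in> carrier D - {\<zero>}" and p: "p = fraction D a s"
      by (blast elim: D.quotient_fieldE)
    have "v \<in> carrier M" using U.subset v by auto
    note pv = smult_fraction_ex1[OF a this]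
    have "a \<odot>\<^bsub>M\<^esub> v \<in> U" using a v by simp
    then show "p \<odot>\<^bsub>V\<^esub> v \<in> U" using U a pv p by auto
  qed (use U.subset in auto)
qed

end

section \<open>Pure ideals inside the nilradical\<close>

context nonchain_fqp
begin

text \<open>
  The pure ideals are exactly the subspaces of \<open>N\<close> over the quotient field of \<open>R/N\<close>.
\<close>

definition pure :: "'a set \<Rightarrow> bool" where
  "pure U \<longleftrightarrow> ideal U R \<and> U \<subseteq> N \<and> (\<forall>s\<in>carrier R - N. \<forall>v\<in>N. s \<otimes> v \<in> U \<longrightarrow> v \<in> U)"

lemma pureD:
  assumes "pure U"
  shows "ideal U R" "U \<subseteq> N" "s \<in> carrier R - N \<Longrightarrow> v \<in> N \<Longrightarrow> s \<otimes> v \<in> U \<Longrightarrow> v \<in> U"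
  using assms unfolding pure_def by auto

lemma pureI:
  assumes "ideal U R" "U \<subseteq> N" "\<And>s v. s \<in> carrier R - N \<Longrightarrow> v \<in> N \<Longrightarrow> s \<otimes> v \<in> U \<Longrightarrow> v \<in> U"
  shows "pure U"
  using assms unfolding pure_def by auto

lemma pure_N: "pure N"
  unfolding pure_def using ideal_N by auto

lemma pure_zero: "pure {\<zero>}"
  unfolding pure_def using zeroideal N_zero torsionfree N_carr by auto

lemma pure_hull:
  assumes "A \<subseteq> N"
  shows "pure (pure hull A)"
proof (rule pureI)
  let ?T = "{t. pure t \<and> A \<subseteq> t}"
  have N: "N \<in> ?T" using pure_N assms by simp
  show "ideal (pure hull A) R"
    unfolding hull_def by (rule i_Intersect) (use N pureD(1) in auto)
  show "pure hull A \<subseteq> N" unfolding hull_def using N by blast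
  fix s v assume "s \<in> carrier R - N" "v \<in> N" "s \<otimes> v \<in> pure hull A"
  then show "v \<in> pure hull A" unfolding hull_def using pureD(3)[of _ s v] by simp
qed

lemma hull_N: "A \<subseteq> N \<Longrightarrow> v \<in> pure hull A \<Longrightarrow> v \<in> N"
  using pureD(2)[OF pure_hull] by blast

lemma hull_empty: "pure hull {} = {\<zero>}"
proof (rule antisym)
  show "pure hull {} \<subseteq> {\<zero>}" by (rule hull_minimal) (auto intro: pure_zero)
  interpret H: ideal "pure hull {}" R using pureD(1)[OF pure_hull] by simp
  show "{\<zero>} \<subseteq> pure hull {}" by simp
qed

text \<open>
  The linear relation generated by \<open>g\<close> and the pair \<open>(e, x)\<close>, closed under division by elements
  outside \<open>N\<close>.
\<close>

definition adjoin :: "('a \<times> 'a) set \<Rightarrow> 'a \<Rightarrow> 'a \<Rightarrow> ('a \<times> 'a) set" where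
  "adjoin g e x = {(v, y). v \<in> carrier R \<and> y \<in> carrier R \<and> (\<exists>s\<in>carrier R - N. \<exists>r\<in>carrier R. \<exists>w h.
     (w, h) \<in> g \<and> s \<otimes> v = r \<otimes> e \<oplus> w \<and> s \<otimes> y = r \<otimes> x \<oplus> h)}"

lemma linear_relation_adjoin:
  assumes g: "linear_relation g" and e: "e \<in> carrier R" and x: "x \<in> carrier R"
  shows "linear_relation (adjoin g e x)"
proof (rule linear_relationI)
  note gc = linear_relationD(1,2)[OF g]
  have I: "(v, y) \<in> adjoin g e x"
    if "v \<in> carrier R" "y \<in> carrier R" "s \<in> carrier R - N" "r \<in> carrier R" "(w, h) \<in> g"
      "s \<otimes> v = r \<otimes> e \<oplus> w" "s \<otimes> y = r \<otimes> x \<oplus> h" for v y s r w h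
    unfolding adjoin_def using that by blast
  have E: "v \<in> carrier R \<and> y \<in> carrier R \<and> (\<exists>s r w h. s \<in> carrier R - N \<and> r \<in> carrier R \<and>
      (w, h) \<in> g \<and> s \<otimes> v = r \<otimes> e \<oplus> w \<and> s \<otimes> y = r \<otimes> x \<oplus> h)" if "(v, y) \<in> adjoin g e x" for v y
    using that unfolding adjoin_def by blast
  show "v \<in> carrier R \<and> y \<in> carrier R" if "(v, y) \<in> adjoin g e x" for v y using E[OF that] by blast
  show "(\<zero>, \<zero>) \<in> adjoin g e x"
    by (rule I[of \<zero> \<zero> \<one> \<zero> \<zero> \<zero>]) (use one_notin_N linear_relationD(3)[OF g] e x in auto)
  fix v y assume vy: "(v, y) \<in> adjoin g e x"
  obtain s r w h where 1: "v \<in> carrier R" "y \<in> carrier R" "s \<in> carrier R - N" "r \<in> carrier R"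
    "(w, h) \<in> g" "s \<otimes> v = r \<otimes> e \<oplus> w" "s \<otimes> y = r \<otimes> x \<oplus> h" using E[OF vy] by metis
  have s: "s \<in> carrier R" using 1(3) by simp
  note c1 = 1(1,2,4) s gc[OF 1(5)] e x
  show "(q \<otimes> v, q \<otimes> y) \<in> adjoin g e x" if q: "q \<in> carrier R" for q
  proof (rule I)
    show "(q \<otimes> w, q \<otimes> h) \<in> g" by (intro linear_relationD(5)[OF g] 1 q)
    have "s \<otimes> (q \<otimes> v) = q \<otimes> (s \<otimes> v)" using c1 q by algebra
    also have "\<dots> = (q \<otimes> r) \<otimes> e \<oplus> q \<otimes> w" unfolding 1(6) using c1 q by algebra
    finally show "s \<otimes> (q \<otimes> v) = (q \<otimes> r) \<otimes> e \<oplus> q \<otimes> w" .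
    have "s \<otimes> (q \<otimes> y) = q \<otimes> (s \<otimes> y)" using c1 q by algebra
    also have "\<dots> = (q \<otimes> r) \<otimes> x \<oplus> q \<otimes> h" unfolding 1(7) using c1 q by algebra
    finally show "s \<otimes> (q \<otimes> y) = (q \<otimes> r) \<otimes> x \<oplus> q \<otimes> h" .
  qed (use 1 c1 q in auto)
  fix v' y' assume vy': "(v', y') \<in> adjoin g e x"
  obtain s' r' w' h' where 2: "v' \<in> carrier R" "y' \<in> carrier R" "s' \<in> carrier R - N" "r' \<in> carrier R"
    "(w', h') \<in> g" "s' \<otimes> v' = r' \<otimes> e \<oplus> w'" "s' \<otimes> y' = r' \<otimes> x \<oplus> h'" using E[OF vy'] by metis
  have s': "s' \<in> carrier R" using 2(3) by simp
  note c = c1 2(1,2,4) s' gc[OF 2(5)]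
  show "(v \<oplus> v', y \<oplus> y') \<in> adjoin g e x"
  proof (rule I[OF _ _ N_complement_mult[OF 1(3) 2(3)]])
    show "(s' \<otimes> w \<oplus> s \<otimes> w', s' \<otimes> h \<oplus> s \<otimes> h') \<in> g"
      by (intro linear_relationD(4)[OF g] linear_relationD(5)[OF g] 1 2 s s')
    have "(s \<otimes> s') \<otimes> (v \<oplus> v') = s' \<otimes> (s \<otimes> v) \<oplus> s \<otimes> (s' \<otimes> v')" using c by algebra
    also have "\<dots> = (s' \<otimes> r \<oplus> s \<otimes> r') \<otimes> e \<oplus> (s' \<otimes> w \<oplus> s \<otimes> w')" unfolding 1(6) 2(6) using c by algebra
    finally show "(s \<otimes> s') \<otimes> (v \<oplus> v') = (s' \<otimes> r \<oplus> s \<otimes> r') \<otimes> e \<oplus> (s' \<otimes> w \<oplus> s \<otimes> w')" .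
    have "(s \<otimes> s') \<otimes> (y \<oplus> y') = s' \<otimes> (s \<otimes> y) \<oplus> s \<otimes> (s' \<otimes> y')" using c by algebra
    also have "\<dots> = (s' \<otimes> r \<oplus> s \<otimes> r') \<otimes> x \<oplus> (s' \<otimes> h \<oplus> s \<otimes> h')" unfolding 1(7) 2(7) using c by algebra
    finally show "(s \<otimes> s') \<otimes> (y \<oplus> y') = (s' \<otimes> r \<oplus> s \<otimes> r') \<otimes> x \<oplus> (s' \<otimes> h \<oplus> s \<otimes> h')" .
  qed (use c in auto)
qed

lemma mem_adjoin_zero_iff:
  assumes B: "ideal B R" and c: "e \<in> carrier R" "x \<in> carrier R" "v \<in> carrier R" "y \<in> carrier R"
  shows "(v, y) \<in> adjoin (B \<times> {\<zero>}) e x \<longleftrightarrow>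
    (\<exists>s\<in>carrier R - N. \<exists>r\<in>carrier R. s \<otimes> v \<ominus> r \<otimes> e \<in> B \<and> s \<otimes> y = r \<otimes> x)"
proof -
  interpret B: ideal B R by fact
  have "(\<exists>w h. (w, h) \<in> B \<times> {\<zero>} \<and> s \<otimes> v = r \<otimes> e \<oplus> w \<and> s \<otimes> y = r \<otimes> x \<oplus> h) \<longleftrightarrow>
      s \<otimes> v \<ominus> r \<otimes> e \<in> B \<and> s \<otimes> y = r \<otimes> x" if "s \<in> carrier R - N" "r \<in> carrier R" for s r
  proof
    have s: "s \<in> carrier R" "r \<in> carrier R" using that by auto
    assume "\<exists>w h. (w, h) \<in> B \<times> {\<zero>} \<and> s \<otimes> v = r \<otimes> e \<oplus> w \<and> s \<otimes> y = r \<otimes> x \<oplus> h"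
    then obtain w where w: "w \<in> B" "s \<otimes> v = r \<otimes> e \<oplus> w" "s \<otimes> y = r \<otimes> x \<oplus> \<zero>" by blast
    have "(r \<otimes> e \<oplus> w) \<ominus> r \<otimes> e = w" using s c B.Icarr[OF w(1)] by algebra
    then show "s \<otimes> v \<ominus> r \<otimes> e \<in> B \<and> s \<otimes> y = r \<otimes> x" unfolding w(2,3) using w(1) s c by simp
  next
    have s: "s \<in> carrier R" "r \<in> carrier R" using that by auto
    assume B: "s \<otimes> v \<ominus> r \<otimes> e \<in> B \<and> s \<otimes> y = r \<otimes> x"
    have "s \<otimes> v = r \<otimes> e \<oplus> (s \<otimes> v \<ominus> r \<otimes> e)" using s c by algebra
    moreover have "s \<otimes> y = r \<otimes> x \<oplus> \<zero>" using B s c by simp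
    ultimately show "\<exists>w h. (w, h) \<in> B \<times> {\<zero>} \<and> s \<otimes> v = r \<otimes> e \<oplus> w \<and> s \<otimes> y = r \<otimes> x \<oplus> h"
      using B by blast
  qed
  then show ?thesis unfolding adjoin_def using c by simp
qed

lemma mem_hull_insert_iff:
  assumes B: "B \<subseteq> N" and e: "e \<in> N"
  shows "v \<in> pure hull (insert e B) \<longleftrightarrow>
    v \<in> N \<and> (\<exists>s\<in>carrier R - N. \<exists>r\<in>carrier R. s \<otimes> v \<ominus> r \<otimes> e \<in> pure hull B)"
proof
  let ?H = "pure hull B"
  interpret H: ideal ?H R by (rule pureD(1)[OF pure_hull[OF B]])
  note ec = N_carr[OF e]
  define T where "T = N \<inter> Domain (adjoin (?H \<times> {\<zero>}) e \<zero>)"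
  have mem_adjoin: "(v, y) \<in> adjoin (?H \<times> {\<zero>}) e \<zero> \<longleftrightarrow>
      (\<exists>s\<in>carrier R - N. \<exists>r\<in>carrier R. s \<otimes> v \<ominus> r \<otimes> e \<in> ?H \<and> s \<otimes> y = r \<otimes> \<zero>)"
    if "v \<in> carrier R" "y \<in> carrier R" for v y
    by (rule mem_adjoin_zero_iff[OF H.is_ideal ec zero_closed that])
  have lin: "linear_relation (adjoin (?H \<times> {\<zero>}) e \<zero>)"
    by (intro linear_relation_adjoin linear_relation_Times H.is_ideal zeroideal ec zero_closed)
  have TE: "\<exists>s\<in>carrier R - N. \<exists>r\<in>carrier R. s \<otimes> v \<ominus> r \<otimes> e \<in> ?H" if v: "v \<in> T" for v
  proof -
    obtain y where y: "(v, y) \<in> adjoin (?H \<times> {\<zero>}) e \<zero>" using v by (auto simp: T_def)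
    then show ?thesis using mem_adjoin[OF linear_relationD(1,2)[OF lin y]] by blast
  qed
  have TI: "v \<in> T" if "v \<in> N" "s \<in> carrier R - N" "r \<in> carrier R" "s \<otimes> v \<ominus> r \<otimes> e \<in> ?H" for v s r
  proof -
    have "s \<otimes> \<zero> = r \<otimes> \<zero>" using that by simp
    then have "(v, \<zero>) \<in> adjoin (?H \<times> {\<zero>}) e \<zero>" using mem_adjoin[OF N_carr zero_closed] that by blast
    then show ?thesis using that(1) by (auto simp: T_def)
  qed
  have "ideal T R" unfolding T_def by (intro i_intersect ideal_N linear_relation_Domain lin)
  moreover have "v \<in> T" if t: "t \<in> carrier R - N" and v: "v \<in> N" and tv: "t \<otimes> v \<in> T" for t v
  proof -
    obtain s r where s: "s \<in> carrier R - N" and r: "r \<in> carrier R"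
      and mem: "s \<otimes> (t \<otimes> v) \<ominus> r \<otimes> e \<in> ?H" using TE[OF tv] by blast
    have "s \<otimes> (t \<otimes> v) = (s \<otimes> t) \<otimes> v" using s t N_carr[OF v] by (simp add: m_assoc)
    then show ?thesis using TI[OF v N_complement_mult[OF s t] r] mem by simp
  qed
  ultimately have "pure T" by (intro pureI) (auto simp: T_def)
  moreover have "insert e B \<subseteq> T"
  proof -
    have one: "\<one> \<in> carrier R - N" using one_notin_N by simp
    have "e \<in> T" by (rule TI[OF e one, of \<one>]) (use ec in auto)
    moreover have "b \<in> T" if "b \<in> B" for b
    proof -
      have "b \<in> N" "b \<in> carrier R" using that B N_carr by auto
      moreover have "b \<in> ?H" using that by (rule hull_inc)
      ultimately show ?thesis using TI[OF \<open>b \<in> N\<close> one, of \<zero>] ec by (simp add: a_minus_def)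
    qed
    ultimately show ?thesis by auto
  qed
  ultimately have "pure hull (insert e B) \<subseteq> T" by (intro hull_minimal)
  moreover assume "v \<in> pure hull (insert e B)"
  ultimately have "v \<in> T" by blast
  then show "v \<in> N \<and> (\<exists>s\<in>carrier R - N. \<exists>r\<in>carrier R. s \<otimes> v \<ominus> r \<otimes> e \<in> ?H)"
    using TE by (simp add: T_def)
next
  let ?H = "pure hull (insert e B)"
  assume "v \<in> N \<and> (\<exists>s\<in>carrier R - N. \<exists>r\<in>carrier R. s \<otimes> v \<ominus> r \<otimes> e \<in> pure hull B)"
  then obtain s r where v: "v \<in> N" and s: "s \<in> carrier R - N" and r: "r \<in> carrier R"
    and mem: "s \<otimes> v \<ominus> r \<otimes> e \<in> pure hull B" by blast
  have P: "pure ?H" using B e by (intro pure_hull) simp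
  interpret H: ideal ?H R by (rule pureD(1)[OF P])
  have "pure hull B \<subseteq> ?H" by (rule hull_mono) auto
  moreover have "e \<in> ?H" by (rule hull_inc) simp
  ultimately have "(s \<otimes> v \<ominus> r \<otimes> e) \<oplus> r \<otimes> e \<in> ?H" using mem r by (intro H.a_closed H.I_l_closed) auto
  moreover have c: "v \<in> carrier R" "s \<in> carrier R" "e \<in> carrier R" using v s N_carr e by auto
  have "(s \<otimes> v \<ominus> r \<otimes> e) \<oplus> r \<otimes> e = s \<otimes> v" using c r by algebra
  ultimately show "v \<in> ?H" using pureD(3)[OF P s v] by simp
qed

lemma mem_hull_singleton_iff:
  assumes "b \<in> N"
  shows "v \<in> pure hull {b} \<longleftrightarrow> v \<in> N \<and> (\<exists>s\<in>carrier R - N. \<exists>r\<in>carrier R. s \<otimes> v = r \<otimes> b)"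
proof -
  have "s \<otimes> v \<ominus> r \<otimes> b = \<zero> \<longleftrightarrow> s \<otimes> v = r \<otimes> b" if "v \<in> N" "s \<in> carrier R - N" "r \<in> carrier R" for s r
    using that N_carr assms by simp
  then show ?thesis unfolding mem_hull_insert_iff[OF empty_subsetI assms] hull_empty singleton_iff by blast
qed

lemma hull_finite_subset:
  assumes S: "S \<subseteq> N" and v: "v \<in> pure hull S"
  obtains F where "finite F" "F \<subseteq> S" "v \<in> pure hull F"
proof -
  define T where "T = (\<Union>F\<in>{F. finite F \<and> F \<subseteq> S}. pure hull F)"
  have pureF: "pure (pure hull F)" if "F \<subseteq> S" for F using that S by (intro pure_hull) auto
  have TE: "\<exists>F. finite F \<and> F \<subseteq> S \<and> v \<in> pure hull F" if "v \<in> T" for v using that by (auto simp: T_def)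
  have TI: "v \<in> T" if "finite F" "F \<subseteq> S" "v \<in> pure hull F" for v F using that by (auto simp: T_def)
  have TN: "T \<subseteq> N" unfolding T_def by (rule UN_least) (rule pureD(2)[OF pureF], simp)
  have "ideal T R"
  proof (rule ideal_ofI)
    show "T \<subseteq> carrier R" using TN N_carr by blast
    show "\<zero> \<in> T" by (rule TI[of "{}"]) (auto simp: hull_empty)
  next
    fix v w assume "v \<in> T" "w \<in> T"
    then obtain F G where F: "finite F" "F \<subseteq> S" "v \<in> pure hull F" and G: "finite G" "G \<subseteq> S" "w \<in> pure hull G"
      using TE by meson
    interpret H: ideal "pure hull (F \<union> G)" R by (rule pureD(1)[OF pureF]) (use F G in auto)
    have "v \<oplus> w \<in> pure hull (F \<union> G)"
      using F G hull_mono[of F "F \<union> G" pure] hull_mono[of G "F \<union> G" pure] by (intro H.a_closed) auto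
    then show "v \<oplus> w \<in> T" using F G by (intro TI[of "F \<union> G"]) auto
  next
    fix r v assume r: "r \<in> carrier R" and "v \<in> T"
    then obtain F where F: "finite F" "F \<subseteq> S" "v \<in> pure hull F" using TE by meson
    show "r \<otimes> v \<in> T"
      by (rule TI[OF F(1,2)]) (rule ideal.I_l_closed[OF pureD(1)[OF pureF[OF F(2)]] F(3) r])
  qed
  moreover have "v \<in> T" if s: "s \<in> carrier R - N" and v: "v \<in> N" and sv: "s \<otimes> v \<in> T" for s v
  proof -
    obtain F where F: "finite F" "F \<subseteq> S" "s \<otimes> v \<in> pure hull F" using TE[OF sv] by meson
    show ?thesis by (rule TI[OF F(1,2)]) (rule pureD(3)[OF pureF[OF F(2)] s v F(3)])
  qed
  ultimately have "pure T" using TN by (intro pureI)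
  moreover have "S \<subseteq> T"
  proof
    fix x assume "x \<in> S"
    then show "x \<in> T" by (intro TI[of "{x}"]) (auto intro: hull_inc)
  qed
  ultimately have "pure hull S \<subseteq> T" by (intro hull_minimal)
  then obtain F where "finite F \<and> F \<subseteq> S \<and> v \<in> pure hull F" using TE v by blast
  then show thesis using that by blast
qed

section \<open>The rank of the nilradical\<close>

text \<open>
  All elements of a coset of \<open>N\<close> act on \<open>N\<close> in the same way, because \<open>N\<^sup>2 = 0\<close>.
\<close>

lemma smult_module_over_quotient:
  assumes r: "r \<in> carrier R" and m: "m \<in> N"
  shows "(N +> r) \<odot>\<^bsub>module_over_quotient (ideal_module R N)\<^esub> m = r \<otimes> m"
proof -
  have "x \<otimes> m = r \<otimes> m" if x: "x \<in> N +> r" for x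
  proof -
    obtain n where "n \<in> N" "x = n \<oplus> r" using x by (auto simp: a_r_coset_def')
    then show ?thesis using r m N_mult_N[of n m] by (simp add: N_carr l_distr)
  qed
  moreover have "\<zero> \<oplus> r \<in> N +> r" unfolding a_r_coset_def' using N_zero by blast
  then have "N +> r \<noteq> {}" by blast
  ultimately have "(\<lambda>r. r \<otimes> m) ` (N +> r) = {r \<otimes> m}" by (auto simp: image_def)
  then show ?thesis by (simp add: module_over_quotient_def)
qed

lemma module_over_quotient_simps [simp]:
  "carrier (module_over_quotient (ideal_module R N)) = N"
  "\<zero>\<^bsub>module_over_quotient (ideal_module R N)\<^esub> = \<zero>"
  "x \<oplus>\<^bsub>module_over_quotient (ideal_module R N)\<^esub> y = x \<oplus> y"
  by (simp_all add: module_over_quotient_def)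

lemma carrier_Quot: "C \<in> carrier (R Quot N) \<longleftrightarrow> (\<exists>r\<in>carrier R. C = N +> r)"
  by (auto simp: FactRing_def A_RCOSETS_def')

lemma coset_N_zero: "r \<in> carrier R \<Longrightarrow> N +> r = N \<longleftrightarrow> r \<in> N"
  using ideal.rcos_const_imp_mem[OF ideal_N] a_rcos_zero[OF ideal_N] by blast

lemma Quot_nonzeroE:
  assumes "C \<in> carrier (R Quot N) - {\<zero>\<^bsub>R Quot N\<^esub>}"
  obtains s where "s \<in> carrier R - N" "C = N +> s"
proof -
  obtain s where "s \<in> carrier R" "C = N +> s" "C \<noteq> N" using assms carrier_Quot by (auto simp: FactRing_def)
  then show thesis using that coset_N_zero by auto
qed

lemma torsionfree_divisible_N:
  "torsionfree_divisible (R Quot N) (module_over_quotient (ideal_module R N))"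
proof -
  let ?D = "R Quot N" and ?M = "module_over_quotient (ideal_module R N)"
  interpret N: primeideal N R by (rule primeideal_N)
  interpret D: "domain" ?D by (rule N.quotient_is_domain)
  note sm = smult_module_over_quotient
  have "abelian_group ?M"
  proof (rule abelian_groupI)
    fix x assume "x \<in> carrier ?M"
    then show "\<exists>y\<in>carrier ?M. y \<oplus>\<^bsub>?M\<^esub> x = \<zero>\<^bsub>?M\<^esub>"
      by (auto intro!: bexI[of _ "\<ominus> x"] simp: N_carr l_neg)
  qed (auto simp: N_carr a_ac)
  moreover have "module_axioms ?D ?M"
  proof
    fix C x assume "C \<in> carrier ?D" and x': "x \<in> carrier ?M"
    then obtain r where r: "r \<in> carrier R" "C = N +> r" using carrier_Quot by auto
    have x: "x \<in> N" "x \<in> carrier R" using x' N_carr by auto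
    show "C \<odot>\<^bsub>?M\<^esub> x \<in> carrier ?M" using r x by (simp add: sm N_mult)
    show "C \<odot>\<^bsub>?M\<^esub> (x \<oplus>\<^bsub>?M\<^esub> y) = C \<odot>\<^bsub>?M\<^esub> x \<oplus>\<^bsub>?M\<^esub> C \<odot>\<^bsub>?M\<^esub> y" if "y \<in> carrier ?M" for y
      using r x that by (simp add: sm N_add r_distr N_carr)
    fix C' assume "C' \<in> carrier ?D"
    then obtain q where q: "q \<in> carrier R" "C' = N +> q" using carrier_Quot by auto
    have "C \<oplus>\<^bsub>?D\<^esub> C' = N +> (r \<oplus> q)" using r q N.a_rcos_sum by (simp add: FactRing_def)
    then show "(C \<oplus>\<^bsub>?D\<^esub> C') \<odot>\<^bsub>?M\<^esub> x = C \<odot>\<^bsub>?M\<^esub> x \<oplus>\<^bsub>?M\<^esub> C' \<odot>\<^bsub>?M\<^esub> x"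
      using r q x by (simp add: sm l_distr)
    have "C \<otimes>\<^bsub>?D\<^esub> C' = N +> (r \<otimes> q)" using r q N.rcoset_mult_add by (simp add: FactRing_def)
    then show "(C \<otimes>\<^bsub>?D\<^esub> C') \<odot>\<^bsub>?M\<^esub> x = C \<odot>\<^bsub>?M\<^esub> (C' \<odot>\<^bsub>?M\<^esub> x)"
      using r q x by (simp add: sm m_assoc N_mult)
  next
    fix x assume "x \<in> carrier ?M"
    then show "\<one>\<^bsub>?D\<^esub> \<odot>\<^bsub>?M\<^esub> x = x" using sm[of \<one> x] by (simp add: FactRing_def N_carr)
  qed
  moreover have "torsionfree_divisible_axioms ?D ?M"
  proof
    fix C m assume "C \<in> carrier ?D - {\<zero>\<^bsub>?D\<^esub>}" and m': "m \<in> carrier ?M"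
    then obtain s where s: "s \<in> carrier R - N" "C = N +> s" by (elim Quot_nonzeroE)
    have m: "m \<in> N" using m' by simp
    obtain y where "y \<in> N" "m = s \<otimes> y" using divisible[OF _ _ m, of s] s by auto
    then show "\<exists>n\<in>carrier ?M. C \<odot>\<^bsub>?M\<^esub> n = m" using s sm[of s y] by auto
    assume "C \<odot>\<^bsub>?M\<^esub> m = \<zero>\<^bsub>?M\<^esub>"
    then show "m = \<zero>\<^bsub>?M\<^esub>" using s m sm[of s m] torsionfree[of s m] N_carr by auto
  qed
  ultimately show ?thesis
    by (intro torsionfree_divisible.intro module.intro D.domain_axioms D.is_cring)
qed

text \<open>
  Division by \<open>s \<notin> N\<close> is a scalar multiplication over the quotient field, so the pure ideals are the
  subspaces and hulls are spans.
\<close>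

lemma finite_rank_iff:
  "finite_rank (R Quot N) (module_over_quotient (ideal_module R N)) \<longleftrightarrow>
    (\<exists>A. finite A \<and> A \<subseteq> N \<and> pure hull A = N)"
proof -
  let ?D = "R Quot N" and ?M = "module_over_quotient (ideal_module R N)"
  interpret N: primeideal N R by (rule primeideal_N)
  interpret Q: torsionfree_divisible ?D ?M by (rule torsionfree_divisible_N)
  interpret V: vectorspace Q.K Q.V by (rule Q.vectorspace_V)
  have iff: "submodule Q.K U Q.V \<longleftrightarrow> pure U" for U
    unfolding Q.submodule_V_iff
  proof
    assume U: "submodule ?D U ?M \<and> (\<forall>s\<in>carrier ?D - {\<zero>\<^bsub>?D\<^esub>}. \<forall>v\<in>carrier ?M. s \<odot>\<^bsub>?M\<^esub> v \<in> U \<longrightarrow> v \<in> U)"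
    then interpret U: submodule ?D U ?M by simp
    have UN: "U \<subseteq> N" using U.subset by simp
    have "ideal U R"
    proof (rule ideal_ofI)
      show "U \<subseteq> carrier R" using UN N_carr by blast
      show "\<zero> \<in> U" using U.zero_closed by simp
      show "x \<oplus> y \<in> U" if "x \<in> U" "y \<in> U" for x y using U.m_closed[OF that] by simp
      show "r \<otimes> x \<in> U" if r: "r \<in> carrier R" and x: "x \<in> U" for r x
      proof -
        have "N +> r \<in> carrier ?D" using r carrier_Quot by blast
        from U.smult_closed[OF this x] show ?thesis
          unfolding smult_module_over_quotient[OF r subsetD[OF UN x]] .
      qed
    qed
    moreover have "v \<in> U" if "s \<in> carrier R - N" "v \<in> N" "s \<otimes> v \<in> U" for s v
    proof -
      have "N +> s \<in> carrier ?D - {\<zero>\<^bsub>?D\<^esub>}"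
        using that(1) coset_N_zero[of s] carrier_Quot by (auto simp: FactRing_def)
      then show ?thesis using U that smult_module_over_quotient[of s v] by auto
    qed
    ultimately show "pure U" using UN unfolding pure_def by blast
  next
    assume U: "pure U"
    interpret U: ideal U R by (rule pureD(1)[OF U])
    have "submodule ?D U ?M"
    proof
      fix C x assume "C \<in> carrier ?D" and x: "x \<in> U"
      then obtain r where "r \<in> carrier R" "C = N +> r" using carrier_Quot by auto
      then show "C \<odot>\<^bsub>?M\<^esub> x \<in> U"
        using smult_module_over_quotient[of r x] x pureD(2)[OF U] U.I_l_closed by auto
    qed (use pureD(2)[OF U] in auto)
    moreover have "v \<in> U" if C: "C \<in> carrier ?D - {\<zero>\<^bsub>?D\<^esub>}" and v: "v \<in> carrier ?M"
      and Cv: "C \<odot>\<^bsub>?M\<^esub> v \<in> U" for C v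
    proof -
      obtain s where s: "s \<in> carrier R - N" "C = N +> s" using C by (rule Quot_nonzeroE)
      then show ?thesis using pureD(3)[OF U s(1), of v] v Cv smult_module_over_quotient[of s v] by auto
    qed
    ultimately show "submodule ?D U ?M \<and>
        (\<forall>s\<in>carrier ?D - {\<zero>\<^bsub>?D\<^esub>}. \<forall>v\<in>carrier ?M. s \<odot>\<^bsub>?M\<^esub> v \<in> U \<longrightarrow> v \<in> U)" by blast
  qed
  have span: "V.span A = pure hull A" if A: "A \<subseteq> N" for A
  proof (rule antisym)
    show "V.span A \<subseteq> pure hull A"
      using V.span_is_subset[of A "pure hull A"] iff[of "pure hull A"] pure_hull[OF A] hull_subset[of A pure] by blast
    show "pure hull A \<subseteq> V.span A"
      using V.in_own_span[of A] V.span_is_submodule[of A] A iff by (intro hull_minimal) auto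
  qed
  have "finite_rank ?D ?M \<longleftrightarrow> (\<exists>A. finite A \<and> A \<subseteq> N \<and> V.span A = N)"
    unfolding finite_rank_def V.fin_dim_def by simp
  also have "\<dots> \<longleftrightarrow> (\<exists>A. finite A \<and> A \<subseteq> N \<and> pure hull A = N)"
    by (intro ex_cong1 conj_cong refl) (simp add: span)
  finally show ?thesis .
qed

end

section \<open>Linear compactness in terms of cosets\<close>

context cring
begin

text \<open>
  The nonempty affine sets are exactly the cosets of ideals; this form of closure is inherited by
  intersections, translates and images under linear relations. For an ideal \<open>B\<close>, compactness with
  respect to affine sets is linear compactness.
\<close>

definition affine :: "'a set \<Rightarrow> bool" where
  "affine X \<longleftrightarrow> X \<subseteq> carrier R \<and>
     (\<forall>x\<in>X. \<forall>y\<in>X. \<forall>z\<in>X. \<forall>r\<in>carrier R. x \<oplus> r \<otimes> (y \<ominus> z) \<in> X)"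

definition coset_compact :: "'a set \<Rightarrow> bool" where
  "coset_compact B \<longleftrightarrow> (\<forall>\<X>. (\<forall>X\<in>\<X>. affine X) \<longrightarrow>
     (\<forall>\<G>. finite \<G> \<and> \<G> \<subseteq> \<X> \<longrightarrow> B \<inter> \<Inter>\<G> \<noteq> {}) \<longrightarrow> B \<inter> \<Inter>\<X> \<noteq> {})"

lemma affineI:
  assumes "\<And>x. x \<in> X \<Longrightarrow> x \<in> carrier R"
    and "\<And>x y z r. x \<in> X \<Longrightarrow> y \<in> X \<Longrightarrow> z \<in> X \<Longrightarrow> r \<in> carrier R \<Longrightarrow> x \<oplus> r \<otimes> (y \<ominus> z) \<in> X"
  shows "affine X"
  using assms unfolding affine_def by blast

lemma affineD:
  assumes "affine X"
  shows "x \<in> X \<Longrightarrow> x \<in> carrier R"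
    "x \<in> X \<Longrightarrow> y \<in> X \<Longrightarrow> z \<in> X \<Longrightarrow> r \<in> carrier R \<Longrightarrow> x \<oplus> r \<otimes> (y \<ominus> z) \<in> X"
  using assms unfolding affine_def by blast+

lemma coset_compactI:
  assumes "\<And>\<X>. (\<And>X. X \<in> \<X> \<Longrightarrow> affine X) \<Longrightarrow>
    (\<And>\<G>. finite \<G> \<Longrightarrow> \<G> \<subseteq> \<X> \<Longrightarrow> \<exists>x\<in>B. \<forall>X\<in>\<G>. x \<in> X) \<Longrightarrow> \<exists>x\<in>B. \<forall>X\<in>\<X>. x \<in> X"
  shows "coset_compact B"
  unfolding coset_compact_def
proof (intro allI impI)
  fix \<X> assume aff: "\<forall>X\<in>\<X>. affine X" and fip: "\<forall>\<G>. finite \<G> \<and> \<G> \<subseteq> \<X> \<longrightarrow> B \<inter> \<Inter>\<G> \<noteq> {}"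
  have "\<exists>x\<in>B. \<forall>X\<in>\<X>. x \<in> X"
  proof (rule assms)
    show "affine X" if "X \<in> \<X>" for X using aff that by simp
    show "\<exists>x\<in>B. \<forall>X\<in>\<G>. x \<in> X" if "finite \<G>" "\<G> \<subseteq> \<X>" for \<G>
      using fip[rule_format, of \<G>] that by blast
  qed
  then show "B \<inter> \<Inter>\<X> \<noteq> {}" by blast
qed

lemma coset_compactD:
  assumes "coset_compact B" "\<And>X. X \<in> \<X> \<Longrightarrow> affine X"
    "\<And>\<G>. finite \<G> \<Longrightarrow> \<G> \<subseteq> \<X> \<Longrightarrow> \<exists>x\<in>B. \<forall>X\<in>\<G>. x \<in> X"
  shows "\<exists>x\<in>B. \<forall>X\<in>\<X>. x \<in> X"
proof -
  have "B \<inter> \<Inter>\<X> \<noteq> {}"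
  proof (rule assms(1)[unfolded coset_compact_def, rule_format])
    fix \<G> assume "finite \<G> \<and> \<G> \<subseteq> \<X>"
    then obtain x where "x \<in> B" "\<forall>X\<in>\<G>. x \<in> X" using assms(3) by blast
    then show "B \<inter> \<Inter>\<G> \<noteq> {}" by blast
  qed (rule assms(2))
  then show ?thesis by blast
qed

lemma affine_coset:
  assumes U: "ideal U R" and a: "a \<in> carrier R"
  shows "affine {x \<in> carrier R. x \<ominus> a \<in> U}"
proof (rule affineI)
  interpret U: ideal U R by fact
  fix x y z r assume x: "x \<in> {x \<in> carrier R. x \<ominus> a \<in> U}" and y: "y \<in> {x \<in> carrier R. x \<ominus> a \<in> U}"
    and z: "z \<in> {x \<in> carrier R. x \<ominus> a \<in> U}" and r: "r \<in> carrier R"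
  have c: "x \<in> carrier R" "y \<in> carrier R" "z \<in> carrier R" using x y z by auto
  have "(x \<ominus> a) \<oplus> r \<otimes> ((y \<ominus> a) \<oplus> \<ominus> (z \<ominus> a)) \<in> U"
    using x y z r by (intro U.a_closed U.I_l_closed U.a_inv_closed) auto
  moreover have "(x \<ominus> a) \<oplus> r \<otimes> ((y \<ominus> a) \<oplus> \<ominus> (z \<ominus> a)) = (x \<oplus> r \<otimes> (y \<ominus> z)) \<ominus> a"
    using c r a by algebra
  ultimately show "x \<oplus> r \<otimes> (y \<ominus> z) \<in> {x \<in> carrier R. x \<ominus> a \<in> U}" using c r by simp
qed auto

lemma affine_direction:
  assumes X: "affine X" and a: "a \<in> X"
  shows "ideal {z \<in> carrier R. a \<oplus> z \<in> X} R"
proof (rule ideal_ofI)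
  have ac: "a \<in> carrier R" using affineD[OF X] a by simp
  show "\<zero> \<in> {z \<in> carrier R. a \<oplus> z \<in> X}" using a ac by simp
  fix x y assume "x \<in> {z \<in> carrier R. a \<oplus> z \<in> X}" "y \<in> {z \<in> carrier R. a \<oplus> z \<in> X}"
  then have xy: "x \<in> carrier R" "y \<in> carrier R" "a \<oplus> x \<in> X" "a \<oplus> y \<in> X" by auto
  have "(a \<oplus> x) \<oplus> \<one> \<otimes> ((a \<oplus> y) \<ominus> a) \<in> X" by (rule affineD(2)[OF X xy(3,4) a]) simp
  moreover have "(a \<oplus> x) \<oplus> \<one> \<otimes> ((a \<oplus> y) \<ominus> a) = a \<oplus> (x \<oplus> y)" using xy(1,2) ac by algebra
  ultimately show "x \<oplus> y \<in> {z \<in> carrier R. a \<oplus> z \<in> X}" using xy by simp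
next
  have ac: "a \<in> carrier R" using affineD[OF X] a by simp
  fix r x assume r: "r \<in> carrier R" and "x \<in> {z \<in> carrier R. a \<oplus> z \<in> X}"
  then have x: "x \<in> carrier R" "a \<oplus> x \<in> X" by auto
  have "a \<oplus> r \<otimes> ((a \<oplus> x) \<ominus> a) \<in> X" by (rule affineD(2)[OF X a x(2) a r])
  moreover have "a \<oplus> r \<otimes> ((a \<oplus> x) \<ominus> a) = a \<oplus> r \<otimes> x" using x(1) r ac by algebra
  ultimately show "r \<otimes> x \<in> {z \<in> carrier R. a \<oplus> z \<in> X}" using x r by simp
qed auto

lemma linearly_compact_ring_iff: "linearly_compact_ring R \<longleftrightarrow> coset_compact (carrier R)"
proof -
  let ?M = "ideal_module R (carrier R)"
  define C where "C p = {x \<in> carrier R. x \<ominus> fst p \<in> snd p}" for p :: "'a \<times> 'a set"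
  have solves: "solves_congruences ?M F x \<longleftrightarrow> x \<in> carrier R \<and> (\<forall>p\<in>F. x \<in> C p)"
    if Fc: "\<And>p. p \<in> F \<Longrightarrow> fst p \<in> carrier R" for F x
  proof -
    have "(\<forall>(a, U)\<in>F. x \<ominus>\<^bsub>?M\<^esub> a \<in> U) \<longleftrightarrow> (\<forall>p\<in>F. x \<in> C p)" if "x \<in> carrier R"
      using that Fc a_minus_ideal_module[OF oneideal that]
      by (intro ball_cong refl) (auto simp: C_def)
    then show ?thesis unfolding solves_congruences_def by auto
  qed
  show ?thesis
  proof
    assume "linearly_compact_ring R"
    then have "linearly_compact R ?M" by (simp add: linearly_compact_ring_def)
    then have lc: "\<exists>x. solves_congruences ?M F x"
      if "\<forall>(a, U)\<in>F. a \<in> carrier ?M \<and> submodule R U ?M"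
        "\<forall>G. G \<subseteq> F \<and> finite G \<longrightarrow> (\<exists>x. solves_congruences ?M G x)" for F
      by (rule linearly_compact_def[THEN iffD1, THEN conjunct2, THEN spec, THEN mp, OF _ conjI[OF that]])
    show "coset_compact (carrier R)"
    proof (rule coset_compactI)
      fix \<X> assume aff: "\<And>X. X \<in> \<X> \<Longrightarrow> affine X"
        and fip: "\<And>\<G>. finite \<G> \<Longrightarrow> \<G> \<subseteq> \<X> \<Longrightarrow> \<exists>x\<in>carrier R. \<forall>X\<in>\<G>. x \<in> X"
      define F where "F = {(a, U). a \<in> carrier R \<and> ideal U R \<and> C (a, U) \<in> \<X>}"
      have Fc: "fst p \<in> carrier R" if "p \<in> F" for p using that by (auto simp: F_def)
      have "\<exists>x. solves_congruences ?M F x"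
      proof (rule lc)
        show "\<forall>(a, U)\<in>F. a \<in> carrier ?M \<and> submodule R U ?M"
          using submodule_ideal_module_iff[OF oneideal] ideal.Icarr by (fastforce simp: F_def)
        show "\<forall>G. G \<subseteq> F \<and> finite G \<longrightarrow> (\<exists>x. solves_congruences ?M G x)"
        proof (intro allI impI)
          fix G assume G: "G \<subseteq> F \<and> finite G"
          have "C ` G \<subseteq> \<X>" using G by (auto simp: F_def)
          then have "\<exists>x\<in>carrier R. \<forall>X\<in>C ` G. x \<in> X" using G by (intro fip) auto
          then obtain x where x: "x \<in> carrier R \<and> (\<forall>p\<in>G. x \<in> C p)" by (elim bexE) simp
          have "fst p \<in> carrier R" if "p \<in> G" for p using Fc G that by blast
          from iffD2[OF solves[OF this] x] show "\<exists>x. solves_congruences ?M G x" ..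
        qed
      qed
      then obtain x where "solves_congruences ?M F x" ..
      from iffD1[OF solves[OF Fc] this] have x: "x \<in> carrier R" "\<forall>p\<in>F. x \<in> C p" by auto
      have "x \<in> X" if "X \<in> \<X>" for X
      proof -
        obtain a where a: "a \<in> X" using fip[of "{X}"] \<open>X \<in> \<X>\<close> by auto
        note A = aff[OF \<open>X \<in> \<X>\<close>]
        let ?U = "{z \<in> carrier R. a \<oplus> z \<in> X}"
        have ac: "a \<in> carrier R" using affineD[OF A] a by simp
        have "a \<oplus> (y \<ominus> a) = y" if "y \<in> carrier R" for y using that ac by algebra
        then have "C (a, ?U) = X" using affineD(1)[OF A] ac by (auto simp: C_def)
        then have "(a, ?U) \<in> F" using ac affine_direction[OF A a] \<open>X \<in> \<X>\<close> by (simp add: F_def)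
        then show "x \<in> X" using x(2) \<open>C (a, ?U) = X\<close> by blast
      qed
      then show "\<exists>x\<in>carrier R. \<forall>X\<in>\<X>. x \<in> X" using x(1) by blast
    qed
  next
    assume cc: "coset_compact (carrier R)"
    show "linearly_compact_ring R"
      unfolding linearly_compact_ring_def linearly_compact_def
    proof (intro conjI allI impI is_cring module_ideal_module oneideal, elim conjE)
      fix F assume F: "\<forall>(a, U)\<in>F. a \<in> carrier ?M \<and> submodule R U ?M"
        and fip: "\<forall>G. G \<subseteq> F \<and> finite G \<longrightarrow> (\<exists>x. solves_congruences ?M G x)"
      have Fc: "fst p \<in> carrier R" if "p \<in> F" for p using that F by auto
      have "\<exists>x\<in>carrier R. \<forall>X\<in>C ` F. x \<in> X"
      proof (rule coset_compactD[OF cc])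
        fix X assume "X \<in> C ` F"
        then obtain a U where "(a, U) \<in> F" "X = C (a, U)" by auto
        then show "affine X"
          using F submodule_ideal_module_iff[OF oneideal] affine_coset[of U a] by (auto simp: C_def)
      next
        fix \<G> assume "finite \<G>" "\<G> \<subseteq> C ` F"
        then obtain G where G: "G \<subseteq> F" "finite G" "\<G> = C ` G" by (meson finite_subset_image)
        then obtain x where "solves_congruences ?M G x" using fip by blast
        moreover have "fst p \<in> carrier R" if "p \<in> G" for p using Fc G(1) that by blast
        ultimately have "x \<in> carrier R \<and> (\<forall>p\<in>G. x \<in> C p)" using solves[of G x] by simp
        then show "\<exists>x\<in>carrier R. \<forall>X\<in>\<G>. x \<in> X" unfolding G(3) by blast
      qed
      then obtain x where "x \<in> carrier R \<and> (\<forall>p\<in>F. x \<in> C p)" by blast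
      from iffD2[OF solves[OF Fc] this] show "\<exists>x. solves_congruences ?M F x" ..
    qed
  qed
qed

lemma affine_Inter: "(\<And>X. X \<in> \<G> \<Longrightarrow> affine X) \<Longrightarrow> ideal B R \<Longrightarrow> affine {x \<in> B. \<forall>X\<in>\<G>. x \<in> X}"
proof (rule affineI)
  assume aff: "\<And>X. X \<in> \<G> \<Longrightarrow> affine X" and B: "ideal B R"
  interpret B: ideal B R by fact
  show "x \<in> carrier R" if "x \<in> {x \<in> B. \<forall>X\<in>\<G>. x \<in> X}" for x using that B.Icarr by blast
  fix x y z r assume xyz: "x \<in> {x \<in> B. \<forall>X\<in>\<G>. x \<in> X}" "y \<in> {x \<in> B. \<forall>X\<in>\<G>. x \<in> X}" "z \<in> {x \<in> B. \<forall>X\<in>\<G>. x \<in> X}"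
    and r: "r \<in> carrier R"
  have "x \<oplus> r \<otimes> (y \<ominus> z) \<in> B"
    unfolding a_minus_def using xyz r by (intro B.a_closed B.I_l_closed B.a_inv_closed) auto
  moreover have "x \<oplus> r \<otimes> (y \<ominus> z) \<in> X" if X: "X \<in> \<G>" for X
    by (rule affineD(2)[OF aff[OF X] _ _ _ r]) (use xyz X in auto)
  ultimately show "x \<oplus> r \<otimes> (y \<ominus> z) \<in> {x \<in> B. \<forall>X\<in>\<G>. x \<in> X}" by simp
qed

lemma affine_Image:
  assumes \<theta>: "linear_relation \<theta>" and X: "affine X"
  shows "affine (\<theta> `` X)"
proof (rule affineI)
  show "x \<in> carrier R" if "x \<in> \<theta> `` X" for x using that linear_relationD(2)[OF \<theta>] by blast
  fix x y z r assume "x \<in> \<theta> `` X" "y \<in> \<theta> `` X" "z \<in> \<theta> `` X" and r: "r \<in> carrier R"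
  then obtain x' y' z' where p: "(x', x) \<in> \<theta>" "(y', y) \<in> \<theta>" "(z', z) \<in> \<theta>" and X': "x' \<in> X" "y' \<in> X" "z' \<in> X"
    by blast
  have "(x' \<oplus> r \<otimes> (y' \<ominus> z'), x \<oplus> r \<otimes> (y \<ominus> z)) \<in> \<theta>"
    by (intro linear_relationD(4)[OF \<theta>] linear_relationD(5)[OF \<theta>] linear_relation_minus[OF \<theta>] p r)
  moreover have "x' \<oplus> r \<otimes> (y' \<ominus> z') \<in> X" by (rule affineD(2)[OF X X' r])
  ultimately show "x \<oplus> r \<otimes> (y \<ominus> z) \<in> \<theta> `` X" by blast
qed

lemma affine_translate:
  assumes X: "affine X" and a: "a \<in> carrier R"
  shows "affine {z \<in> carrier R. a \<oplus> z \<in> X}"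
proof (rule affineI)
  fix x y z r assume "x \<in> {z \<in> carrier R. a \<oplus> z \<in> X}" "y \<in> {z \<in> carrier R. a \<oplus> z \<in> X}" "z \<in> {z \<in> carrier R. a \<oplus> z \<in> X}"
    and r: "r \<in> carrier R"
  then have c: "x \<in> carrier R" "y \<in> carrier R" "z \<in> carrier R" and X': "a \<oplus> x \<in> X" "a \<oplus> y \<in> X" "a \<oplus> z \<in> X" by auto
  have "(a \<oplus> x) \<oplus> r \<otimes> ((a \<oplus> y) \<ominus> (a \<oplus> z)) \<in> X" by (rule affineD(2)[OF X X' r])
  moreover have "(a \<oplus> x) \<oplus> r \<otimes> ((a \<oplus> y) \<ominus> (a \<oplus> z)) = a \<oplus> (x \<oplus> r \<otimes> (y \<ominus> z))" using c a r by algebra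
  ultimately show "x \<oplus> r \<otimes> (y \<ominus> z) \<in> {z \<in> carrier R. a \<oplus> z \<in> X}" using c r by simp
qed auto

lemma coset_compact_zero: "coset_compact {\<zero>}"
proof (rule coset_compactI)
  fix \<X> assume fip: "\<And>\<G>. finite \<G> \<Longrightarrow> \<G> \<subseteq> \<X> \<Longrightarrow> \<exists>x\<in>{\<zero>}. \<forall>X\<in>\<G>. x \<in> X"
  have "\<zero> \<in> X" if "X \<in> \<X>" for X using fip[of "{X}"] that by simp
  then show "\<exists>x\<in>{\<zero>}. \<forall>X\<in>\<X>. x \<in> X" by blast
qed

text \<open>
  The images under \<open>\<theta>\<close> of all finite intersections have a common point; after translation by a
  preimage of it, the family has the finite intersection property on the kernel.
\<close>

lemma coset_compact_extension:
  assumes \<theta>: "linear_map \<theta>" and dom: "Domain \<theta> = B" and ran: "Range \<theta> \<subseteq> H"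
    and ker: "\<And>v. (v, \<zero>) \<in> \<theta> \<longleftrightarrow> v \<in> A" and ccH: "coset_compact H" and ccA: "coset_compact A"
  shows "coset_compact B"
proof (rule coset_compactI)
  have \<theta>lin: "linear_relation \<theta>" using \<theta> by (simp add: linear_map_def)
  have B: "ideal B R" using linear_relation_Domain[OF \<theta>lin] dom by simp
  interpret B: ideal B R by fact
  fix \<X> assume aff: "\<And>X. X \<in> \<X> \<Longrightarrow> affine X"
    and fip: "\<And>\<G>. finite \<G> \<Longrightarrow> \<G> \<subseteq> \<X> \<Longrightarrow> \<exists>x\<in>B. \<forall>X\<in>\<G>. x \<in> X"
  define f where "f \<G> = \<theta> `` {x \<in> B. \<forall>X\<in>\<G>. x \<in> X}" for \<G>
  have fI: "y \<in> f \<G>" if "(x, y) \<in> \<theta>" "\<And>X. X \<in> \<G> \<Longrightarrow> x \<in> X" for x y \<G>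
    using that dom by (auto simp: f_def)
  have "\<exists>y\<in>H. \<forall>Y\<in>f ` {\<G>. finite \<G> \<and> \<G> \<subseteq> \<X>}. y \<in> Y"
  proof (rule coset_compactD[OF ccH])
    fix Y assume "Y \<in> f ` {\<G>. finite \<G> \<and> \<G> \<subseteq> \<X>}"
    then obtain \<G> where "\<G> \<subseteq> \<X>" "Y = f \<G>" by blast
    then show "affine Y" unfolding f_def using aff by (auto intro!: affine_Image[OF \<theta>lin] affine_Inter B)
  next
    fix \<H> assume "finite \<H>" "\<H> \<subseteq> f ` {\<G>. finite \<G> \<and> \<G> \<subseteq> \<X>}"
    then obtain \<C> where C: "\<C> \<subseteq> {\<G>. finite \<G> \<and> \<G> \<subseteq> \<X>}" "finite \<C>" "\<H> = f ` \<C>" by (meson finite_subset_image)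
    then have "finite (\<Union>\<C>)" "\<Union>\<C> \<subseteq> \<X>" by auto
    then obtain x where x: "x \<in> B" "\<forall>X\<in>\<Union>\<C>. x \<in> X" using fip by metis
    then obtain y where y: "(x, y) \<in> \<theta>" using dom by blast
    have "y \<in> f \<G>" if "\<G> \<in> \<C>" for \<G> using fI[OF y] x(2) that by blast
    then show "\<exists>y\<in>H. \<forall>Y\<in>\<H>. y \<in> Y" using y ran C(3) by blast
  qed
  then obtain y where yY: "\<forall>Y\<in>f ` {\<G>. finite \<G> \<and> \<G> \<subseteq> \<X>}. y \<in> Y" by (elim bexE)
  have y: "y \<in> f \<G>" if "finite \<G>" "\<G> \<subseteq> \<X>" for \<G>
    using bspec[OF yY imageI, of \<G>] that by simp
  from y[of "{}"] obtain x0 where x0: "(x0, y) \<in> \<theta>" by (auto simp: f_def)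
  have x0B: "x0 \<in> B" and x0c: "x0 \<in> carrier R" using x0 dom linear_relationD(1)[OF \<theta>lin x0] by auto
  have yc: "y \<in> carrier R" using linear_relationD(2)[OF \<theta>lin x0] .
  let ?t = "\<lambda>X. {z \<in> carrier R. x0 \<oplus> z \<in> X}"
  have "\<exists>z\<in>A. \<forall>Y\<in>?t ` \<X>. z \<in> Y"
  proof (rule coset_compactD[OF ccA])
    show "affine Y" if "Y \<in> ?t ` \<X>" for Y using that aff affine_translate[OF _ x0c] by auto
    fix \<H> assume "finite \<H>" "\<H> \<subseteq> ?t ` \<X>"
    then obtain \<G> where G: "\<G> \<subseteq> \<X>" "finite \<G>" "\<H> = ?t ` \<G>" by (meson finite_subset_image)
    obtain x1 where x1: "x1 \<in> B" "\<forall>X\<in>\<G>. x1 \<in> X" "(x1, y) \<in> \<theta>" using y[OF G(2,1)] by (auto simp: f_def)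
    have x1c: "x1 \<in> carrier R" using x1(1) B.Icarr by blast
    have "(x1 \<ominus> x0, y \<ominus> y) \<in> \<theta>" by (rule linear_relation_minus[OF \<theta>lin x1(3) x0])
    then have "x1 \<ominus> x0 \<in> A" using ker yc by simp
    moreover have "x0 \<oplus> (x1 \<ominus> x0) = x1" using x0c x1c by algebra
    then have "x1 \<ominus> x0 \<in> Y" if "Y \<in> \<H>" for Y using that G(3) x1(2) x0c x1c by auto
    ultimately show "\<exists>z\<in>A. \<forall>Y\<in>\<H>. z \<in> Y" by blast
  qed
  then obtain z where zA: "z \<in> A" and zY: "\<forall>Y\<in>?t ` \<X>. z \<in> Y" by (elim bexE)
  have z: "x0 \<oplus> z \<in> X" if "X \<in> \<X>" for X using bspec[OF zY imageI[OF that]] by simp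
  have "z \<in> B" using zA ker dom by blast
  then have "x0 \<oplus> z \<in> B" using x0B by simp
  then show "\<exists>x\<in>B. \<forall>X\<in>\<X>. x \<in> X" using z by blast
qed

end

section \<open>Linear compactness implies finite rank\<close>

context nonchain_fqp
begin

text \<open>
  If a basis \<open>S\<close> of \<open>N\<close> were infinite, then no element would satisfy \<open>x = e\<close> modulo the span of
  \<open>S - {e}\<close> for all \<open>e \<in> S\<close>: it would have infinitely many nonzero coordinates.
\<close>

definition independent :: "'a set \<Rightarrow> bool" where
  "independent S \<longleftrightarrow> S \<subseteq> N \<and> (\<forall>e\<in>S. e \<notin> pure hull (S - {e}))"

lemma independent_Union_chain:
  assumes C: "C \<noteq> {}" and ch: "subset.chain {S. independent S} C"
  shows "independent (\<Union>C)"
  unfolding independent_def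
proof (intro conjI ballI notI)
  have ind: "independent S" if "S \<in> C" for S using ch that by (auto simp: subset_chain_def)
  then show CN: "\<Union>C \<subseteq> N" by (auto simp: independent_def)
  fix e assume e: "e \<in> \<Union>C" and "e \<in> pure hull (\<Union>C - {e})"
  moreover have "\<Union>C - {e} \<subseteq> N" using CN by blast
  ultimately obtain F where F: "finite F" "F \<subseteq> \<Union>C - {e}" "e \<in> pure hull F"
    by (meson hull_finite_subset)
  have "insert e F \<subseteq> \<Union>C" using e F(2) by blast
  then obtain Y where Y: "Y \<in> C" "insert e F \<subseteq> Y"
    using finite_subset_Union_chain[OF _ _ C ch, of "insert e F"] F(1) by auto
  then have "pure hull F \<subseteq> pure hull (Y - {e})" using F(2) by (intro hull_mono) blast
  then show False using ind[OF Y(1)] Y(2) F(3) by (auto simp: independent_def)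
qed

text \<open>
  A maximal independent set spans: if \<open>e\<close> becomes dependent by adding \<open>x\<close>, say
  \<open>s e - r x \<in> pure hull (S - {e})\<close>, then \<open>r \<notin> N\<close> and \<open>x\<close> is already in the hull of \<open>S\<close>.
\<close>

lemma ex_basis: "\<exists>S. independent S \<and> pure hull S = N"
proof -
  have "\<exists>M\<in>{S. independent S}. \<forall>X\<in>{S. independent S}. M \<subseteq> X \<longrightarrow> X = M"
  proof (rule subset_Zorn_nonempty)
    have "independent {}" by (simp add: independent_def)
    then show "{S. independent S} \<noteq> {}" by blast
    show "\<Union>C \<in> {S. independent S}" if "C \<noteq> {}" "subset.chain {S. independent S} C" for C
      using independent_Union_chain[OF that] by simp
  qed
  then obtain S where S: "independent S" and max: "\<And>X. independent X \<Longrightarrow> S \<subseteq> X \<Longrightarrow> X = S" by auto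
  have SN: "S \<subseteq> N" using S by (simp add: independent_def)
  have "x \<in> pure hull S" if x: "x \<in> N" for x
  proof (rule ccontr)
    assume nx: "x \<notin> pure hull S"
    then have xS: "x \<notin> S" using hull_inc[of x S pure] by blast
    have "independent (insert x S)"
      unfolding independent_def
    proof (intro conjI ballI notI)
      show "insert x S \<subseteq> N" using SN x by simp
      fix e assume e: "e \<in> insert x S" and mem: "e \<in> pure hull (insert x S - {e})"
      show False
      proof (cases "e = x")
        case True
        then show False using mem nx xS by simp
      next
        case False
        then have eS: "e \<in> S" using e by simp
        let ?H = "pure hull (S - {e})"
        have H: "pure ?H" using SN by (intro pure_hull) auto
        have "insert x S - {e} = insert x (S - {e})" using False by auto
        then obtain s r where s: "s \<in> carrier R - N" and r: "r \<in> carrier R" and sr: "s \<otimes> e \<ominus> r \<otimes> x \<in> ?H"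
          using mem mem_hull_insert_iff[of "S - {e}" x e] SN x by auto
        have c: "s \<in> carrier R" "e \<in> carrier R" "x \<in> carrier R" "e \<in> N" using s eS SN x N_carr by auto
        show False
        proof (cases "r \<in> N")
          case True
          then have "s \<otimes> e \<in> ?H" using sr N_mult_N[OF True x] c by (simp add: a_minus_def)
          then show False using pureD(3)[OF H s c(4)] S eS by (auto simp: independent_def)
        next
          case False
          have P: "pure (pure hull S)" using SN by (rule pure_hull)
          interpret P: ideal "pure hull S" R by (rule pureD(1)[OF P])
          have "?H \<subseteq> pure hull S" by (rule hull_mono) auto
          moreover have "e \<in> pure hull S" using eS by (rule hull_inc)
          ultimately have "s \<otimes> e \<oplus> \<ominus> (s \<otimes> e \<ominus> r \<otimes> x) \<in> pure hull S"
            using sr c by (intro P.a_closed P.I_l_closed P.a_inv_closed) auto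
          moreover have "s \<otimes> e \<oplus> \<ominus> (s \<otimes> e \<ominus> r \<otimes> x) = r \<otimes> x" using c(1-3) r by algebra
          ultimately show False using pureD(3)[OF P, of r x] False r x nx by simp
        qed
      qed
    qed
    then show False using max[of "insert x S"] xS by blast
  qed
  then have "pure hull S = N" using pureD(2)[OF pure_hull[OF SN]] by blast
  then show ?thesis using S by blast
qed

lemma coset_compact_imp_finite_rank:
  assumes cc: "coset_compact (carrier R)"
  shows "\<exists>A. finite A \<and> A \<subseteq> N \<and> pure hull A = N"
proof -
  obtain S where S: "independent S" and gen: "pure hull S = N" using ex_basis by blast
  have SN: "S \<subseteq> N" using S by (simp add: independent_def)
  let ?H = "\<lambda>e. pure hull (S - {e})" and ?X = "\<lambda>e. {x \<in> carrier R. x \<ominus> e \<in> pure hull (S - {e})}"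
  have H: "pure (?H e)" for e using SN by (intro pure_hull) auto
  have sum: "\<exists>x\<in>pure hull F. \<forall>e\<in>F. x \<in> ?X e" if "finite F" "F \<subseteq> S" for F
    using that
  proof (induction F)
    case empty
    show ?case by (auto simp: hull_empty)
  next
    case (insert e F)
    then obtain x where x: "x \<in> pure hull F" "\<forall>f\<in>F. x \<in> ?X f" by auto
    have FN: "insert e F \<subseteq> N" using insert.prems SN by blast
    have e: "e \<in> N" "e \<in> carrier R" using FN N_carr by auto
    have xc: "x \<in> carrier R" using hull_N[of F x] x FN N_carr by auto
    interpret P: ideal "pure hull (insert e F)" R by (rule pureD(1)[OF pure_hull[OF FN]])
    have "x \<oplus> e \<in> pure hull (insert e F)"
      using x(1) hull_mono[of F "insert e F" pure] hull_inc[of e "insert e F" pure] by (intro P.a_closed) auto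
    moreover have "x \<oplus> e \<in> ?X f" if f: "f \<in> insert e F" for f
    proof (cases "f = e")
      case True
      have "x \<in> ?H e" using x(1) hull_mono[of F "S - {e}" pure] insert by blast
      moreover have "x \<oplus> e \<ominus> e = x" using xc e by algebra
      ultimately show ?thesis using True xc e by simp
    next
      case False
      interpret Hf: ideal "?H f" R by (rule pureD(1)[OF H])
      have fF: "f \<in> F" using f False by simp
      then have "f \<in> carrier R" using FN N_carr by auto
      then have "x \<oplus> e \<ominus> f = (x \<ominus> f) \<oplus> e" using xc e(2) by algebra
      moreover have "(x \<ominus> f) \<oplus> e \<in> ?H f"
        using x(2) fF False insert.prems by (intro Hf.a_closed) (auto intro: hull_inc)
      ultimately show ?thesis using xc e by simp
    qed
    ultimately show ?case by blast
  qed
  have "\<exists>x\<in>carrier R. \<forall>X\<in>?X ` S. x \<in> X"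
  proof (rule coset_compactD[OF cc])
    fix X assume "X \<in> ?X ` S"
    then obtain e where "e \<in> S" "X = ?X e" by blast
    then show "affine X" using affine_coset[OF pureD(1)[OF H]] SN N_carr by auto
  next
    fix \<G> assume "finite \<G>" "\<G> \<subseteq> ?X ` S"
    then obtain F where F: "F \<subseteq> S" "finite F" "\<G> = ?X ` F" by (meson finite_subset_image)
    then obtain x where x: "x \<in> pure hull F" "\<forall>e\<in>F. x \<in> ?X e" using sum by meson
    then have "x \<in> carrier R" using hull_N[of F x] F SN N_carr by blast
    then show "\<exists>x\<in>carrier R. \<forall>X\<in>\<G>. x \<in> X" using x F(3) by blast
  qed
  then obtain x where x: "x \<in> carrier R" "\<And>e. e \<in> S \<Longrightarrow> x \<ominus> e \<in> ?H e" by auto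
  have "finite S"
  proof (rule ccontr)
    assume inf: "infinite S"
    then obtain d where d: "d \<in> S" by (metis finite.emptyI ex_in_conv)
    have dN: "d \<in> N" "d \<in> carrier R" using d SN N_carr by auto
    have "x \<ominus> d \<in> N" using x(2)[OF d] pureD(2)[OF H] by blast
    then have "(x \<ominus> d) \<oplus> d \<in> N" using dN by (intro N_add)
    moreover have "(x \<ominus> d) \<oplus> d = x" using x(1) dN by algebra
    ultimately have "x \<in> pure hull S" using gen by simp
    then obtain F where F: "finite F" "F \<subseteq> S" "x \<in> pure hull F" using hull_finite_subset[OF SN] by metis
    obtain e where e: "e \<in> S" "e \<notin> F" using inf F by (metis finite_subset subsetI)
    interpret He: ideal "?H e" R by (rule pureD(1)[OF H])
    have "x \<in> ?H e" using F hull_mono[of F "S - {e}" pure] e by blast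
    then have "x \<oplus> \<ominus> (x \<ominus> e) \<in> ?H e" using x(2)[OF e(1)] by simp
    moreover have "e \<in> carrier R" using e SN N_carr by auto
    then have "x \<oplus> \<ominus> (x \<ominus> e) = e" using x(1) by algebra
    ultimately show False using S e(1) by (auto simp: independent_def)
  qed
  then show ?thesis using SN gen by blast
qed

end

section \<open>Linear compactness implies that all ideals are quasi-projective\<close>

context nonchain_fqp
begin

text \<open>
  A directed union of cyclic modules: finitely many elements of \<open>W'/W\<close> lie in a single one.
\<close>

lemma common_generator:
  assumes W: "ideal W R" and W': "ideal W' R"
    and dir: "\<And>v v'. v \<in> W' \<Longrightarrow> v' \<in> W' \<Longrightarrow>
      \<exists>u\<in>W'. \<exists>t\<in>carrier R. \<exists>t'\<in>carrier R. v \<ominus> t \<otimes> u \<in> W \<and> v' \<ominus> t' \<otimes> u \<in> W"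
    and F: "finite F" "F \<subseteq> W'"
  shows "\<exists>u\<in>W'. \<forall>v\<in>F. \<exists>t\<in>carrier R. v \<ominus> t \<otimes> u \<in> W"
  using F
proof (induction F)
  case empty
  interpret W': ideal W' R by fact
  show ?case using W'.zero_closed by blast
next
  case (insert v F)
  interpret W: ideal W R by fact
  interpret W': ideal W' R by fact
  obtain u where u: "u \<in> W'" "\<And>f. f \<in> F \<Longrightarrow> \<exists>t\<in>carrier R. f \<ominus> t \<otimes> u \<in> W"
    using insert by auto
  obtain u' t t' where u': "u' \<in> W'" "t \<in> carrier R" "t' \<in> carrier R" "v \<ominus> t \<otimes> u' \<in> W" "u \<ominus> t' \<otimes> u' \<in> W"
    using dir[of v u] insert.prems u(1) by auto
  have "\<exists>q\<in>carrier R. f \<ominus> q \<otimes> u' \<in> W" if f: "f \<in> F" for f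
  proof -
    obtain q where q: "q \<in> carrier R" "f \<ominus> q \<otimes> u \<in> W" using u(2)[OF f] by blast
    have c: "f \<in> carrier R" "u \<in> carrier R" "u' \<in> carrier R" using f insert.prems u u' W'.Icarr by auto
    have "(f \<ominus> q \<otimes> u) \<oplus> q \<otimes> (u \<ominus> t' \<otimes> u') \<in> W"
      using q u' by (intro W.a_closed W.I_l_closed)
    moreover have "(f \<ominus> q \<otimes> u) \<oplus> q \<otimes> (u \<ominus> t' \<otimes> u') = f \<ominus> (q \<otimes> t') \<otimes> u'"
      using c q(1) u'(3) by algebra
    ultimately show ?thesis using q(1) u'(3) by auto
  qed
  then show ?case using u' by auto
qed

text \<open>
  A section \<open>g\<close> of \<open>G\<close> over \<open>W\<close> extends to \<open>W'\<close> as soon as the value \<open>x\<close> at \<open>e\<close> is chosen: every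
  \<open>v \<in> W'\<close> satisfies some \<open>s v = r e + w\<close>, and the value \<open>y\<close> at \<open>v\<close> must satisfy
  \<open>s y = r x + g w\<close>. Requiring \<open>y \<in> G v\<close> restricts \<open>x\<close> to a coset of an ideal. Finitely many of
  these conditions involve only the submodule generated over \<open>W\<close> by a single element, where any
  choice of a value in \<open>G\<close> solves them; linear compactness then solves all of them at once.
\<close>

lemma extend_section:
  assumes cc: "coset_compact (carrier R)"
    and G: "linear_relation G" and dom: "Domain G = I" and ran: "Range G \<subseteq> I"
    and g: "linear_map g" and gG: "g \<subseteq> G" and domg: "Domain g = W"
    and W': "ideal W' R" and W'I: "W' \<subseteq> I" and e: "e \<in> W'"
    and tors: "\<And>v. v \<in> W' \<Longrightarrow> \<exists>s\<in>carrier R - N. \<exists>r\<in>carrier R. s \<otimes> v \<ominus> r \<otimes> e \<in> W"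
    and dir: "\<And>v v'. v \<in> W' \<Longrightarrow> v' \<in> W' \<Longrightarrow>
      \<exists>u\<in>W'. \<exists>t\<in>carrier R. \<exists>t'\<in>carrier R. v \<ominus> t \<otimes> u \<in> W \<and> v' \<ominus> t' \<otimes> u \<in> W"
    and ann: "\<And>r x. r \<in> carrier R \<Longrightarrow> r \<otimes> e \<in> W \<Longrightarrow> x \<in> I \<Longrightarrow> r \<otimes> x = \<zero>"
  obtains h where "linear_map h" "h \<subseteq> G" "Domain h = W'"
proof -
  have glin: "linear_relation g" using g by (simp add: linear_map_def)
  have W: "ideal W R" using linear_relation_Domain[OF glin] domg by simp
  interpret W: ideal W R by fact
  interpret W': ideal W' R by fact
  note gc = linear_relationD(1,2)[OF glin] and Gc = linear_relationD(1,2)[OF G]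
  have gW: "w \<in> W" if "(w, h) \<in> g" for w h using that domg by blast
  have ec: "e \<in> carrier R" using e W'.Icarr by blast
  define T where "T = {(v, s, r, w, h). v \<in> W' \<and> s \<in> carrier R - N \<and> r \<in> carrier R \<and> (w, h) \<in> g \<and>
      s \<otimes> v = r \<otimes> e \<oplus> w}"
  define X where "X = (\<lambda>(v, s, r, w :: 'a, h). {x \<in> carrier R. \<exists>y. (v, y) \<in> G \<and> s \<otimes> y = r \<otimes> x \<oplus> h})"
  have TD: "v \<in> W'" "s \<in> carrier R - N" "r \<in> carrier R" "(w, h) \<in> g" "s \<otimes> v = r \<otimes> e \<oplus> w"
    if "(v, s, r, w, h) \<in> T" for v s r w h using that by (auto simp: T_def)
  have XD: "\<exists>y. (v, y) \<in> G \<and> s \<otimes> y = r \<otimes> x \<oplus> h" if "x \<in> X (v, s, r, w, h)" for x v s r w h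
    using that by (auto simp: X_def)
  have XI: "x \<in> X (v, s, r, w, h)" if "x \<in> carrier R" "(v, y) \<in> G" "s \<otimes> y = r \<otimes> x \<oplus> h" for x v s r w h y
    using that by (auto simp: X_def)
  have "\<exists>x\<in>carrier R. \<forall>Y\<in>X ` T. x \<in> Y"
  proof (rule coset_compactD[OF cc])
    fix Y assume "Y \<in> X ` T"
    then obtain v s r w h where \<tau>: "(v, s, r, w, h) \<in> T" and Y: "Y = X (v, s, r, w, h)" by auto
    note t = TD[OF \<tau>]
    show "affine Y"
      unfolding Y
    proof (rule affineI)
      show "x \<in> carrier R" if "x \<in> X (v, s, r, w, h)" for x using that by (simp add: X_def)
      fix x1 x2 x3 q assume x1: "x1 \<in> X (v, s, r, w, h)" and x2: "x2 \<in> X (v, s, r, w, h)"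
        and x3: "x3 \<in> X (v, s, r, w, h)" and q: "q \<in> carrier R"
      obtain y1 where y1: "(v, y1) \<in> G" "s \<otimes> y1 = r \<otimes> x1 \<oplus> h" using XD[OF x1] by blast
      obtain y2 where y2: "(v, y2) \<in> G" "s \<otimes> y2 = r \<otimes> x2 \<oplus> h" using XD[OF x2] by blast
      obtain y3 where y3: "(v, y3) \<in> G" "s \<otimes> y3 = r \<otimes> x3 \<oplus> h" using XD[OF x3] by blast
      have c: "x1 \<in> carrier R" "x2 \<in> carrier R" "x3 \<in> carrier R" "y1 \<in> carrier R" "y2 \<in> carrier R"
        "y3 \<in> carrier R" "v \<in> carrier R" "s \<in> carrier R" "h \<in> carrier R" "r \<in> carrier R"
        using x1 x2 x3 Gc(2)[OF y1(1)] Gc(2)[OF y2(1)] Gc(2)[OF y3(1)] Gc(1)[OF y1(1)] t(2,3) gc(2)[OF t(4)]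
        by (auto simp: X_def)
      have "(v \<oplus> q \<otimes> (v \<ominus> v), y1 \<oplus> q \<otimes> (y2 \<ominus> y3)) \<in> G"
        by (intro linear_relationD(4)[OF G] linear_relationD(5)[OF G] linear_relation_minus[OF G] y1 y2 y3 q)
      then have mem: "(v, y1 \<oplus> q \<otimes> (y2 \<ominus> y3)) \<in> G" using c q by simp
      have "s \<otimes> (y1 \<oplus> q \<otimes> (y2 \<ominus> y3)) = s \<otimes> y1 \<oplus> q \<otimes> (s \<otimes> y2 \<ominus> s \<otimes> y3)" using c q by algebra
      also have "\<dots> = r \<otimes> (x1 \<oplus> q \<otimes> (x2 \<ominus> x3)) \<oplus> h"
        unfolding y1(2) y2(2) y3(2) using c q by algebra
      finally show "x1 \<oplus> q \<otimes> (x2 \<ominus> x3) \<in> X (v, s, r, w, h)" using c q by (intro XI[OF _ mem]) auto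
    qed
  next
    fix \<G> assume "finite \<G>" "\<G> \<subseteq> X ` T"
    then obtain T0 where T0: "T0 \<subseteq> T" "finite T0" "\<G> = X ` T0" by (meson finite_subset_image)
    have "insert e (fst ` T0) \<subseteq> W'" using T0(1) TD(1) e by auto
    then obtain u where u: "u \<in> W'" and gen: "\<forall>v\<in>insert e (fst ` T0). \<exists>t\<in>carrier R. v \<ominus> t \<otimes> u \<in> W"
      using common_generator[OF W W' dir, of "insert e (fst ` T0)"] T0(2) by auto
    have uc: "u \<in> carrier R" using u W'.Icarr by blast
    obtain y0 where y0: "(u, y0) \<in> G" using u W'I dom by blast
    have y0c: "y0 \<in> carrier R" and y0I: "y0 \<in> I" using Gc(2)[OF y0] y0 ran by auto
    have val: "\<exists>t\<in>carrier R. \<exists>w h. (w, h) \<in> g \<and> v = t \<otimes> u \<oplus> w \<and> (v, t \<otimes> y0 \<oplus> h) \<in> G"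
      if v: "v \<in> insert e (fst ` T0)" for v
    proof -
      obtain t where t: "t \<in> carrier R" "v \<ominus> t \<otimes> u \<in> W" using gen v by blast
      then obtain h where h: "(v \<ominus> t \<otimes> u, h) \<in> g" using domg by blast
      have vc: "v \<in> carrier R" using v \<open>insert e (fst ` T0) \<subseteq> W'\<close> W'.Icarr by blast
      have eq: "v = t \<otimes> u \<oplus> (v \<ominus> t \<otimes> u)" using vc t(1) uc by algebra
      have "(t \<otimes> u \<oplus> (v \<ominus> t \<otimes> u), t \<otimes> y0 \<oplus> h) \<in> G"
        using h gG by (intro linear_relationD(4)[OF G] linear_relationD(5)[OF G] t y0) auto
      then show ?thesis using t(1) h eq by metis
    qed
    obtain t0 w0 h0 where t0: "t0 \<in> carrier R" "(w0, h0) \<in> g" "e = t0 \<otimes> u \<oplus> w0" "(e, t0 \<otimes> y0 \<oplus> h0) \<in> G"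
      using val[of e] by blast
    define x where "x = t0 \<otimes> y0 \<oplus> h0"
    note c0 = t0(1) gc[OF t0(2)] uc y0c
    have xc: "x \<in> carrier R" using c0 by (simp add: x_def)
    have "x \<in> Y" if "Y \<in> \<G>" for Y
    proof -
      obtain \<tau> where "\<tau> \<in> T0" "Y = X \<tau>" using \<open>Y \<in> \<G>\<close> T0(3) by blast
      moreover obtain v s r w h where "\<tau> = (v, s, r, w, h)" by (cases \<tau>)
      ultimately have \<tau>: "(v, s, r, w, h) \<in> T0" and Y: "Y = X (v, s, r, w, h)" by auto
      note t = TD[OF subsetD[OF T0(1) \<tau>]]
      have "v \<in> insert e (fst ` T0)" using \<tau> by force
      then obtain t1 w1 h1 where t1: "t1 \<in> carrier R" "(w1, h1) \<in> g" "v = t1 \<otimes> u \<oplus> w1" "(v, t1 \<otimes> y0 \<oplus> h1) \<in> G"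
        using val by blast
      have s: "s \<in> carrier R" using t(2) by simp
      note c1 = t1(1) gc[OF t1(2)] gc[OF t(4)] s t(3) c0
      define \<rho> where "\<rho> = s \<otimes> t1 \<ominus> r \<otimes> t0"
      define \<omega> where "\<omega> = (w \<ominus> s \<otimes> w1) \<oplus> r \<otimes> w0"
      define \<eta> where "\<eta> = (h \<ominus> s \<otimes> h1) \<oplus> r \<otimes> h0"
      \<comment> \<open>The defect \<open>\<rho>\<close> maps \<open>u\<close>, and hence \<open>e\<close>, into \<open>W\<close>; so it annihilates \<open>I\<close>.\<close>
      have \<rho>c: "\<rho> \<in> carrier R" using c1 by (simp add: \<rho>_def)
      have \<omega>\<eta>: "(\<omega>, \<eta>) \<in> g"
        unfolding \<omega>_def \<eta>_def
        by (intro linear_relationD(4)[OF glin] linear_relationD(5)[OF glin] linear_relation_minus[OF glin] t t1 t0 s)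
      have "\<rho> \<otimes> u = (s \<otimes> (t1 \<otimes> u \<oplus> w1) \<ominus> r \<otimes> (t0 \<otimes> u \<oplus> w0)) \<ominus> s \<otimes> w1 \<oplus> r \<otimes> w0"
        unfolding \<rho>_def using c1 by algebra
      also have "\<dots> = ((r \<otimes> e \<oplus> w) \<ominus> r \<otimes> e) \<ominus> s \<otimes> w1 \<oplus> r \<otimes> w0"
        unfolding t1(3)[symmetric] t0(3)[symmetric] t(5) ..
      also have "\<dots> = \<omega>" unfolding \<omega>_def using c1 ec by algebra
      finally have \<rho>u: "\<rho> \<otimes> u = \<omega>" .
      have "\<rho> \<otimes> e = t0 \<otimes> (\<rho> \<otimes> u) \<oplus> \<rho> \<otimes> w0" unfolding t0(3) using c1 \<rho>c by algebra
      also have "\<dots> \<in> W"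
        unfolding \<rho>u using gW[OF \<omega>\<eta>] gW[OF t0(2)] t0(1) \<rho>c by (intro W.a_closed W.I_l_closed)
      finally have "\<rho> \<otimes> e \<in> W" .
      note \<rho>0 = ann[OF \<rho>c this]
      have "\<omega> = \<zero>" using \<rho>0[of u] u W'I \<rho>u by auto
      then have "\<eta> = \<zero>" using \<omega>\<eta> g by (simp add: linear_map_def)
      have "s \<otimes> (t1 \<otimes> y0 \<oplus> h1) = \<rho> \<otimes> y0 \<ominus> \<eta> \<oplus> (r \<otimes> x \<oplus> h)"
        unfolding \<rho>_def \<eta>_def x_def using c1 by algebra
      also have "\<dots> = r \<otimes> x \<oplus> h"
        using \<rho>0[OF y0I] \<open>\<eta> = \<zero>\<close> c1 xc by (simp add: a_minus_def)
      finally show "x \<in> Y" unfolding Y by (rule XI[OF xc t1(4)])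
    qed
    then show "\<exists>x\<in>carrier R. \<forall>Y\<in>\<G>. x \<in> Y" using xc by blast
  qed
  then obtain x where xc: "x \<in> carrier R" and sol: "\<And>\<tau>. \<tau> \<in> T \<Longrightarrow> x \<in> X \<tau>" by blast
  have xI: "x \<in> I"
  proof -
    have "(e, \<one>, \<one>, \<zero>, \<zero>) \<in> T"
      unfolding T_def using e ec one_notin_N linear_relationD(3)[OF glin] by simp
    then have "\<exists>y. (e, y) \<in> G \<and> \<one> \<otimes> y = \<one> \<otimes> x \<oplus> \<zero>" using sol XD by blast
    then obtain y where y: "(e, y) \<in> G" "\<one> \<otimes> y = \<one> \<otimes> x \<oplus> \<zero>" by blast
    then have "y = x" using Gc(2)[OF y(1)] xc by simp
    then show "x \<in> I" using y(1) ran by blast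
  qed
  define H where "H = adjoin g e x \<inter> W' \<times> carrier R"
  have HI: "(v, y) \<in> H" if "v \<in> W'" "y \<in> carrier R" "s \<in> carrier R - N" "r \<in> carrier R" "(w, h) \<in> g"
    "s \<otimes> v = r \<otimes> e \<oplus> w" "s \<otimes> y = r \<otimes> x \<oplus> h" for v y s r w h
    using that W'.Icarr[OF that(1)] unfolding H_def adjoin_def by blast
  have HE: thesis if "(v, y) \<in> H" and "\<And>s r w h. v \<in> W' \<Longrightarrow> y \<in> carrier R \<Longrightarrow> s \<in> carrier R - N \<Longrightarrow> r \<in> carrier R \<Longrightarrow>
      (w, h) \<in> g \<Longrightarrow> s \<otimes> v = r \<otimes> e \<oplus> w \<Longrightarrow> s \<otimes> y = r \<otimes> x \<oplus> h \<Longrightarrow> thesis" for v y thesis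
    using that(1) that(2) unfolding H_def adjoin_def by blast
  have "linear_relation H"
    unfolding H_def by (intro linear_relation_Int linear_relation_adjoin linear_relation_Times glin ec xc W' oneideal)
  moreover have "y = \<zero>" if vy: "(\<zero>, y) \<in> H" for y
  proof -
    from vy obtain s r w h where v: "y \<in> carrier R" "s \<in> carrier R - N" "r \<in> carrier R"
      "(w, h) \<in> g" "s \<otimes> \<zero> = r \<otimes> e \<oplus> w" "s \<otimes> y = r \<otimes> x \<oplus> h" by (elim HE)
    have s: "s \<in> carrier R" "s \<notin> N" using v by auto
    note c = gc[OF v(4)] v(3) ec
    have "r \<otimes> e \<oplus> w = \<zero>" using v(5) s(1) by simp
    then have "r \<otimes> e = \<ominus> w" using c by (intro minus_equality[symmetric]) auto
    then have "r \<otimes> e \<in> W" using gW[OF v(4)] by simp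
    note r0 = ann[OF v(3) this]
    have "r \<otimes> e = \<zero>" "r \<otimes> x = \<zero>" using r0[of e] r0[OF xI] e W'I by auto
    then have "w = \<zero>" using v(5) s c by simp
    then have "h = \<zero>" using v(4) g by (simp add: linear_map_def)
    then have "s \<otimes> y = \<zero>" using v(6) \<open>r \<otimes> x = \<zero>\<close> by simp
    then show ?thesis using torsionfree[OF s v(1)] by simp
  qed
  ultimately have "linear_map H" by (simp add: linear_map_def)
  moreover have "H \<subseteq> G"
  proof (intro subrelI)
    fix v y assume vy: "(v, y) \<in> H"
    from vy obtain s r w h where v: "v \<in> W'" "y \<in> carrier R" "s \<in> carrier R - N" "r \<in> carrier R"
      "(w, h) \<in> g" "s \<otimes> v = r \<otimes> e \<oplus> w" "s \<otimes> y = r \<otimes> x \<oplus> h" by (elim HE)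
    have "(v, s, r, w, h) \<in> T" using v by (simp add: T_def)
    from XD[OF sol[OF this]] obtain y1 where y1: "(v, y1) \<in> G" "s \<otimes> y1 = r \<otimes> x \<oplus> h" by blast
    have "y = y1" using cancel[of s y y1] v y1 Gc(2)[OF y1(1)] by simp
    then show "(v, y) \<in> G" using y1(1) by simp
  qed
  moreover have "Domain H = W'"
  proof
    show "Domain H \<subseteq> W'" by (auto simp: H_def)
    show "W' \<subseteq> Domain H"
    proof
      fix v assume v: "v \<in> W'"
      obtain s r where sr: "s \<in> carrier R - N" "r \<in> carrier R" "s \<otimes> v \<ominus> r \<otimes> e \<in> W" using tors[OF v] by blast
      then obtain h where h: "(s \<otimes> v \<ominus> r \<otimes> e, h) \<in> g" using domg by blast
      have c: "s \<in> carrier R" "v \<in> carrier R" using sr v W'.Icarr by auto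
      have eq: "s \<otimes> v = r \<otimes> e \<oplus> (s \<otimes> v \<ominus> r \<otimes> e)" using c sr(2) ec by algebra
      have "(v, s, r, s \<otimes> v \<ominus> r \<otimes> e, h) \<in> T" unfolding T_def using v sr h eq by simp
      from XD[OF sol[OF this]] obtain y where y: "(v, y) \<in> G" "s \<otimes> y = r \<otimes> x \<oplus> h" by blast
      have "(v, y) \<in> H" by (rule HI[OF v Gc(2)[OF y(1)] sr(1,2) h eq y(2)])
      then show "v \<in> Domain H" by blast
    qed
  qed
  ultimately show thesis by (rule that)
qed

text \<open>
  Modulo \<open>U\<close> the elements \<open>v\<close> and \<open>v'\<close> are \<open>(r/s) d\<close> and \<open>(r'/s') d\<close>, so they compare like the
  elements \<open>s' r\<close> and \<open>s r'\<close> of the valuation domain \<open>R/N\<close>.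
\<close>

lemma rank_one_uniserial:
  assumes U: "pure U" and d: "d \<in> N" and v: "v \<in> N" and v': "v' \<in> N"
    and s: "s \<in> carrier R - N" and s': "s' \<in> carrier R - N" and r: "r \<in> carrier R" and r': "r' \<in> carrier R"
    and mem: "s \<otimes> v \<ominus> r \<otimes> d \<in> U" and mem': "s' \<otimes> v' \<ominus> r' \<otimes> d \<in> U"
  shows "(\<exists>t\<in>carrier R. v \<ominus> t \<otimes> v' \<in> U) \<or> (\<exists>t\<in>carrier R. v' \<ominus> t \<otimes> v \<in> U)"
proof -
  interpret U: ideal U R by (rule pureD(1)[OF U])
  have multiple: "v \<ominus> t \<otimes> v' \<in> U"
    if v: "v \<in> N" and v': "v' \<in> N" and s: "s \<in> carrier R - N" and s': "s' \<in> carrier R - N"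
    and r: "r \<in> carrier R" and r': "r' \<in> carrier R"
    and mem: "s \<otimes> v \<ominus> r \<otimes> d \<in> U" "s' \<otimes> v' \<ominus> r' \<otimes> d \<in> U"
    and t: "t \<in> carrier R" and n: "n \<in> N" and eq: "s' \<otimes> r = t \<otimes> (s \<otimes> r') \<oplus> n" for v v' s s' r r' t n
  proof -
    have c: "v \<in> carrier R" "v' \<in> carrier R" "s \<in> carrier R" "s' \<in> carrier R" "n \<in> carrier R" "d \<in> carrier R"
      using v v' s s' n d N_carr by auto
    have "s' \<otimes> (s \<otimes> v \<ominus> r \<otimes> d) \<oplus> (\<ominus> (t \<otimes> s)) \<otimes> (s' \<otimes> v' \<ominus> r' \<otimes> d) \<in> U"
      using mem c t by (intro U.a_closed U.I_l_closed) auto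
    moreover have "s' \<otimes> (s \<otimes> v \<ominus> r \<otimes> d) \<oplus> (\<ominus> (t \<otimes> s)) \<otimes> (s' \<otimes> v' \<ominus> r' \<otimes> d) =
        (s \<otimes> s') \<otimes> (v \<ominus> t \<otimes> v') \<oplus> (t \<otimes> (s \<otimes> r') \<ominus> s' \<otimes> r) \<otimes> d"
      using c t r r' by algebra
    moreover have "(t \<otimes> (s \<otimes> r') \<ominus> s' \<otimes> r) \<otimes> d = \<zero>"
    proof -
      have "(t \<otimes> (s \<otimes> r') \<ominus> (t \<otimes> (s \<otimes> r') \<oplus> n)) \<otimes> d = \<ominus> (n \<otimes> d)" using c t r' by algebra
      then show ?thesis unfolding eq using N_mult_N[OF n d] by simp
    qed
    ultimately have "(s \<otimes> s') \<otimes> (v \<ominus> t \<otimes> v') \<in> U" using c t by simp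
    moreover have "v \<ominus> t \<otimes> v' \<in> N"
      unfolding a_minus_def
      by (intro N_add v additive_subgroup.a_inv_closed[OF ideal.axioms(1)[OF ideal_N]] N_mult t v')
    ultimately show ?thesis using pureD(3)[OF U N_complement_mult[OF s s']] by blast
  qed
  have c: "s' \<otimes> r \<in> carrier R" "s \<otimes> r' \<in> carrier R" using s s' r r' by auto
  then show ?thesis
  proof (cases rule: incomparable_cases)
    case 1
    have "s' \<otimes> r = \<zero> \<otimes> (s \<otimes> r') \<oplus> s' \<otimes> r" using c by simp
    from multiple[OF v v' s s' r r' mem mem' zero_closed incomparable_N(1)[OF 1] this]
    show ?thesis using zero_closed by blast
  next
    case (2 t)
    then have "s' \<otimes> r = t \<otimes> (s \<otimes> r') \<oplus> \<zero>" using c by simp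
    from multiple[OF v v' s s' r r' mem mem' 2(1) N_zero this] show ?thesis using 2(1) by blast
  next
    case (3 t)
    then have "s \<otimes> r' = t \<otimes> (s' \<otimes> r) \<oplus> \<zero>" using c by simp
    from multiple[OF v' v s' s r' r mem' mem 3(1) N_zero this] show ?thesis using 3(1) by blast
  qed
qed

lemma linear_map_zero: "linear_map {(\<zero>, \<zero>)}"
  unfolding linear_map_def by (auto intro!: linear_relationI)

text \<open>
  Adding one generator \<open>e\<close> to \<open>B\<close> enlarges \<open>I \<inter> pure hull B\<close> by a uniserial module of rank at most
  one, across which a section extends.
\<close>

lemma section_on_hull:
  assumes cc: "coset_compact (carrier R)" and G: "linear_relation G" and dom: "Domain G = I"
    and ran: "Range G \<subseteq> I" and IN: "I \<subseteq> N" and B: "finite B" "B \<subseteq> N"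
  shows "\<exists>g. linear_map g \<and> g \<subseteq> G \<and> Domain g = I \<inter> pure hull B"
  using B
proof (induction B)
  case empty
  have "\<zero> \<in> I" "{(\<zero>, \<zero>)} \<subseteq> G" using linear_relationD(3)[OF G] dom by auto
  then show ?case using linear_map_zero by (intro exI[of _ "{(\<zero>, \<zero>)}"]) (auto simp: hull_empty)
next
  case (insert e B)
  have I: "ideal I R" using linear_relation_Domain[OF G] dom by simp
  have BN: "B \<subseteq> N" and eN: "e \<in> N" using insert.prems by auto
  obtain g where g: "linear_map g" "g \<subseteq> G" "Domain g = I \<inter> pure hull B" using insert by auto
  let ?W = "I \<inter> pure hull B" and ?W' = "I \<inter> pure hull (insert e B)"
  have P: "pure (pure hull B)" by (rule pure_hull[OF BN])
  have P': "pure (pure hull (insert e B))" by (rule pure_hull[OF insert.prems])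
  have W': "ideal ?W' R" by (rule i_intersect[OF I pureD(1)[OF P']])
  interpret P: ideal "pure hull B" R by (rule pureD(1)[OF P])
  interpret I: ideal I R by (rule I)
  have sub: "?W \<subseteq> ?W'" using hull_mono[of B "insert e B" pure] by auto
  show ?case
  proof (cases "?W' \<subseteq> ?W")
    case True
    then have "Domain g = ?W'" using g(3) sub by (metis subset_antisym)
    then show ?thesis using g(1,2) by blast
  next
    case False
    then obtain d where d: "d \<in> I" "d \<in> pure hull (insert e B)" "d \<notin> pure hull B" by auto
    have dN: "d \<in> N" "d \<in> carrier R" and ec: "e \<in> carrier R" using d(1) IN N_carr eN by auto
    have hull: "\<exists>s\<in>carrier R - N. \<exists>r\<in>carrier R. s \<otimes> v \<ominus> r \<otimes> e \<in> pure hull B"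
      if "v \<in> pure hull (insert e B)" for v using that mem_hull_insert_iff[OF BN eN] by blast
    obtain s2 r2 where sr2: "s2 \<in> carrier R - N" "r2 \<in> carrier R" "s2 \<otimes> d \<ominus> r2 \<otimes> e \<in> pure hull B"
      using hull[OF d(2)] by blast
    have r2: "r2 \<in> carrier R - N"
    proof (rule ccontr)
      assume "r2 \<notin> carrier R - N"
      then have "r2 \<otimes> e = \<zero>" using sr2(2) N_mult_N[of r2 e] eN by auto
      then have "s2 \<otimes> d \<in> pure hull B" using sr2 dN by (simp add: a_minus_def)
      then show False using pureD(3)[OF P sr2(1) dN(1)] d(3) by blast
    qed
    \<comment> \<open>As \<open>d\<close> is not in the hull of \<open>B\<close>, it can replace \<open>e\<close>, which need not belong to \<open>I\<close>.\<close>
    have tors: "\<exists>s\<in>carrier R - N. \<exists>r\<in>carrier R. s \<otimes> v \<ominus> r \<otimes> d \<in> ?W" if v: "v \<in> ?W'" for v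
    proof -
      obtain s1 r1 where sr1: "s1 \<in> carrier R - N" "r1 \<in> carrier R" "s1 \<otimes> v \<ominus> r1 \<otimes> e \<in> pure hull B"
        using hull v by blast
      have c: "v \<in> carrier R" "s1 \<in> carrier R" "s2 \<in> carrier R" using v I.Icarr sr1 sr2 by auto
      have "r2 \<otimes> (s1 \<otimes> v \<ominus> r1 \<otimes> e) \<oplus> (\<ominus> r1) \<otimes> (s2 \<otimes> d \<ominus> r2 \<otimes> e) \<in> pure hull B"
        using sr1 sr2 by (intro P.a_closed P.I_l_closed) auto
      moreover have "r2 \<otimes> (s1 \<otimes> v \<ominus> r1 \<otimes> e) \<oplus> (\<ominus> r1) \<otimes> (s2 \<otimes> d \<ominus> r2 \<otimes> e) =
          (r2 \<otimes> s1) \<otimes> v \<ominus> (r1 \<otimes> s2) \<otimes> d"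
        using c sr1(2) sr2(2) dN(2) ec by algebra
      moreover have "(r2 \<otimes> s1) \<otimes> v \<ominus> (r1 \<otimes> s2) \<otimes> d \<in> I"
        unfolding a_minus_def using v d(1) c sr1(2) sr2(2) by (intro I.a_closed I.a_inv_closed I.I_l_closed) auto
      ultimately have "(r2 \<otimes> s1) \<otimes> v \<ominus> (r1 \<otimes> s2) \<otimes> d \<in> ?W" by simp
      moreover have "r1 \<otimes> s2 \<in> carrier R" using sr1(2) c(3) by simp
      ultimately show ?thesis using N_complement_mult[OF r2 sr1(1)] by blast
    qed
    have dir: "\<exists>u\<in>?W'. \<exists>t\<in>carrier R. \<exists>t'\<in>carrier R. v \<ominus> t \<otimes> u \<in> ?W \<and> v' \<ominus> t' \<otimes> u \<in> ?W"
      if v: "v \<in> ?W'" and v': "v' \<in> ?W'" for v v'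
    proof -
      obtain s r where sr: "s \<in> carrier R - N" "r \<in> carrier R" "s \<otimes> v \<ominus> r \<otimes> d \<in> ?W" using tors[OF v] by blast
      obtain s' r' where sr': "s' \<in> carrier R - N" "r' \<in> carrier R" "s' \<otimes> v' \<ominus> r' \<otimes> d \<in> ?W" using tors[OF v'] by blast
      have vN: "v \<in> N" "v' \<in> N" and c: "v \<in> carrier R" "v' \<in> carrier R" using v v' IN N_carr by auto
      have refl: "w \<ominus> \<one> \<otimes> w \<in> ?W" if "w \<in> carrier R" for w using that by simp
      have WI: "w \<ominus> t \<otimes> w' \<in> ?W"
        if "w \<ominus> t \<otimes> w' \<in> pure hull B" "w \<in> ?W'" "w' \<in> ?W'" "t \<in> carrier R" for w t w'
      proof -
        have "w \<ominus> t \<otimes> w' \<in> I"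
          unfolding a_minus_def using that by (intro I.a_closed I.a_inv_closed I.I_l_closed) auto
        then show ?thesis using that(1) by simp
      qed
      have "(\<exists>t\<in>carrier R. v \<ominus> t \<otimes> v' \<in> pure hull B) \<or> (\<exists>t\<in>carrier R. v' \<ominus> t \<otimes> v \<in> pure hull B)"
        using sr sr' by (intro rank_one_uniserial[OF P dN(1) vN sr(1) sr'(1) sr(2) sr'(2)]) auto
      then have "(\<exists>t\<in>carrier R. v \<ominus> t \<otimes> v' \<in> ?W) \<or> (\<exists>t\<in>carrier R. v' \<ominus> t \<otimes> v \<in> ?W)"
        using WI v v' by blast
      then show ?thesis
        using v v' refl[OF c(1)] refl[OF c(2)] one_closed by meson
    qed
    have ann: "r \<otimes> x = \<zero>" if r: "r \<in> carrier R" and rd: "r \<otimes> d \<in> ?W" and x: "x \<in> I" for r x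
    proof -
      have "r \<in> N" using pureD(3)[OF P, of r d] r rd dN(1) d(3) by blast
      then show ?thesis using N_mult_N x IN by blast
    qed
    obtain h where "linear_map h" "h \<subseteq> G" "Domain h = ?W'"
    proof (rule extend_section[OF cc G dom ran g W' _ _ tors dir ann])
      show "?W' \<subseteq> I" by simp
      show "d \<in> ?W'" using d by simp
    qed
    then show ?thesis by blast
  qed
qed

lemma coset_compact_imp_liftable:
  assumes cc: "coset_compact (carrier R)" and I: "ideal I R"
  shows "liftable I"
  unfolding liftable_def
proof (intro allI impI, elim conjE)
  interpret I: ideal I R by fact
  fix G assume G: "linear_relation G" and dom: "Domain G = I" and ran: "Range G \<subseteq> I"
  show "\<exists>g\<subseteq>G. linear_map g \<and> Domain g = I"
  proof (cases "I \<subseteq> N")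
    case True
    obtain A where A: "finite A" "A \<subseteq> N" "pure hull A = N" using coset_compact_imp_finite_rank[OF cc] by blast
    have "I \<inter> pure hull A = I" using True A(3) by blast
    then show ?thesis using section_on_hull[OF cc G dom ran True A(1,2)] by auto
  next
    case False
    \<comment> \<open>An element \<open>e\<close> outside \<open>N\<close> is regular, so \<open>I\<close> is a directed union of free cyclic modules.\<close>
    then obtain e where e: "e \<in> I" "e \<notin> N" by blast
    have ec: "e \<in> carrier R" using e I.Icarr by blast
    have zG: "{(\<zero>, \<zero>)} \<subseteq> G" using linear_relationD(3)[OF G] by simp
    have cmp: "(\<exists>r\<in>carrier R. v = r \<otimes> w) \<or> (\<exists>r\<in>carrier R. w = r \<otimes> v)"
      if "v \<in> carrier R" "w \<in> carrier R" "v \<notin> N \<or> w \<notin> N" for v w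
      using that by (cases rule: comparable_cases) auto
    have diff: "v \<ominus> t \<otimes> w \<in> {\<zero>} \<longleftrightarrow> v = t \<otimes> w" if "v \<in> carrier R" "t \<in> carrier R" "w \<in> carrier R" for v t w
      using that by simp
    have tors: "\<exists>s\<in>carrier R - N. \<exists>r\<in>carrier R. s \<otimes> v \<ominus> r \<otimes> e \<in> {\<zero>}" if v: "v \<in> I" for v
    proof -
      have vc: "v \<in> carrier R" using v I.Icarr by blast
      from cmp[OF vc ec disjI2[OF e(2)]] show ?thesis
      proof (elim disjE bexE)
        fix r assume "r \<in> carrier R" "v = r \<otimes> e"
        then have "\<one> \<otimes> v \<ominus> r \<otimes> e \<in> {\<zero>}" using ec by simp
        then show ?thesis using one_notin_N \<open>r \<in> carrier R\<close> by blast
      next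
        fix r assume r: "r \<in> carrier R" "e = r \<otimes> v"
        have "r \<notin> N"
        proof
          assume "r \<in> N"
          then have "v \<otimes> r \<in> N" using N_mult[OF vc] by blast
          then show False using r vc e(2) by (simp add: m_comm)
        qed
        moreover have "r \<otimes> v \<ominus> \<one> \<otimes> e \<in> {\<zero>}" using r vc by simp
        ultimately show ?thesis using r(1) one_closed by blast
      qed
    qed
    have dir: "\<exists>u\<in>I. \<exists>t\<in>carrier R. \<exists>t'\<in>carrier R. v \<ominus> t \<otimes> u \<in> {\<zero>} \<and> v' \<ominus> t' \<otimes> u \<in> {\<zero>}"
      if v: "v \<in> I" and v': "v' \<in> I" for v v'
    proof -
      have c: "v \<in> carrier R" "v' \<in> carrier R" using v v' I.Icarr by auto
      have mult: ?thesis if "u \<in> I" "t \<in> carrier R" "t' \<in> carrier R" "v = t \<otimes> u" "v' = t' \<otimes> u" for u t t'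
        using that diff[OF c(1), of t u] diff[OF c(2), of t' u] I.Icarr[of u] by blast
      show ?thesis
      proof (cases "v \<in> N \<and> v' \<in> N")
        case True
        obtain y where "y \<in> N" "v = e \<otimes> y" using divisible[OF ec e(2)] True by blast
        moreover obtain y' where "y' \<in> N" "v' = e \<otimes> y'" using divisible[OF ec e(2)] True by blast
        ultimately show ?thesis using mult[OF e(1), of y y'] N_carr ec m_comm by simp
      next
        case False
        then have "v \<notin> N \<or> v' \<notin> N" by blast
        from cmp[OF c this] show ?thesis
        proof (elim disjE bexE)
          show ?thesis if "r \<in> carrier R" "v = r \<otimes> v'" for r using mult[OF v' that(1) one_closed that(2)] c by simp
          show ?thesis if "r \<in> carrier R" "v' = r \<otimes> v" for r using mult[OF v one_closed that(1) _ that(2)] c by simp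
        qed
      qed
    qed
    have ann: "r \<otimes> x = \<zero>" if r: "r \<in> carrier R" and re: "r \<otimes> e \<in> {\<zero>}" and x: "x \<in> I" for r x
    proof -
      have "e \<otimes> r = \<zero>" using r re ec by (simp add: m_comm)
      then have "r = \<zero>" using torsionfree[OF ec e(2) r] by blast
      then show ?thesis using x I.Icarr by simp
    qed
    obtain h where "linear_map h" "h \<subseteq> G" "Domain h = I"
      by (rule extend_section[OF cc G dom ran linear_map_zero zG _ I _ e(1) tors dir ann]) auto
    then show ?thesis by blast
  qed
qed

end

section \<open>Finite rank and quasi-projective ideals imply linear compactness\<close>

context nonchain_fqp
begin

lemma hull_singleton_uniserial:
  assumes b: "b \<in> N" and v: "v \<in> pure hull {b}" and w: "w \<in> pure hull {b}"
  shows "(\<exists>r\<in>carrier R. v = r \<otimes> w) \<or> (\<exists>r\<in>carrier R. w = r \<otimes> v)"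
proof -
  have N: "v \<in> N" "w \<in> N" using v w hull_N[of "{b}"] b by auto
  obtain s r where sr: "s \<in> carrier R - N" "r \<in> carrier R" "s \<otimes> v = r \<otimes> b"
    using v mem_hull_singleton_iff[OF b] by blast
  obtain t q where tq: "t \<in> carrier R - N" "q \<in> carrier R" "t \<otimes> w = q \<otimes> b"
    using w mem_hull_singleton_iff[OF b] by blast
  have "(\<exists>k\<in>carrier R. v \<ominus> k \<otimes> w \<in> {\<zero>}) \<or> (\<exists>k\<in>carrier R. w \<ominus> k \<otimes> v \<in> {\<zero>})"
    using sr(2,3) tq(2,3) N_carr[OF b]
    by (intro rank_one_uniserial[OF pure_zero b N sr(1) tq(1) sr(2) tq(2)]) auto
  then show ?thesis using N N_carr by auto
qed

lemma incomparable_hulls_disjoint: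
  assumes ab: "incomparable a b" and va: "v \<in> pure hull {a}" and vb: "v \<in> pure hull {b}"
  shows "v = \<zero>"
proof -
  obtain s r where sr: "s \<in> carrier R - N" "r \<in> carrier R" "s \<otimes> v = r \<otimes> a"
    using va mem_hull_singleton_iff[OF incomparable_N(1)[OF ab]] by blast
  obtain t q where tq: "t \<in> carrier R - N" "q \<in> carrier R" "t \<otimes> v = q \<otimes> b"
    using vb mem_hull_singleton_iff[OF incomparable_N(2)[OF ab]] by blast
  have c: "v \<in> carrier R" "s \<in> carrier R" "t \<in> carrier R" "a \<in> carrier R" "b \<in> carrier R"
    using hull_N[of "{a}" v] va incomparable_N[OF ab] N_carr sr tq by auto
  have "(t \<otimes> r) \<otimes> a = t \<otimes> (s \<otimes> v)" unfolding sr(3) using c sr(2) by algebra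
  also have "\<dots> = (t \<otimes> s) \<otimes> v" using c by algebra
  finally have 1: "(t \<otimes> r) \<otimes> a = (t \<otimes> s) \<otimes> v" .
  have "(t \<otimes> s) \<otimes> v = s \<otimes> (t \<otimes> v)" using c by algebra
  also have "\<dots> = (s \<otimes> q) \<otimes> b" unfolding tq(3) using c tq(2) by algebra
  finally have "(t \<otimes> r) \<otimes> a = (s \<otimes> q) \<otimes> b" using 1 by simp
  then have "(t \<otimes> r) \<otimes> a = \<zero>" using disjoint[OF ab, of "t \<otimes> r" "s \<otimes> q"] c sr(2) tq(2) by simp
  then show ?thesis using 1 torsionfree[of "t \<otimes> s" v] N_complement_mult[OF tq(1) sr(1)] c by auto
qed

text \<open>
  Write \<open>Q\<close> for the quotient field of \<open>R/N\<close>. Every \<open>s\<close> in \<open>Qb\<close> is \<open>\<sigma>b\<close> with \<open>\<sigma> \<in> Q\<close>. For all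
  given pairs \<open>(y, s)\<close> put \<open>u = a/\<sigma>\<close> and \<open>z = y/\<sigma>\<close>; the elements \<open>u\<close> generate a submodule \<open>B\<close> of
  \<open>Qa\<close>, and the congruences \<open>x = y\<close> modulo \<open>Rs\<close> are compatible precisely when \<open>u \<mapsto> z\<close> defines a
  homomorphism from \<open>B\<close> to \<open>Qb/Rb\<close>. Lift it to an endomorphism of the ideal \<open>B + Qb\<close>. Its
  restriction to \<open>B\<close> extends to a \<open>Q\<close>-linear map on \<open>Qa\<close>, whose value \<open>x\<close> at \<open>a\<close> solves all
  congruences.
\<close>

lemma principal_congruences_solvable:
  assumes ab: "incomparable a b" and lift: "\<And>I. ideal I R \<Longrightarrow> liftable I"
    and P: "P \<noteq> {}" "\<And>y s. (y, s) \<in> P \<Longrightarrow> y \<in> pure hull {b} \<and> s \<in> pure hull {b} \<and> s \<noteq> \<zero>"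
    and compat: "\<And>y s y' s' r. (y, s) \<in> P \<Longrightarrow> (y', s') \<in> P \<Longrightarrow> r \<in> carrier R \<Longrightarrow> s' = r \<otimes> s \<Longrightarrow>
      \<exists>k\<in>carrier R. y \<ominus> y' = k \<otimes> s"
  shows "\<exists>x\<in>carrier R. \<forall>(y, s)\<in>P. \<exists>t\<in>carrier R. x \<ominus> y = t \<otimes> s"
proof -
  let ?H = "pure hull {b}"
  have aN: "a \<in> N" and bN: "b \<in> N" using incomparable_N[OF ab] by auto
  have ac: "a \<in> carrier R" and bc: "b \<in> carrier R" using aN bN N_carr by auto
  have PH: "pure ?H" using bN by (intro pure_hull) simp
  interpret H: ideal ?H R by (rule pureD(1)[OF PH])
  have HN: "v \<in> N" "v \<in> carrier R" if "v \<in> ?H" for v using that pureD(2)[OF PH] N_carr by auto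
  have bH: "b \<in> ?H" by (rule hull_inc) simp
  \<comment> \<open>Here \<open>\<sigma> = p/q\<close>.\<close>
  define S where "S = (\<lambda>(y, s, p, q, u, z). (y, s) \<in> P \<and> p \<in> carrier R - N \<and> q \<in> carrier R - N \<and>
      u \<in> N \<and> z \<in> N \<and> q \<otimes> s = p \<otimes> b \<and> p \<otimes> u = q \<otimes> a \<and> p \<otimes> z = q \<otimes> y)"
  have SD: "(y, s) \<in> P" "p \<in> carrier R - N" "q \<in> carrier R - N" "u \<in> N" "z \<in> N"
    "q \<otimes> s = p \<otimes> b" "p \<otimes> u = q \<otimes> a" "p \<otimes> z = q \<otimes> y" if "S (y, s, p, q, u, z)" for y s p q u z
    using that by (auto simp: S_def)
  have Sc: "p \<in> carrier R" "q \<in> carrier R" "u \<in> carrier R" "z \<in> carrier R" "s \<in> carrier R" "y \<in> carrier R"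
    "y \<in> ?H" "s \<in> ?H" if "S (y, s, p, q, u, z)" for y s p q u z
    using SD[OF that] P(2) N_carr HN by auto
  have Sex: "\<exists>p q u z. S (y, s, p, q, u, z)" if "(y, s) \<in> P" for y s
  proof -
    have ys: "y \<in> ?H" "s \<in> ?H" "s \<noteq> \<zero>" using P(2)[OF that] by auto
    then obtain q p where qp: "q \<in> carrier R - N" "p \<in> carrier R" "q \<otimes> s = p \<otimes> b"
      using mem_hull_singleton_iff[OF bN] by blast
    have pN: "p \<notin> N"
    proof
      assume "p \<in> N"
      then have "q \<otimes> s = \<zero>" using qp(3) N_mult_N[OF _ bN] by simp
      then show False using torsionfree[of q s] qp(1) HN(2)[OF ys(2)] ys(3) by auto
    qed
    have qc: "q \<in> carrier R" using qp(1) by simp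
    obtain u where u: "u \<in> N" "q \<otimes> a = p \<otimes> u" using divisible[OF qp(2) pN N_mult[OF qc aN]] by blast
    obtain z where z: "z \<in> N" "q \<otimes> y = p \<otimes> z" using divisible[OF qp(2) pN N_mult[OF qc HN(1)[OF ys(1)]]] by blast
    have "S (y, s, p, q, u, z)" using that qp pN u z by (simp add: S_def)
    then show ?thesis by blast
  qed
  define Z where "Z = {(u, z). \<exists>y s p q. S (y, s, p, q, u, z)}"
  have ZE: "\<exists>y s p q. S (y, s, p, q, u, z)" if "(u, z) \<in> Z" for u z using that by (simp add: Z_def)
  have Zprop: "u \<in> pure hull {a}" "u \<noteq> \<zero>" "z \<in> ?H" "u \<in> carrier R" "z \<in> carrier R" "u \<in> N" if uz: "(u, z) \<in> Z" for u z
  proof -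
    obtain y s p q where S: "S (y, s, p, q, u, z)" using ZE[OF uz] by blast
    note d = SD[OF S] and c = Sc[OF S]
    show "u \<in> pure hull {a}" using mem_hull_singleton_iff[OF aN] d(2,4,7) c(2) by blast
    show "u \<noteq> \<zero>"
    proof
      assume "u = \<zero>"
      then have "q \<otimes> a = \<zero>" using d(7) c by simp
      then show False using torsionfree[of q a] d(3) ac incomparableD(5)[OF ab] by auto
    qed
    have "p \<otimes> z \<in> ?H" unfolding d(8) by (rule H.I_l_closed[OF c(7,2)])
    then show "z \<in> ?H" by (rule pureD(3)[OF PH d(2,5)])
    show "u \<in> carrier R" "z \<in> carrier R" "u \<in> N" using c d by auto
  qed
  have step: "\<exists>r\<in>carrier R. \<exists>k\<in>carrier R. u = r \<otimes> u' \<and> z = r \<otimes> z' \<oplus> k \<otimes> b"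
    if S: "S (y, s, p, q, u, z)" and S': "S (y', s', p', q', u', z')" and r: "r \<in> carrier R" and s': "s' = r \<otimes> s"
    for y s p q u z y' s' p' q' u' z' r
  proof -
    note d = SD[OF S] and c = Sc[OF S] and d' = SD[OF S'] and c' = Sc[OF S']
    obtain k where k: "k \<in> carrier R" "y \<ominus> y' = k \<otimes> s" using compat[OF d(1) d'(1) r s'] by blast
    note cc = c(1-6) c'(1-6) r k(1) ac bc
    have pp: "p \<otimes> p' \<in> carrier R - N" by (rule N_complement_mult[OF d(2) d'(2)])
    \<comment> \<open>\<open>\<sigma>' = r\<sigma>\<close>, which holds only modulo \<open>N\<close> and hence after multiplication with elements of \<open>N\<close>.\<close>
    define n where "n = q \<otimes> p' \<ominus> (q' \<otimes> r) \<otimes> p"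
    have nc: "n \<in> carrier R" using cc by (simp add: n_def)
    have "q \<otimes> (q' \<otimes> s') = (q' \<otimes> r) \<otimes> (q \<otimes> s)" unfolding s' using cc by algebra
    then have eq: "q \<otimes> (p' \<otimes> b) = (q' \<otimes> r) \<otimes> (p \<otimes> b)" unfolding d(6) d'(6) .
    have "n \<otimes> b = q \<otimes> (p' \<otimes> b) \<ominus> (q' \<otimes> r) \<otimes> (p \<otimes> b)" unfolding n_def using cc by algebra
    then have "n \<otimes> b = \<zero>" unfolding eq using cc by simp
    then have nN: "n \<in> N" using annihilator_N[OF nc bc incomparableD(6)[OF ab]] by simp
    have sub: "(q' \<otimes> r) \<otimes> (p \<otimes> v) = q \<otimes> (p' \<otimes> v)" if v: "v \<in> N" for v
    proof -
      have "(q' \<otimes> r) \<otimes> (p \<otimes> v) = q \<otimes> (p' \<otimes> v) \<ominus> n \<otimes> v" unfolding n_def using cc N_carr[OF v] by algebra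
      then show ?thesis using N_mult_N[OF nN v] cc N_carr[OF v] by (simp add: a_minus_def)
    qed
    have "(p \<otimes> p') \<otimes> u = p' \<otimes> (p \<otimes> u)" using cc by algebra
    also have "\<dots> = q \<otimes> (p' \<otimes> a)" unfolding d(7) using cc by algebra
    also have "\<dots> = (q' \<otimes> r) \<otimes> (p \<otimes> a)" using sub[OF aN] by simp
    also have "\<dots> = (p \<otimes> r) \<otimes> (q' \<otimes> a)" using cc by algebra
    also have "\<dots> = (p \<otimes> p') \<otimes> (r \<otimes> u')" unfolding d'(7)[symmetric] using cc by algebra
    finally have u: "u = r \<otimes> u'" using cancel[of "p \<otimes> p'"] pp cc by simp
    have "(p \<otimes> p') \<otimes> (r \<otimes> z') = (p \<otimes> r) \<otimes> (p' \<otimes> z')" using cc by algebra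
    also have "\<dots> = (q' \<otimes> r) \<otimes> (p \<otimes> y')" unfolding d'(8) using cc by algebra
    also have "\<dots> = q \<otimes> (p' \<otimes> y')" by (rule sub[OF HN(1)[OF c'(7)]])
    finally have z': "(p \<otimes> p') \<otimes> (r \<otimes> z') = q \<otimes> (p' \<otimes> y')" .
    have "(p \<otimes> p') \<otimes> z = p' \<otimes> (p \<otimes> z)" using cc by algebra
    also have "\<dots> = q \<otimes> (p' \<otimes> y') \<oplus> (q \<otimes> p') \<otimes> (y \<ominus> y')" unfolding d(8) using cc by algebra
    also have "\<dots> = (p \<otimes> p') \<otimes> (r \<otimes> z') \<oplus> (p' \<otimes> k) \<otimes> (q \<otimes> s)" unfolding z' k(2) using cc by algebra
    also have "\<dots> = (p \<otimes> p') \<otimes> (r \<otimes> z' \<oplus> k \<otimes> b)" unfolding d(6) using cc by algebra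
    finally have "z = r \<otimes> z' \<oplus> k \<otimes> b" using cancel[of "p \<otimes> p'"] pp cc by simp
    then show ?thesis using u r k(1) by blast
  qed
  have Zchain: "(\<exists>r\<in>carrier R. \<exists>k\<in>carrier R. u = r \<otimes> u' \<and> z = r \<otimes> z' \<oplus> k \<otimes> b) \<or>
      (\<exists>r\<in>carrier R. \<exists>k\<in>carrier R. u' = r \<otimes> u \<and> z' = r \<otimes> z \<oplus> k \<otimes> b)"
    if uz: "(u, z) \<in> Z" and uz': "(u', z') \<in> Z" for u z u' z'
  proof -
    obtain y s p q where S: "S (y, s, p, q, u, z)" using ZE[OF uz] by blast
    obtain y' s' p' q' where S': "S (y', s', p', q', u', z')" using ZE[OF uz'] by blast
    from hull_singleton_uniserial[OF bN Sc(8)[OF S] Sc(8)[OF S']] show ?thesis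
    proof (elim disjE bexE)
      fix r assume "r \<in> carrier R" "s = r \<otimes> s'"
      from step[OF S' S this] show ?thesis by (rule disjI2)
    next
      fix r assume "r \<in> carrier R" "s' = r \<otimes> s"
      from step[OF S S' this] show ?thesis by (rule disjI1)
    qed
  qed
  define G where "G = {(c \<otimes> u \<oplus> w, c \<otimes> z \<oplus> t \<otimes> b) | c u z w t.
      (u, z) \<in> Z \<and> c \<in> carrier R \<and> t \<in> carrier R \<and> w \<in> ?H}"
  have GI: "(v, x) \<in> G" if "v = c \<otimes> u \<oplus> w" "x = c \<otimes> z \<oplus> t \<otimes> b" "(u, z) \<in> Z" "c \<in> carrier R" "t \<in> carrier R" "w \<in> ?H"
    for v x c u z w t using that unfolding G_def by blast
  have GE: "\<exists>c u z w t. v = c \<otimes> u \<oplus> w \<and> x = c \<otimes> z \<oplus> t \<otimes> b \<and> (u, z) \<in> Z \<and> c \<in> carrier R \<and> t \<in> carrier R \<and> w \<in> ?H"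
    if "(v, x) \<in> G" for v x using that unfolding G_def by blast
  obtain y0 s0 where ys0: "(y0, s0) \<in> P" using P(1) by auto
  obtain p0 q0 u0 z0 where S0: "S (y0, s0, p0, q0, u0, z0)" using Sex[OF ys0] by blast
  have Z0: "(u0, z0) \<in> Z" using S0 unfolding Z_def by blast
  note d0 = SD[OF S0] and c0 = Sc[OF S0]
  have H_dom: "(w, t \<otimes> b) \<in> G" if "w \<in> ?H" "t \<in> carrier R" for w t
    by (rule GI[OF _ _ Z0 zero_closed that(2,1)]) (use c0 HN(2)[OF that(1)] that(2) bc in auto)
  have G: "linear_relation G"
  proof (rule linear_relationI)
    fix v x assume "(v, x) \<in> G"
    then obtain c u z w t where "v = c \<otimes> u \<oplus> w" "x = c \<otimes> z \<oplus> t \<otimes> b" "(u, z) \<in> Z" "c \<in> carrier R" "t \<in> carrier R" "w \<in> ?H"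
      using GE by metis
    then show "v \<in> carrier R \<and> x \<in> carrier R" using Zprop[of u z] HN(2) bc by simp
  next
    show "(\<zero>, \<zero>) \<in> G" using H_dom[OF H.zero_closed zero_closed] bc by simp
  next
    have add: "(v \<oplus> v', x \<oplus> x') \<in> G"
      if v: "v = c \<otimes> u \<oplus> w" and x: "x = c \<otimes> z \<oplus> t \<otimes> b" and uz: "(u, z) \<in> Z" and c: "c \<in> carrier R" and t: "t \<in> carrier R" and w: "w \<in> ?H"
      and v': "v' = c' \<otimes> u' \<oplus> w'" and x': "x' = c' \<otimes> z' \<oplus> t' \<otimes> b" and uz': "(u', z') \<in> Z" and c': "c' \<in> carrier R"
      and t': "t' \<in> carrier R" and w': "w' \<in> ?H" and r: "r \<in> carrier R" and k: "k \<in> carrier R"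
      and u: "u = r \<otimes> u'" and z: "z = r \<otimes> z' \<oplus> k \<otimes> b"
      for v v' x x' c u z w t c' u' z' w' t' r k
    proof (rule GI[OF _ _ uz'])
      note cc = c t c' t' r k bc HN(2)[OF w] HN(2)[OF w'] Zprop(4,5)[OF uz']
      show "v \<oplus> v' = (c \<otimes> r \<oplus> c') \<otimes> u' \<oplus> (w \<oplus> w')" unfolding v v' u using cc by algebra
      show "x \<oplus> x' = (c \<otimes> r \<oplus> c') \<otimes> z' \<oplus> (c \<otimes> k \<oplus> t \<oplus> t') \<otimes> b" unfolding x x' z using cc by algebra
    qed (use c c' r k t t' w w' in auto)
    fix v x v' x' assume vx: "(v, x) \<in> G" and vx': "(v', x') \<in> G"
    obtain c u z w t where 1: "v = c \<otimes> u \<oplus> w" "x = c \<otimes> z \<oplus> t \<otimes> b" "(u, z) \<in> Z" "c \<in> carrier R" "t \<in> carrier R" "w \<in> ?H"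
      using GE[OF vx] by metis
    obtain c' u' z' w' t' where 2: "v' = c' \<otimes> u' \<oplus> w'" "x' = c' \<otimes> z' \<oplus> t' \<otimes> b" "(u', z') \<in> Z" "c' \<in> carrier R" "t' \<in> carrier R" "w' \<in> ?H"
      using GE[OF vx'] by metis
    have cc: "v \<in> carrier R" "v' \<in> carrier R" "x \<in> carrier R" "x' \<in> carrier R"
      using 1 2 Zprop(4,5)[OF 1(3)] Zprop(4,5)[OF 2(3)] HN(2) bc by auto
    from Zchain[OF 1(3) 2(3)] show "(v \<oplus> v', x \<oplus> x') \<in> G"
    proof (elim disjE bexE conjE)
      fix r k assume "r \<in> carrier R" "k \<in> carrier R" "u = r \<otimes> u'" "z = r \<otimes> z' \<oplus> k \<otimes> b"
      from add[OF 1 2 this] show ?thesis .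
    next
      fix r k assume "r \<in> carrier R" "k \<in> carrier R" "u' = r \<otimes> u" "z' = r \<otimes> z \<oplus> k \<otimes> b"
      from add[OF 2 1 this] show ?thesis using cc by (simp add: a_comm)
    qed
  next
    fix r v x assume r: "r \<in> carrier R" and vx: "(v, x) \<in> G"
    obtain c u z w t where 1: "v = c \<otimes> u \<oplus> w" "x = c \<otimes> z \<oplus> t \<otimes> b" "(u, z) \<in> Z" "c \<in> carrier R" "t \<in> carrier R" "w \<in> ?H"
      using GE[OF vx] by metis
    note cc = r 1(4,5) HN(2)[OF 1(6)] Zprop(4,5)[OF 1(3)] bc
    show "(r \<otimes> v, r \<otimes> x) \<in> G"
    proof (rule GI[OF _ _ 1(3)])
      show "r \<otimes> v = (r \<otimes> c) \<otimes> u \<oplus> r \<otimes> w" unfolding 1(1) using cc by algebra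
      show "r \<otimes> x = (r \<otimes> c) \<otimes> z \<oplus> (r \<otimes> t) \<otimes> b" unfolding 1(2) using cc by algebra
    qed (use r 1 H.I_l_closed in auto)
  qed
  have ran: "x \<in> ?H" if vx: "(v, x) \<in> G" for v x
  proof -
    obtain c u z w t where "x = c \<otimes> z \<oplus> t \<otimes> b" "(u, z) \<in> Z" "c \<in> carrier R" "t \<in> carrier R"
      using GE[OF vx] by metis
    then show ?thesis using Zprop(3) bH by (simp add: H.I_l_closed)
  qed
  have "Range G \<subseteq> Domain G"
  proof
    fix x assume "x \<in> Range G"
    then have "x \<in> ?H" using ran by blast
    from H_dom[OF this zero_closed] show "x \<in> Domain G" by blast
  qed
  then obtain g where gG: "g \<subseteq> G" and g: "linear_map g" and domg: "Domain g = Domain G"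
    using liftableE[OF lift[OF linear_relation_Domain[OF G]] G refl] by metis
  have glin: "linear_relation g" using g by (simp add: linear_map_def)
  have fibre: "\<exists>t\<in>carrier R. x = t \<otimes> b" if x0: "(\<zero>, x) \<in> G" for x
  proof -
    obtain c u z w t where 1: "\<zero> = c \<otimes> u \<oplus> w" "x = c \<otimes> z \<oplus> t \<otimes> b" "(u, z) \<in> Z" "c \<in> carrier R" "t \<in> carrier R" "w \<in> ?H"
      using GE[OF x0] by metis
    note uz = Zprop[OF 1(3)]
    have "\<ominus> (c \<otimes> u) = w"
      using 1(1,4) HN(2)[OF 1(6)] uz(4) by (intro minus_equality) (auto simp: a_comm)
    then have "c \<otimes> u = \<ominus> w" using 1(4) uz(4) by (metis m_closed minus_minus)
    then have "c \<otimes> u \<in> ?H" using 1(6) by simp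
    moreover have "c \<otimes> u \<in> pure hull {a}"
      using uz(1) 1(4) aN by (intro ideal.I_l_closed[OF pureD(1)[OF pure_hull]]) auto
    ultimately have "c \<otimes> u = \<zero>" using incomparable_hulls_disjoint[OF ab] by blast
    then have "c \<in> N" using annihilator_N[OF 1(4) uz(4,2)] by simp
    then have "c \<otimes> z = \<zero>" using N_mult_N HN(1)[OF uz(3)] by blast
    then have "x = t \<otimes> b" using 1(2,5) bc by simp
    then show ?thesis using 1(5) by blast
  qed
  have uzG: "(u, z) \<in> G" if "(u, z) \<in> Z" for u z
    by (rule GI[OF _ _ that one_closed zero_closed H.zero_closed]) (use Zprop(4,5)[OF that] bc in auto)
  have g_ex: "\<exists>x. (u, x) \<in> g" if "(u, z) \<in> Z" for u z using uzG[OF that] domg by blast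
  obtain x0 where x0: "(u0, x0) \<in> g" using g_ex[OF Z0] by blast
  have x0N: "x0 \<in> N" using x0 gG ran HN(1) by blast
  have "q0 \<notin> N" using d0(3) by simp
  obtain x where x: "x \<in> N" "p0 \<otimes> x0 = q0 \<otimes> x"
    using divisible[OF c0(2) \<open>q0 \<notin> N\<close> N_mult[OF c0(1) x0N]] by blast
  have xc: "x \<in> carrier R" "x0 \<in> carrier R" using x x0N N_carr by auto
  have "\<exists>t\<in>carrier R. x \<ominus> y = t \<otimes> s" if ys: "(y, s) \<in> P" for y s
  proof -
    obtain p q u z where S: "S (y, s, p, q, u, z)" using Sex[OF ys] by blast
    note d = SD[OF S] and c = Sc[OF S]
    have uz: "(u, z) \<in> Z" using S unfolding Z_def by blast
    obtain x1 where x1: "(u, x1) \<in> g" using g_ex[OF uz] by blast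
    have x1c: "x1 \<in> carrier R" using linear_relationD(2)[OF glin x1] .
    note cc = c(1-6) c0(1-6) xc x1c ac bc
    have "(p \<otimes> q0) \<otimes> u = q0 \<otimes> (p \<otimes> u)" using cc by algebra
    also have "\<dots> = q \<otimes> (q0 \<otimes> a)" unfolding d(7) using cc by algebra
    also have "\<dots> = (q \<otimes> p0) \<otimes> u0" unfolding d0(7)[symmetric] using cc by algebra
    finally have eq: "(p \<otimes> q0) \<otimes> u = (q \<otimes> p0) \<otimes> u0" .
    have "((p \<otimes> q0) \<otimes> u, (p \<otimes> q0) \<otimes> x1) \<in> g" using cc by (intro linear_relationD(5)[OF glin _ x1]) simp
    moreover have "((p \<otimes> q0) \<otimes> u, (q \<otimes> p0) \<otimes> x0) \<in> g"
      unfolding eq using cc by (intro linear_relationD(5)[OF glin _ x0]) simp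
    ultimately have "(p \<otimes> q0) \<otimes> x1 = (q \<otimes> p0) \<otimes> x0" by (rule linear_map_unique[OF g])
    then have "q0 \<otimes> (p \<otimes> x1) = q \<otimes> (p0 \<otimes> x0)" using cc by (simp add: m_ac)
    also have "\<dots> = q0 \<otimes> (q \<otimes> x)" unfolding x(2) using cc by (simp add: m_lcomm)
    finally have px1: "p \<otimes> x1 = q \<otimes> x" using cancel[OF c0(2) \<open>q0 \<notin> N\<close>] cc by simp
    have "(u \<ominus> u, x1 \<ominus> z) \<in> G" by (rule linear_relation_minus[OF G]) (use x1 gG uzG[OF uz] in auto)
    then have "(\<zero>, x1 \<ominus> z) \<in> G" using cc by simp
    then obtain t where t: "t \<in> carrier R" "x1 \<ominus> z = t \<otimes> b" using fibre by blast
    have "q \<otimes> (x \<ominus> y) = q \<otimes> x \<ominus> q \<otimes> y" using cc by algebra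
    also have "\<dots> = p \<otimes> (x1 \<ominus> z)" unfolding px1[symmetric] d(8)[symmetric] using cc by algebra
    also have "\<dots> = t \<otimes> (p \<otimes> b)" unfolding t(2) using cc t(1) by algebra
    also have "\<dots> = q \<otimes> (t \<otimes> s)" unfolding d(6)[symmetric] using cc t(1) by algebra
    finally have "x \<ominus> y = t \<otimes> s" using cancel[of q] d(3) cc t(1) by simp
    then show ?thesis using t(1) by blast
  qed
  then show ?thesis using xc(1) by blast
qed

text \<open>
  Affine subsets of the uniserial module \<open>Qb\<close> that meet are nested, so only families without a
  least member matter; there, between a member and a smaller one fits a coset of some \<open>Rs\<close>.
\<close>

lemma coset_compact_hull_singleton:
  assumes ab: "incomparable a b" and lift: "\<And>I. ideal I R \<Longrightarrow> liftable I"
  shows "coset_compact (pure hull {b})"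
proof (rule coset_compactI)
  let ?H = "pure hull {b}"
  have bN: "b \<in> N" using incomparable_N[OF ab] by auto
  have PH: "pure ?H" using bN by (intro pure_hull) simp
  interpret H: ideal ?H R by (rule pureD(1)[OF PH])
  fix \<X> assume aff: "\<And>X. X \<in> \<X> \<Longrightarrow> affine X"
    and fip: "\<And>\<G>. finite \<G> \<Longrightarrow> \<G> \<subseteq> \<X> \<Longrightarrow> \<exists>x\<in>?H. \<forall>X\<in>\<G>. x \<in> X"
  show "\<exists>x\<in>?H. \<forall>X\<in>\<X>. x \<in> X"
  proof (cases "\<X> = {} \<or> (\<exists>X0\<in>\<X>. \<forall>X\<in>\<X>. X0 \<inter> ?H \<subseteq> X)")
    case True
    then show ?thesis
    proof
      assume "\<X> = {}"
      then show ?thesis using H.zero_closed by blast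
    next
      assume "\<exists>X0\<in>\<X>. \<forall>X\<in>\<X>. X0 \<inter> ?H \<subseteq> X"
      then obtain X0 where X0: "X0 \<in> \<X>" "\<forall>X\<in>\<X>. X0 \<inter> ?H \<subseteq> X" by blast
      then obtain x where "x \<in> ?H" "x \<in> X0" using fip[of "{X0}"] by auto
      then show ?thesis using X0(2) by blast
    qed
  next
    case False
    then have desc: "\<exists>X\<in>\<X>. \<exists>x\<in>X0 \<inter> ?H. x \<notin> X" if "X0 \<in> \<X>" for X0
      using that by blast
    have "\<X> \<noteq> {}" using False by blast
    \<comment> \<open>A pair \<open>(y, s)\<close> in \<open>P\<close> is a congruence modulo \<open>Rs\<close> that is weaker than \<open>X\<close>.\<close>
    define P where "P = {(y, s). y \<in> ?H \<and> s \<in> ?H \<and> (\<exists>X\<in>\<X>. y \<in> X \<and> y \<oplus> s \<notin> X)}"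
    have refine: "\<exists>x c. x \<in> X0 \<and> c \<in> X0 \<and> x \<in> ?H \<and> c \<in> ?H \<and> (c, x \<ominus> c) \<in> P" if X0: "X0 \<in> \<X>" for X0
    proof -
      obtain X x where X: "X \<in> \<X>" "x \<in> X0" "x \<in> ?H" "x \<notin> X" using desc[OF X0] by blast
      obtain c where c: "c \<in> ?H" "c \<in> X0" "c \<in> X" using fip[of "{X0, X}"] X0 X(1) by auto
      have cc: "c \<in> carrier R" "x \<in> carrier R" using c X H.Icarr by auto
      have "c \<oplus> (x \<ominus> c) = x" using cc by algebra
      moreover have "x \<ominus> c \<in> ?H" using X(3) c(1) by (simp add: a_minus_def)
      ultimately have "(c, x \<ominus> c) \<in> P" unfolding P_def using c X by auto
      then show ?thesis using X c by blast
    qed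
    have "\<exists>x\<in>carrier R. \<forall>(y, s)\<in>P. \<exists>t\<in>carrier R. x \<ominus> y = t \<otimes> s"
    proof (rule principal_congruences_solvable[OF ab lift])
      obtain X0 where "X0 \<in> \<X>" using \<open>\<X> \<noteq> {}\<close> by blast
      then show "P \<noteq> {}" using refine by blast
      fix y s assume ys: "(y, s) \<in> P"
      then show "y \<in> ?H \<and> s \<in> ?H \<and> s \<noteq> \<zero>" using H.Icarr by (auto simp: P_def)
      have multiple: "\<exists>k\<in>carrier R. y \<ominus> c = k \<otimes> s"
        if y: "y \<in> ?H" "y \<in> X" and s: "s \<in> ?H" "y \<oplus> s \<notin> X" and c: "c \<in> ?H" "c \<in> X" and X: "X \<in> \<X>" for y s c X
      proof -
        have "y \<ominus> c \<in> ?H" using y(1) c(1) by (simp add: a_minus_def)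
        from hull_singleton_uniserial[OF bN this s(1)] show ?thesis
        proof (elim disjE bexE)
          fix k assume k: "k \<in> carrier R" "s = k \<otimes> (y \<ominus> c)"
          have "y \<oplus> k \<otimes> (y \<ominus> c) \<in> X" by (rule affineD(2)[OF aff[OF X] y(2) y(2) c(2) k(1)])
          then show ?thesis using k(2) s(2) by simp
        qed blast
      qed
      fix y' s' r assume ys': "(y', s') \<in> P" and r: "r \<in> carrier R" "s' = r \<otimes> s"
      obtain X where X: "X \<in> \<X>" "y \<in> ?H" "y \<in> X" "s \<in> ?H" "y \<oplus> s \<notin> X" using ys by (auto simp: P_def)
      obtain X' where X': "X' \<in> \<X>" "y' \<in> ?H" "y' \<in> X'" "s' \<in> ?H" "y' \<oplus> s' \<notin> X'" using ys' by (auto simp: P_def)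
      obtain c where c: "c \<in> ?H" "c \<in> X" "c \<in> X'" using fip[of "{X, X'}"] X(1) X'(1) by auto
      obtain k where k: "k \<in> carrier R" "y \<ominus> c = k \<otimes> s" using multiple[OF X(2-5) c(1,2) X(1)] by blast
      obtain k' where k': "k' \<in> carrier R" "y' \<ominus> c = k' \<otimes> s'" using multiple[OF X'(2-5) c(1,3) X'(1)] by blast
      have cc: "y \<in> carrier R" "y' \<in> carrier R" "c \<in> carrier R" "s \<in> carrier R" using X X' c H.Icarr by auto
      have "y \<ominus> y' = (y \<ominus> c) \<ominus> (y' \<ominus> c)" using cc by algebra
      also have "\<dots> = (k \<ominus> k' \<otimes> r) \<otimes> s" unfolding k(2) k'(2) r(2) using cc k(1) k'(1) r(1) by algebra
      finally have "y \<ominus> y' = (k \<ominus> k' \<otimes> r) \<otimes> s" .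
      moreover have "k \<ominus> k' \<otimes> r \<in> carrier R" using k(1) k'(1) r(1) by simp
      ultimately show "\<exists>k\<in>carrier R. y \<ominus> y' = k \<otimes> s" by blast
    qed
    then obtain w where wc: "w \<in> carrier R" and "\<forall>(y, s)\<in>P. \<exists>t\<in>carrier R. w \<ominus> y = t \<otimes> s" by (elim bexE)
    then have w: "\<exists>t\<in>carrier R. w \<ominus> y = t \<otimes> s" if "(y, s) \<in> P" for y s using that by auto
    have sol: "w \<in> X0 \<and> w \<in> ?H" if X0: "X0 \<in> \<X>" for X0
    proof -
      obtain x c where xc: "x \<in> X0" "c \<in> X0" "x \<in> ?H" "c \<in> ?H" "(c, x \<ominus> c) \<in> P" using refine[OF X0] by blast
      obtain t where t: "t \<in> carrier R" "w \<ominus> c = t \<otimes> (x \<ominus> c)" using w[OF xc(5)] by blast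
      have cc: "x \<in> carrier R" "c \<in> carrier R" using xc H.Icarr by auto
      have "w = c \<oplus> (w \<ominus> c)" using cc wc by algebra
      then have eq: "w = c \<oplus> t \<otimes> (x \<ominus> c)" unfolding t(2) .
      have "c \<oplus> t \<otimes> (x \<ominus> c) \<in> X0" by (rule affineD(2)[OF aff[OF X0] xc(2,1,2) t(1)])
      moreover have "c \<oplus> t \<otimes> (x \<ominus> c) \<in> ?H"
        unfolding a_minus_def using xc t(1) by (intro H.a_closed H.I_l_closed H.a_inv_closed)
      ultimately show ?thesis using eq by simp
    qed
    then show ?thesis using \<open>\<X> \<noteq> {}\<close> by blast
  qed
qed

text \<open>
  If \<open>e\<close> is not in the hull of \<open>B\<close>, then \<open>(r/s) e \<mapsto> (r/s) b\<close> identifies the quotient of the two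
  hulls with \<open>Qb\<close>.
\<close>

lemma coset_compact_hull_insert:
  assumes b: "b \<in> N" "b \<noteq> \<zero>" and ccH: "coset_compact (pure hull {b})"
    and B: "B \<subseteq> N" and e: "e \<in> N" and ccB: "coset_compact (pure hull B)"
  shows "coset_compact (pure hull (insert e B))"
proof (cases "e \<in> pure hull B")
  case True
  then show ?thesis using ccB hull_redundant by metis
next
  case False
  let ?B = "pure hull B" and ?H = "pure hull {b}"
  have P: "pure ?B" by (rule pure_hull[OF B])
  interpret P: ideal ?B R by (rule pureD(1)[OF P])
  have ec: "e \<in> carrier R" and bc: "b \<in> carrier R" using e b N_carr by auto
  define \<theta> where "\<theta> = adjoin (?B \<times> {\<zero>}) e b \<inter> N \<times> N"
  have mem_adjoin: "(v, y) \<in> adjoin (?B \<times> {\<zero>}) e b \<longleftrightarrow>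
      (\<exists>s\<in>carrier R - N. \<exists>r\<in>carrier R. s \<otimes> v \<ominus> r \<otimes> e \<in> ?B \<and> s \<otimes> y = r \<otimes> b)"
    if "v \<in> N" "y \<in> N" for v y
    by (rule mem_adjoin_zero_iff[OF P.is_ideal ec bc]) (use that N_carr in auto)
  have \<theta>I: "(v, y) \<in> \<theta>" if "v \<in> N" "y \<in> N" "s \<in> carrier R - N" "r \<in> carrier R" "s \<otimes> v \<ominus> r \<otimes> e \<in> ?B" "s \<otimes> y = r \<otimes> b"
    for v y s r using that mem_adjoin[OF that(1,2)] unfolding \<theta>_def by blast
  have \<theta>E: "v \<in> N \<and> y \<in> N \<and> (\<exists>s r. s \<in> carrier R - N \<and> r \<in> carrier R \<and> s \<otimes> v \<ominus> r \<otimes> e \<in> ?B \<and> s \<otimes> y = r \<otimes> b)"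
    if "(v, y) \<in> \<theta>" for v y using that mem_adjoin[of v y] unfolding \<theta>_def by blast
  have one: "\<one> \<in> carrier R - N" using one_notin_N by simp
  have lin: "linear_relation \<theta>"
    unfolding \<theta>_def
    by (intro linear_relation_Int linear_relation_adjoin linear_relation_Times P.is_ideal zeroideal ideal_N ec bc)
  have ker: "(v, \<zero>) \<in> \<theta> \<longleftrightarrow> v \<in> ?B" for v
  proof
    assume v0: "(v, \<zero>) \<in> \<theta>"
    obtain s r where 1: "v \<in> N" "s \<in> carrier R - N" "r \<in> carrier R" "s \<otimes> v \<ominus> r \<otimes> e \<in> ?B" "s \<otimes> \<zero> = r \<otimes> b"
      using \<theta>E[OF v0] by blast
    then have "r \<in> N" using annihilator_N[OF 1(3) bc b(2)] by simp
    then have "r \<otimes> e = \<zero>" using N_mult_N e by blast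
    then have "s \<otimes> v \<in> ?B" using 1 N_carr[OF 1(1)] by (simp add: a_minus_def)
    then show "v \<in> ?B" by (rule pureD(3)[OF P 1(2,1)])
  next
    assume v: "v \<in> ?B"
    show "(v, \<zero>) \<in> \<theta>"
      by (rule \<theta>I[OF hull_N[OF B v] N_zero one zero_closed]) (use v P.Icarr[OF v] ec bc in \<open>auto simp: a_minus_def\<close>)
  qed
  have "y = \<zero>" if y: "(\<zero>, y) \<in> \<theta>" for y
  proof -
    obtain s r where 1: "y \<in> N" "s \<in> carrier R - N" "r \<in> carrier R" "s \<otimes> \<zero> \<ominus> r \<otimes> e \<in> ?B" "s \<otimes> y = r \<otimes> b"
      using \<theta>E[OF y] by blast
    have "s \<otimes> \<zero> = \<zero>" using 1(2) by simp
    then have "\<ominus> (r \<otimes> e) \<in> ?B" using 1(3,4) ec by (simp add: a_minus_def)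
    then have "\<ominus> (\<ominus> (r \<otimes> e)) \<in> ?B" by (rule P.a_inv_closed)
    then have "r \<otimes> e \<in> ?B" using 1(3) ec by simp
    then have "r \<in> N" using pureD(3)[OF P, of r e] 1(3) e False by blast
    then have "s \<otimes> y = \<zero>" using 1(5) N_mult_N b(1) by simp
    then show ?thesis using torsionfree[of s y] 1(1,2) N_carr by simp
  qed
  then have \<theta>: "linear_map \<theta>" using lin by (simp add: linear_map_def)
  have dom: "Domain \<theta> = pure hull (insert e B)"
  proof
    show "Domain \<theta> \<subseteq> pure hull (insert e B)" using \<theta>E mem_hull_insert_iff[OF B e] by blast
    show "pure hull (insert e B) \<subseteq> Domain \<theta>"
    proof
      fix v assume "v \<in> pure hull (insert e B)"
      then obtain s r where v: "v \<in> N" "s \<in> carrier R - N" "r \<in> carrier R" "s \<otimes> v \<ominus> r \<otimes> e \<in> ?B"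
        using mem_hull_insert_iff[OF B e] by blast
      obtain y where y: "y \<in> N" "r \<otimes> b = s \<otimes> y" using divisible[OF _ _ N_mult[OF v(3) b(1)], of s] v(2) by blast
      have "(v, y) \<in> \<theta>" by (rule \<theta>I[OF v(1) y(1) v(2-4) y(2)[symmetric]])
      then show "v \<in> Domain \<theta>" by blast
    qed
  qed
  have ran: "Range \<theta> \<subseteq> ?H" using \<theta>E mem_hull_singleton_iff[OF b(1)] by blast
  show ?thesis by (rule coset_compact_extension[OF \<theta> dom ran ker ccH ccB])
qed

text \<open>
  After climbing from \<open>0\<close> to \<open>N\<close>, the last factor \<open>R/N\<close> is identified with \<open>Rb \<subseteq> Qb\<close> by
  \<open>r \<mapsto> r b\<close>.
\<close>

lemma finite_rank_liftable_imp_coset_compact: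
  assumes lift: "\<And>I. ideal I R \<Longrightarrow> liftable I" and A: "finite A" "A \<subseteq> N" "pure hull A = N"
  shows "coset_compact (carrier R)"
proof -
  obtain a b where ab: "incomparable a b" using ex_incomparable by blast
  have b: "b \<in> N" "b \<noteq> \<zero>" "b \<in> carrier R" using incomparable_N[OF ab] incomparableD[OF ab] by auto
  have ccH: "coset_compact (pure hull {b})" by (rule coset_compact_hull_singleton[OF ab lift])
  have "coset_compact (pure hull A)"
    using A(1,2)
  proof (induction A)
    case empty
    show ?case by (simp add: hull_empty coset_compact_zero)
  next
    case (insert e B)
    then show ?case using coset_compact_hull_insert[OF b(1,2) ccH, of B e] by simp
  qed
  then have ccN: "coset_compact N" using A(3) by simp
  define \<theta> where "\<theta> = {(r, r \<otimes> b) | r. r \<in> carrier R}"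
  have \<theta>: "linear_map \<theta>"
    unfolding linear_map_def
  proof
    show "linear_relation \<theta>"
    proof (rule linear_relationI)
      show "(\<zero>, \<zero>) \<in> \<theta>" using b(3) by (auto simp: \<theta>_def)
    qed (use b(3) in \<open>auto simp: \<theta>_def l_distr m_assoc\<close>)
    show "\<forall>y. (\<zero>, y) \<in> \<theta> \<longrightarrow> y = \<zero>" using b(3) by (auto simp: \<theta>_def)
  qed
  show ?thesis
  proof (rule coset_compact_extension[OF \<theta> _ _ _ ccH ccN])
    show "Domain \<theta> = carrier R" by (auto simp: \<theta>_def)
    have "r \<otimes> b \<in> pure hull {b}" if "r \<in> carrier R" for r
      using hull_inc[of b "{b}" pure] b(1) that by (intro ideal.I_l_closed[OF pureD(1)[OF pure_hull]]) auto
    then show "Range \<theta> \<subseteq> pure hull {b}" by (auto simp: \<theta>_def)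
    show "(v, \<zero>) \<in> \<theta> \<longleftrightarrow> v \<in> N" for v
    proof
      assume "(v, \<zero>) \<in> \<theta>"
      then have "v \<in> carrier R" "v \<otimes> b = \<zero>" by (auto simp: \<theta>_def)
      then show "v \<in> N" using annihilator_N b by blast
    next
      assume v: "v \<in> N"
      then have "v \<otimes> b = \<zero>" using N_mult_N b by blast
      then show "(v, \<zero>) \<in> \<theta>" unfolding \<theta>_def using N_carr[OF v] by force
    qed
  qed
qed

end

theorem theorem3p3:
  fixes R :: "('a, 'm) ring_scheme" and N :: "'a set"
  assumes "local_ring R" and "fqp_ring R" and "\<not> chain_ring R"
    and "N = nilradical R"
  shows "linearly_compact_ring R \<longleftrightarrow>
           (\<forall>I. ideal I R \<longrightarrow> quasi_projective R (ideal_module R I)) \<and>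
           finite_rank (R Quot N) (module_over_quotient (ideal_module R N))"
proof -
  interpret nonchain_fqp R by (rule nonchain_fqp_intro[OF assms(1-3)])
  have "(\<forall>I. ideal I R \<longrightarrow> quasi_projective R (ideal_module R I)) \<longleftrightarrow> (\<forall>I. ideal I R \<longrightarrow> liftable I)"
    using quasi_projective_imp_liftable liftable_imp_quasi_projective by blast
  moreover have "coset_compact (carrier R) \<longleftrightarrow> (\<forall>I. ideal I R \<longrightarrow> liftable I) \<and>
      (\<exists>A. finite A \<and> A \<subseteq> nilradical R \<and> pure hull A = nilradical R)"
    using coset_compact_imp_liftable coset_compact_imp_finite_rank finite_rank_liftable_imp_coset_compact
    by blast
  ultimately show ?thesis
    unfolding assms(4) linearly_compact_ring_iff finite_rank_iff by simp
qed

end
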